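(* Let $X_T$ be an $\mathbb{R}^n$-valued random variable (terminal value of a factor process $X$), let $R\in\mathbb{R}^n$ satisfy $\mathbb{E}[\exp(2R^\top X_T)]<\infty$, and let $\mathcal{S}=\{z\in\mathbb{C}^n:\operatorname{Re}(z)=R\}$. Let $\eta=h(X_T)$ be a square integrable claim, where $h:\mathbb{R}^n\to\mathbb{R}$ has the Fourier representation $h(x)=\int_{\mathcal{S}}e^{z^\top x}\,\zeta(dz)$ described in the context, and put $H_t=\mathbb{E}[\eta\mid\mathcal{F}_t]$ and $H(z)_t=\mathbb{E}[\exp(z^\top X_T)\mid\mathcal{F}_t]$ for $z\in\mathcal{S}$, $t\in[0,T]$. Let $S$ be a strictly positive square integrable martingale with $S_0>0$, and let $$H=H_0+\vartheta\cdot S+L,\qquad H(z)=H(z)_0+\vartheta(z)\cdot S+L(z),\quad z\in\mathcal{S},$$ be the GKW decompositions with respect to $S$. Assume that $(t,\omega,z)\mapsto H(\omega,z)_t$ is jointly progressively measurable and that $(t,\omega,z)\mapsto\vartheta(\omega,z)_t$ is jointly predictable. Then $$\vartheta=\int_{\mathcal{S}}\vartheta(z)\,\zeta(dz),\qquad \Big(\int_{\mathcal{S}}\vartheta(z)\,\zeta(dz)\Big)\cdot S=\int_{\mathcal{S}}\big(\vartheta(z)\cdot S\big)\,\zeta(dz),\qquad L=\int_{\mathcal{S}}L(z)\,\zeta(dz).$$ In particular, the GKW decomposition of $H$ with respect to $S$ is $$H=H_0+\Big(\int_{\mathcal{S}}\vartheta(z)\,\zeta(dz)\Big)\cdot S+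\int_{\mathcal{S}}L(z)\,\zeta(dz).$$
   Context: $(\Omega,\mathcal{F},\mathbb{P})$ is a complete probability space with a filtration $\mathbb{F}=(\mathcal{F}_t)_{t\in[0,T]}$, $T>0$, satisfying the usual conditions, $\mathcal{F}_0$ trivial, $\mathcal{F}=\mathcal{F}_T$. All martingales are càdlàg. A complex-valued process is a square integrable martingale if its real and imaginary parts are. Fourier representation: the two-sided Laplace transform $\widetilde h(z)$ of $h$ exists at $R$ and is integrable on $\mathcal{S}$, and $h(x)=\frac{1}{(2\pi i)^n}\int_{R-i\infty}^{R+i\infty}e^{z^\top x}\widetilde h(z)\,dz=\int_{\mathcal{S}}e^{z^\top x}\,\zeta(dz)$, where $\zeta(dz)=\frac{1}{(2\pi i)^n}\widetilde h(z)\,dz$ is a finite non-atomic complex measure on $\mathcal{S}$. GKW decomposition: for a (complex-valued) square integrable martingale $N$, the GKW decomposition with respect to $S$ is the unique decomposition $N=N_0+\theta\cdot S+L$, with $\theta$ predictable (complex-valued; real-valued if $N$ is real) and $\mathbb{E}[\int_0^T|\theta_s|^2d\langle S,S\rangle_s]<\infty$, $\theta\cdot S=\int_0^\cdot\theta_s\,dS_s$, and $L$ a (complex-valued) square integrable martingale with $L_0=0$ and $\langle L,S\rangle=0$. Integrands are identified when they agree $d\langle S,S\rangle\otimes d\mathbb{P}$-a.e. A family of processes $U(z)$, $z\in\mathcal{S}$, is jointly progressively measurable if for every $t$ the map $(s,\omega,z)\mapsto U(\omega,z)_s$ on $[0,t]\times\Omega\times\mathcal{S}$ is $\mathcal{B}([0,t])\otimes\mathcal{F}_t\otimes\mathcal{B}(\mathcal{S})$-measurable;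 it is jointly predictable if $(t,\omega,z)\mapsto U(\omega,z)_t$ is $\mathcal{P}\otimes\mathcal{B}(\mathcal{S})$-measurable, $\mathcal{P}$ being the predictable $\sigma$-algebra on $[0,T]\times\Omega$. Convention: if there is a jointly (progressively) measurable/predictable map $Y(\cdot)$ such that for every $z$ the processes $U(z)$ and $Y(z)$ are indistinguishable, then $U(\cdot)$ is identified with $Y(\cdot)$; integrals over $z$ are taken with such jointly measurable versions. Equalities between processes of the form $\int_{\mathcal S}(\vartheta(z)\cdot S)\zeta(dz)$, $\int_{\mathcal S}L(z)\zeta(dz)$ and martingales are understood up to versions. *)

theory Defs
  imports "HOL-Probability.Probability"
begin

section \<open>Filtered probability spaces\<close>

text \<open>Processes are functions \<open>real \<Rightarrow> 'a \<Rightarrow> 'b\<close> (time first); only times in \<open>{0..T}\<close> matter.\<close>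

definition usual_basis :: "'a measure \<Rightarrow> (real \<Rightarrow> 'a measure) \<Rightarrow> real \<Rightarrow> bool" where
  "usual_basis M F T \<longleftrightarrow>
     prob_space M \<and> (\<forall>N\<in>null_sets M. \<forall>B\<subseteq>N. B \<in> sets M) \<and> 0 < T \<and>
     (\<forall>t\<in>{0..T}. subalgebra M (F t)) \<and>
     (\<forall>s t. 0 \<le> s \<and> s \<le> t \<and> t \<le> T \<longrightarrow> sets (F s) \<subseteq> sets (F t)) \<and>
     null_sets M \<subseteq> sets (F 0) \<and>
     (\<forall>t\<in>{0..<T}. sets (F t) = (\<Inter>u\<in>{t<..T}. sets (F u))) \<and>
     (\<forall>B\<in>sets (F 0). measure M B = 0 \<or> measure M B = 1) \<and>
     sets (F T) = sets M"

definition cadlag_on :: "real \<Rightarrow> (real \<Rightarrow> 'b::topological_space) \<Rightarrow> bool" where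
  "cadlag_on T x \<longleftrightarrow>
     (\<forall>t\<in>{0..<T}. (x \<longlongrightarrow> x t) (at_right t)) \<and> (\<forall>t\<in>{0<..T}. \<exists>l. (x \<longlongrightarrow> l) (at_left t))"

definition indist :: "'a measure \<Rightarrow> real \<Rightarrow> (real \<Rightarrow> 'a \<Rightarrow> 'b) \<Rightarrow> (real \<Rightarrow> 'a \<Rightarrow> 'b) \<Rightarrow> bool" where
  "indist M T U V \<longleftrightarrow> (AE \<omega> in M. \<forall>t\<in>{0..T}. U t \<omega> = V t \<omega>)"

definition martingale ::
    "'a measure \<Rightarrow> (real \<Rightarrow> 'a measure) \<Rightarrow> real \<Rightarrow> (real \<Rightarrow> 'a \<Rightarrow> real) \<Rightarrow> bool" where
  "martingale M F T U \<longleftrightarrow>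
     (\<forall>t\<in>{0..T}. U t \<in> borel_measurable (F t) \<and> integrable M (U t)) \<and>
     (\<forall>s t. 0 \<le> s \<and> s \<le> t \<and> t \<le> T \<longrightarrow> (AE \<omega> in M. real_cond_exp M (F s) (U t) \<omega> = U s \<omega>)) \<and>
     (\<forall>\<omega>\<in>space M. cadlag_on T (\<lambda>t. U t \<omega>))"

definition sq_martingale ::
    "'a measure \<Rightarrow> (real \<Rightarrow> 'a measure) \<Rightarrow> real \<Rightarrow> (real \<Rightarrow> 'a \<Rightarrow> real) \<Rightarrow> bool" where
  "sq_martingale M F T U \<longleftrightarrow>
     martingale M F T U \<and> (\<forall>t\<in>{0..T}. integrable M (\<lambda>\<omega>. (U t \<omega>)\<^sup>2))"

definition sq_martingale_c ::
    "'a measure \<Rightarrow> (real \<Rightarrow> 'a measure) \<Rightarrow> real \<Rightarrow> (real \<Rightarrow> 'a \<Rightarrow> complex) \<Rightarrow> bool" where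
  "sq_martingale_c M F T U \<longleftrightarrow>
     sq_martingale M F T (\<lambda>t \<omega>. Re (U t \<omega>)) \<and> sq_martingale M F T (\<lambda>t \<omega>. Im (U t \<omega>))"

definition cond_exp_c :: "'a measure \<Rightarrow> 'a measure \<Rightarrow> ('a \<Rightarrow> complex) \<Rightarrow> 'a \<Rightarrow> complex" where
  "cond_exp_c M G f \<omega> =
     Complex (real_cond_exp M G (\<lambda>\<omega>. Re (f \<omega>)) \<omega>) (real_cond_exp M G (\<lambda>\<omega>. Im (f \<omega>)) \<omega>)"


section \<open>Predictable processes and predictable covariation\<close>

definition predictable_sigma :: "'a measure \<Rightarrow> (real \<Rightarrow> 'a measure) \<Rightarrow> real \<Rightarrow> (real \<times> 'a) measure" where
  "predictable_sigma M F T =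
     sigma ({0..T} \<times> space M)
       ({{0} \<times> B |B. B \<in> sets (F 0)} \<union>
        {{s<..t} \<times> B |s t B. 0 \<le> s \<and> s < t \<and> t \<le> T \<and> B \<in> sets (F s)})"

definition predictable ::
    "'a measure \<Rightarrow> (real \<Rightarrow> 'a measure) \<Rightarrow> real \<Rightarrow> (real \<Rightarrow> 'a \<Rightarrow> 'b::topological_space) \<Rightarrow> bool" where
  "predictable M F T \<theta> \<longleftrightarrow> (\<lambda>(t, \<omega>). \<theta> t \<omega>) \<in> borel_measurable (predictable_sigma M F T)"

text \<open>
  \<open>covariation M F T U V C\<close>: \<open>C\<close> is (a version of) the predictable covariation
  \<open>\<langle>U, V\<rangle>\<close>, that is, the predictable finite variation process null at \<open>0\<close> for which
  \<open>U V - C\<close> is a martingale. Finite variation is expressed by Jordan's decomposition.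
\<close>
definition covariation ::
    "'a measure \<Rightarrow> (real \<Rightarrow> 'a measure) \<Rightarrow> real \<Rightarrow>
     (real \<Rightarrow> 'a \<Rightarrow> real) \<Rightarrow> (real \<Rightarrow> 'a \<Rightarrow> real) \<Rightarrow> (real \<Rightarrow> 'a \<Rightarrow> real) \<Rightarrow> bool" where
  "covariation M F T U V C \<longleftrightarrow>
     predictable M F T C \<and>
     (\<forall>\<omega>\<in>space M. C 0 \<omega> = 0 \<and> cadlag_on T (\<lambda>t. C t \<omega>) \<and>
        (\<exists>f g. mono_on {0..T} f \<and> mono_on {0..T} g \<and> (\<forall>t\<in>{0..T}. C t \<omega> = f t - g t))) \<and>
     martingale M F T (\<lambda>t \<omega>. U t \<omega> * V t \<omega> - C t \<omega>)"

text \<open>For \<open>\<langle>U, U\<rangle>\<close> the version with nondecreasing paths is taken, so that it induces a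
  measure on the time axis.\<close>
definition quad_variation ::
    "'a measure \<Rightarrow> (real \<Rightarrow> 'a measure) \<Rightarrow> real \<Rightarrow>
     (real \<Rightarrow> 'a \<Rightarrow> real) \<Rightarrow> (real \<Rightarrow> 'a \<Rightarrow> real) \<Rightarrow> bool" where
  "quad_variation M F T U A \<longleftrightarrow>
     covariation M F T U U A \<and> (\<forall>\<omega>\<in>space M. mono_on {0..T} (\<lambda>t. A t \<omega>))"

text \<open>The measure \<open>dA(\<omega>)\<close>; the path is extended constantly outside \<open>{0..T}\<close>,
  so all mass lies in \<open>{0<..T}\<close>.\<close>
definition path_measure :: "real \<Rightarrow> (real \<Rightarrow> 'a \<Rightarrow> real) \<Rightarrow> 'a \<Rightarrow> real measure" where
  "path_measure T A \<omega> = interval_measure (\<lambda>t. A (max 0 (min T t)) \<omega>)"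

definition L2_energy ::
    "'a measure \<Rightarrow> real \<Rightarrow> (real \<Rightarrow> 'a \<Rightarrow> real) \<Rightarrow> (real \<Rightarrow> 'a \<Rightarrow> 'b::real_normed_vector) \<Rightarrow> ennreal" where
  "L2_energy M T A \<theta> =
     (\<integral>\<^sup>+\<omega>. (\<integral>\<^sup>+t\<in>{0..T}. ennreal ((norm (\<theta> t \<omega>))\<^sup>2) \<partial>path_measure T A \<omega>) \<partial>M)"


section \<open>Stochastic integration and GKW decomposition\<close>

text \<open>
  An elementary integrand \<open>\<Sum>\<^sub>i \<phi>\<^sub>i 1\<^bsub>(s\<^sub>i, u\<^sub>i]\<^esub>\<close> is given by the list of the triples
  \<open>(s\<^sub>i, u\<^sub>i, \<phi>\<^sub>i)\<close>.
\<close>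
definition elementary ::
    "'a measure \<Rightarrow> (real \<Rightarrow> 'a measure) \<Rightarrow> real \<Rightarrow> (real \<times> real \<times> ('a \<Rightarrow> real)) list \<Rightarrow> bool" where
  "elementary M F T E \<longleftrightarrow>
     (\<forall>(s, u, \<phi>)\<in>set E. 0 \<le> s \<and> s \<le> u \<and> u \<le> T \<and> \<phi> \<in> borel_measurable (F s) \<and>
        (\<exists>c. \<forall>\<omega>\<in>space M. \<bar>\<phi> \<omega>\<bar> \<le> c))"

definition elem_process :: "(real \<times> real \<times> ('a \<Rightarrow> real)) list \<Rightarrow> real \<Rightarrow> 'a \<Rightarrow> real" where
  "elem_process E t \<omega> = (\<Sum>(s, u, \<phi>)\<leftarrow>E. \<phi> \<omega> * indicator {s<..u} t)"

definition elem_integral ::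
    "(real \<Rightarrow> 'a \<Rightarrow> real) \<Rightarrow> (real \<times> real \<times> ('a \<Rightarrow> real)) list \<Rightarrow> real \<Rightarrow> 'a \<Rightarrow> real" where
  "elem_integral S E t \<omega> = (\<Sum>(s, u, \<phi>)\<leftarrow>E. \<phi> \<omega> * (S (min u t) \<omega> - S (min s t) \<omega>))"

text \<open>Throughout, \<open>A\<close> stands for \<open>\<langle>S, S\<rangle>\<close>.\<close>

definition L2_integrand ::
    "'a measure \<Rightarrow> (real \<Rightarrow> 'a measure) \<Rightarrow> real \<Rightarrow> (real \<Rightarrow> 'a \<Rightarrow> real) \<Rightarrow>
     (real \<Rightarrow> 'a \<Rightarrow> 'b::real_normed_vector) \<Rightarrow> bool" where
  "L2_integrand M F T A \<theta> \<longleftrightarrow> predictable M F T \<theta> \<and> L2_energy M T A \<theta> < \<infinity>"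

text \<open>
  \<open>stoch_integral M F T S A \<theta> I\<close>: \<open>I\<close> is (a version of) the Ito integral process
  \<open>\<theta> \<cdot> S\<close>, the \<open>L\<^sup>2\<close>-limit of elementary integrals. As these are square integrable
  martingales on \<open>{0..T}\<close>, convergence at the terminal time \<open>T\<close> is convergence in the
  Hilbert space of square integrable martingales.
\<close>
definition stoch_integral ::
    "'a measure \<Rightarrow> (real \<Rightarrow> 'a measure) \<Rightarrow> real \<Rightarrow> (real \<Rightarrow> 'a \<Rightarrow> real) \<Rightarrow> (real \<Rightarrow> 'a \<Rightarrow> real) \<Rightarrow>
     (real \<Rightarrow> 'a \<Rightarrow> real) \<Rightarrow> (real \<Rightarrow> 'a \<Rightarrow> real) \<Rightarrow> bool" where
  "stoch_integral M F T S A \<theta> I \<longleftrightarrow>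
     L2_integrand M F T A \<theta> \<and> sq_martingale M F T I \<and>
     (\<exists>E. (\<forall>k::nat. elementary M F T (E k)) \<and>
          (\<lambda>k. L2_energy M T A (\<lambda>t \<omega>. elem_process (E k) t \<omega> - \<theta> t \<omega>)) \<longlonglongrightarrow> 0 \<and>
          (\<lambda>k. \<integral>\<^sup>+\<omega>. ennreal ((elem_integral S (E k) T \<omega> - I T \<omega>)\<^sup>2) \<partial>M) \<longlonglongrightarrow> 0)"

definition stoch_integral_c ::
    "'a measure \<Rightarrow> (real \<Rightarrow> 'a measure) \<Rightarrow> real \<Rightarrow> (real \<Rightarrow> 'a \<Rightarrow> real) \<Rightarrow> (real \<Rightarrow> 'a \<Rightarrow> real) \<Rightarrow>
     (real \<Rightarrow> 'a \<Rightarrow> complex) \<Rightarrow> (real \<Rightarrow> 'a \<Rightarrow> complex) \<Rightarrow> bool" where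
  "stoch_integral_c M F T S A \<theta> I \<longleftrightarrow>
     stoch_integral M F T S A (\<lambda>t \<omega>. Re (\<theta> t \<omega>)) (\<lambda>t \<omega>. Re (I t \<omega>)) \<and>
     stoch_integral M F T S A (\<lambda>t \<omega>. Im (\<theta> t \<omega>)) (\<lambda>t \<omega>. Im (I t \<omega>))"

text \<open>\<open>gkw M F T S A N \<theta> L\<close>: the GKW decomposition of \<open>N\<close> with respect to \<open>S\<close> is
  \<open>N = N\<^sub>0 + \<theta> \<cdot> S + L\<close>.\<close>
definition gkw ::
    "'a measure \<Rightarrow> (real \<Rightarrow> 'a measure) \<Rightarrow> real \<Rightarrow> (real \<Rightarrow> 'a \<Rightarrow> real) \<Rightarrow> (real \<Rightarrow> 'a \<Rightarrow> real) \<Rightarrow>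
     (real \<Rightarrow> 'a \<Rightarrow> real) \<Rightarrow> (real \<Rightarrow> 'a \<Rightarrow> real) \<Rightarrow> (real \<Rightarrow> 'a \<Rightarrow> real) \<Rightarrow> bool" where
  "gkw M F T S A N \<theta> L \<longleftrightarrow>
     sq_martingale M F T N \<and> L2_integrand M F T A \<theta> \<and> sq_martingale M F T L \<and>
     (AE \<omega> in M. L 0 \<omega> = 0) \<and> covariation M F T L S (\<lambda>_ _. 0) \<and>
     (\<exists>I. stoch_integral M F T S A \<theta> I \<and>
          indist M T N (\<lambda>t \<omega>. N 0 \<omega> + I t \<omega> + L t \<omega>))"

definition gkw_c ::
    "'a measure \<Rightarrow> (real \<Rightarrow> 'a measure) \<Rightarrow> real \<Rightarrow> (real \<Rightarrow> 'a \<Rightarrow> real) \<Rightarrow> (real \<Rightarrow> 'a \<Rightarrow> real) \<Rightarrow>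
     (real \<Rightarrow> 'a \<Rightarrow> complex) \<Rightarrow> (real \<Rightarrow> 'a \<Rightarrow> complex) \<Rightarrow> (real \<Rightarrow> 'a \<Rightarrow> complex) \<Rightarrow> bool" where
  "gkw_c M F T S A N \<theta> L \<longleftrightarrow>
     sq_martingale_c M F T N \<and> L2_integrand M F T A \<theta> \<and> sq_martingale_c M F T L \<and>
     (AE \<omega> in M. L 0 \<omega> = 0) \<and>
     covariation M F T (\<lambda>t \<omega>. Re (L t \<omega>)) S (\<lambda>_ _. 0) \<and>
     covariation M F T (\<lambda>t \<omega>. Im (L t \<omega>)) S (\<lambda>_ _. 0) \<and>
     (\<exists>I. stoch_integral_c M F T S A \<theta> I \<and>
          indist M T N (\<lambda>t \<omega>. N 0 \<omega> + I t \<omega> + L t \<omega>))"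


section \<open>Fourier representation\<close>

definition strip :: "real ^ 'n \<Rightarrow> (complex ^ 'n) set" where
  "strip R = {z. \<forall>i. Re (z $ i) = R $ i}"

definition strip_point :: "real ^ 'n \<Rightarrow> real ^ 'n \<Rightarrow> complex ^ 'n" where
  "strip_point R y = (\<chi> i. Complex (R $ i) (y $ i))"

text \<open>The bilinear (not Hermitian) pairing \<open>z\<^sup>T x\<close>.\<close>
definition pairing :: "complex ^ 'n \<Rightarrow> real ^ 'n \<Rightarrow> complex" where
  "pairing z x = (\<Sum>i\<in>UNIV. z $ i * complex_of_real (x $ i))"

definition laplace :: "(real ^ 'n \<Rightarrow> real) \<Rightarrow> complex ^ 'n \<Rightarrow> complex" where
  "laplace h z = (\<integral>x. exp (- pairing z x) * complex_of_real (h x) \<partial>lborel)"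

definition zeta_density :: "(real ^ 'n \<Rightarrow> real) \<Rightarrow> complex ^ 'n \<Rightarrow> complex" where
  "zeta_density h z = laplace h z / (2 * complex_of_real pi * \<i>) ^ CARD('n)"

text \<open>
  Integration against the complex measure \<open>\<zeta>(dz) = (2 \<pi> \<i>)\<^sup>-\<^sup>n laplace h z dz\<close> on the strip.
  The strip is parametrised by \<open>z = R + \<i> y\<close>, so \<open>dz = \<i>\<^sup>n dy\<close>.
\<close>
definition zeta_integrable ::
    "(real ^ 'n \<Rightarrow> real) \<Rightarrow> real ^ 'n \<Rightarrow> (complex ^ 'n \<Rightarrow> complex) \<Rightarrow> bool" where
  "zeta_integrable h R f \<longleftrightarrow>
     integrable lborel
       (\<lambda>y. f (strip_point R y) * zeta_density h (strip_point R y) * \<i> ^ CARD('n))"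

definition zeta_integral ::
    "(real ^ 'n \<Rightarrow> real) \<Rightarrow> real ^ 'n \<Rightarrow> (complex ^ 'n \<Rightarrow> complex) \<Rightarrow> complex" where
  "zeta_integral h R f =
     (\<integral>y. f (strip_point R y) * zeta_density h (strip_point R y) * \<i> ^ CARD('n) \<partial>lborel)"

definition fourier_representation :: "(real ^ 'n \<Rightarrow> real) \<Rightarrow> real ^ 'n \<Rightarrow> bool" where
  "fourier_representation h R \<longleftrightarrow>
     integrable lborel (\<lambda>x. exp (- (R \<bullet> x)) * h x) \<and>
     integrable lborel (\<lambda>y. laplace h (strip_point R y)) \<and>
     (\<forall>x. complex_of_real (h x) = zeta_integral h R (\<lambda>z. exp (pairing z x)))"


section \<open>Families of processes indexed by the strip\<close>

definition jointly_progressive ::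
    "'a measure \<Rightarrow> (real \<Rightarrow> 'a measure) \<Rightarrow> real \<Rightarrow> real ^ 'n \<Rightarrow>
     (complex ^ 'n \<Rightarrow> real \<Rightarrow> 'a \<Rightarrow> complex) \<Rightarrow> bool" where
  "jointly_progressive M F T R U \<longleftrightarrow>
     (\<forall>t\<in>{0..T}. (\<lambda>((s, \<omega>), z). U z s \<omega>)
        \<in> borel_measurable
            ((restrict_space borel {0..t} \<Otimes>\<^sub>M F t) \<Otimes>\<^sub>M restrict_space borel (strip R)))"

definition jointly_predictable ::
    "'a measure \<Rightarrow> (real \<Rightarrow> 'a measure) \<Rightarrow> real \<Rightarrow> real ^ 'n \<Rightarrow>
     (complex ^ 'n \<Rightarrow> real \<Rightarrow> 'a \<Rightarrow> complex) \<Rightarrow> bool" where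
  "jointly_predictable M F T R U \<longleftrightarrow>
     (\<lambda>((t, \<omega>), z). U z t \<omega>)
        \<in> borel_measurable (predictable_sigma M F T \<Otimes>\<^sub>M restrict_space borel (strip R))"

definition joint_version ::
    "'a measure \<Rightarrow> (real \<Rightarrow> 'a measure) \<Rightarrow> real \<Rightarrow> real ^ 'n \<Rightarrow>
     (complex ^ 'n \<Rightarrow> real \<Rightarrow> 'a \<Rightarrow> complex) \<Rightarrow> (complex ^ 'n \<Rightarrow> real \<Rightarrow> 'a \<Rightarrow> complex) \<Rightarrow> bool" where
  "joint_version M F T R U Y \<longleftrightarrow>
     jointly_progressive M F T R Y \<and> (\<forall>z\<in>strip R. indist M T (U z) (Y z))"

definition zeta_process ::
    "(real ^ 'n \<Rightarrow> real) \<Rightarrow> real ^ 'n \<Rightarrow> (complex ^ 'n \<Rightarrow> real \<Rightarrow> 'a \<Rightarrow> complex) \<Rightarrow>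
     real \<Rightarrow> 'a \<Rightarrow> complex" where
  "zeta_process h R U t \<omega> = zeta_integral h R (\<lambda>z. U z t \<omega>)"

text \<open>
  \<open>V = \<integral> U(z) \<zeta>(dz)\<close> up to versions: the family \<open>U\<close> has a jointly progressively measurable
  version, and for each such version the integral over \<open>z\<close> exists and gives \<open>V\<close>.
\<close>
definition eq_zeta_process ::
    "'a measure \<Rightarrow> (real \<Rightarrow> 'a measure) \<Rightarrow> real \<Rightarrow> (real ^ 'n \<Rightarrow> real) \<Rightarrow> real ^ 'n \<Rightarrow>
     (real \<Rightarrow> 'a \<Rightarrow> complex) \<Rightarrow> (complex ^ 'n \<Rightarrow> real \<Rightarrow> 'a \<Rightarrow> complex) \<Rightarrow> bool" where
  "eq_zeta_process M F T h R V U \<longleftrightarrow>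
     (\<exists>Y. joint_version M F T R U Y) \<and>
     (\<forall>Y. joint_version M F T R U Y \<longrightarrow>
        (\<forall>t\<in>{0..T}. AE \<omega> in M.
           zeta_integrable h R (\<lambda>z. Y z t \<omega>) \<and> V t \<omega> = zeta_process h R Y t \<omega>))"

end

(* Every component of the GKW decomposition is bounded in L2 by the exponential moment
   E exp(2 R.X), uniformly on the strip, so all mixtures against the complex measure exist and are
   again square integrable.  By Tonelli and Cauchy-Schwarz, mixing commutes with L2 pairings and with
   conditional expectations; hence H is the mixture of the H(z), and an identity between
   martingales has to be checked at time T only.

   The defect D = (theta . S)_T - mix (theta(z) . S)_T equals mix L(z)_T - L_T.  It is orthogonal to
   every elementary integral because L and all L(z) are, and it is an L2 mixture of limits of
   elementary integrals; so it is orthogonal to itself and vanishes.  Pairing with elementary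
   integrals and using the Ito isometry, theta - mix theta(z) is orthogonal in L2(d<S,S> dP)
   to all elementary integrands, which are dense.

   The delicate point is the existence of a jointly measurable version of the integrals
   theta(z) . S (Stricker-Yor): jointly predictable integrands are approximated by
   elementary ones with errors bounded uniformly in z, and Doob's maximal inequality with
   Borel-Cantelli turns this into pathwise uniform convergence. *)
theory Submission
  imports Defs
begin

section \<open>Square integrable functions and their mixtures\<close>

text \<open>The bound is uniform because \<open>exp (pairing z x)\<close> has modulus
  \<open>exp (R \<bullet> x)\<close> on the strip; Pythagoras for the orthogonal decomposition hands
  it from \<open>Hz z\<close> to the integral and to \<open>Lz z\<close>, and the isometry hands it
  to \<open>\<theta>z z\<close>. The measure d<S,S> dP is not a product, since the path measure
  depends on the scenario; it is built from a kernel on the predictable sets, where a generator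
  closed under intersections gives explicit masses. The main obstacle is null sets: each
  \<open>Iz z\<close> and \<open>Lz z\<close> is known up to a null set depending on z, and
  uncountably many z are mixed. Hence mixtures are formed for jointly measurable versions, versions
  are exchanged by Tonelli, and identities are proved at each fixed time. Approximants depending
  measurably on z come from choosing, measurably in z, the first index with a small enough error;
  the density of elementary integrands is the same statement for a parameter space with one point.
  Orthogonality of complex objects is tested against real functions, through real and imaginary
  parts.\<close>

definition square_integrable :: "'a measure \<Rightarrow> ('a \<Rightarrow> real) \<Rightarrow> bool" where
  "square_integrable N f \<longleftrightarrow> f \<in> borel_measurable N \<and> integrable N (\<lambda>x. (f x)\<^sup>2)"

lemma square_integrableD:
  assumes "square_integrable N f"
  shows "f \<in> borel_measurable N" "integrable N (\<lambda>x. (f x)\<^sup>2)"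
  using assms by (auto simp: square_integrable_def)

lemma square_integrable_mult:
  assumes "square_integrable N f" "square_integrable N g"
  shows "integrable N (\<lambda>x. f x * g x)"
proof (rule Bochner_Integration.integrable_bound)
  show "integrable N (\<lambda>x. (f x)\<^sup>2 + (g x)\<^sup>2)"
    using assms by (auto simp: square_integrable_def)
  show "(\<lambda>x. f x * g x) \<in> borel_measurable N"
    using assms by (auto simp: square_integrable_def)
  show "AE x in N. norm (f x * g x) \<le> norm ((f x)\<^sup>2 + (g x)\<^sup>2)"
  proof (intro AE_I2)
    fix x
    have "0 \<le> (\<bar>f x\<bar> - \<bar>g x\<bar>)\<^sup>2" by simp
    then have "2 * (\<bar>f x\<bar> * \<bar>g x\<bar>) \<le> (f x)\<^sup>2 + (g x)\<^sup>2"
      by (simp add: power2_diff)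
    moreover have "0 \<le> \<bar>f x\<bar> * \<bar>g x\<bar>" by (intro mult_nonneg_nonneg) auto
    ultimately have "\<bar>f x\<bar> * \<bar>g x\<bar> \<le> (f x)\<^sup>2 + (g x)\<^sup>2" by linarith
    then show "norm (f x * g x) \<le> norm ((f x)\<^sup>2 + (g x)\<^sup>2)"
      by (simp add: abs_mult)
  qed
qed

lemma square_integrable_add:
  assumes "square_integrable N f" "square_integrable N g"
  shows "square_integrable N (\<lambda>x. f x + g x)"
proof -
  have "integrable N (\<lambda>x. (f x)\<^sup>2 + (g x)\<^sup>2 + 2 * (f x * g x))"
    using assms square_integrable_mult[OF assms] by (auto simp: square_integrable_def)
  then show ?thesis
    using assms by (auto simp: square_integrable_def power2_sum mult.assoc)
qed

lemma square_integrable_cmult: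
  assumes "square_integrable N f"
  shows "square_integrable N (\<lambda>x. c * f x)"
  using assms by (auto simp: square_integrable_def power_mult_distrib)

lemma square_integrable_diff:
  assumes "square_integrable N f" "square_integrable N g"
  shows "square_integrable N (\<lambda>x. f x - g x)"
  using square_integrable_add[OF assms(1) square_integrable_cmult[OF assms(2), of "-1"]] by simp

lemma square_integrable_zero: "square_integrable N (\<lambda>x. 0)"
  by (simp add: square_integrable_def)

lemma square_integrable_const:
  "finite_measure N \<Longrightarrow> square_integrable N (\<lambda>x. c)"
  by (simp add: square_integrable_def finite_measure.integrable_const)

lemma (in finite_measure) square_integrable_imp_integrable:
  "square_integrable M f \<Longrightarrow> integrable M f"
  using square_integrable_mult[OF _ square_integrable_const[OF finite_measure_axioms, of 1]] by simp

lemma square_integrable_bound: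
  assumes "square_integrable N g" "f \<in> borel_measurable N"
    "AE x in N. \<bar>f x\<bar> \<le> \<bar>g x\<bar>"
  shows "square_integrable N f"
  unfolding square_integrable_def
proof (intro conjI)
  show "integrable N (\<lambda>x. (f x)\<^sup>2)"
  proof (rule Bochner_Integration.integrable_bound)
    show "integrable N (\<lambda>x. (g x)\<^sup>2)" using assms by (auto simp: square_integrable_def)
    show "AE x in N. norm ((f x)\<^sup>2) \<le> norm ((g x)\<^sup>2)"
      using assms(3) by eventually_elim (simp add: abs_le_square_iff)
  qed (use assms in auto)
qed fact

lemma square_integrable_mult_bounded:
  assumes "square_integrable N f" "g \<in> borel_measurable N" "\<And>x. x \<in> space N \<Longrightarrow> \<bar>g x\<bar> \<le> c"
  shows "square_integrable N (\<lambda>x. g x * f x)"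
proof (rule square_integrable_bound[OF square_integrable_cmult[OF assms(1), of c]])
  show "(\<lambda>x. g x * f x) \<in> borel_measurable N"
    using assms by (auto simp: square_integrable_def)
  show "AE x in N. \<bar>g x * f x\<bar> \<le> \<bar>c * f x\<bar>"
    using assms(3) by (intro AE_I2) (force simp: abs_mult intro!: mult_right_mono)
qed

lemma square_integrable_cong_AE:
  assumes "square_integrable N f" "g \<in> borel_measurable N" "AE x in N. f x = g x"
  shows "square_integrable N g"
  using assms(3) by (intro square_integrable_bound[OF assms(1,2)]) auto

lemma square_integrable_iff_nn_integral:
  assumes "f \<in> borel_measurable N"
  shows "square_integrable N f \<longleftrightarrow> (\<integral>\<^sup>+x. ennreal ((f x)\<^sup>2) \<partial>N) < \<infinity>"
  using assms by (auto simp: square_integrable_def integrable_iff_bounded)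

lemma nn_integral_square:
  assumes "square_integrable N f"
  shows "(\<integral>\<^sup>+x. ennreal ((f x)\<^sup>2) \<partial>N) = ennreal (\<integral>x. (f x)\<^sup>2 \<partial>N)"
  using assms by (intro nn_integral_eq_integral) (auto simp: square_integrable_def)

lemma integral_square_add:
  assumes "square_integrable N f" "square_integrable N g"
  shows "(\<integral>x. (f x + g x)\<^sup>2 \<partial>N) = (\<integral>x. (f x)\<^sup>2 \<partial>N) + 2 * (\<integral>x. f x * g x \<partial>N) + (\<integral>x. (g x)\<^sup>2 \<partial>N)"
proof -
  have "(\<integral>x. (f x + g x)\<^sup>2 \<partial>N) = (\<integral>x. (f x)\<^sup>2 + 2 * (f x * g x) + (g x)\<^sup>2 \<partial>N)"
    by (simp add: power2_sum algebra_simps)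
  then show ?thesis
    using assms square_integrable_mult[OF assms] by (simp add: square_integrable_def)
qed

lemma integral_square_diff:
  assumes "square_integrable N f" "square_integrable N g"
  shows "(\<integral>x. (f x - g x)\<^sup>2 \<partial>N) = (\<integral>x. (f x)\<^sup>2 \<partial>N) - 2 * (\<integral>x. f x * g x \<partial>N) + (\<integral>x. (g x)\<^sup>2 \<partial>N)"
  using integral_square_add[OF assms(1) square_integrable_cmult[OF assms(2), of "-1"]] by simp

text \<open>The squared norm of \<open>t * f + g\<close> is a nonnegative quadratic polynomial in t,
  so its discriminant is not positive.\<close>

lemma L2_Cauchy_Schwarz:
  assumes "square_integrable N f" "square_integrable N g"
  shows "\<bar>\<integral>x. f x * g x \<partial>N\<bar> \<le> sqrt (\<integral>x. (f x)\<^sup>2 \<partial>N) * sqrt (\<integral>x. (g x)\<^sup>2 \<partial>N)"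
proof -
  define a b c where "a = (\<integral>x. (f x)\<^sup>2 \<partial>N)" "b = (\<integral>x. f x * g x \<partial>N)" "c = (\<integral>x. (g x)\<^sup>2 \<partial>N)"
  note abc = this
  have a0: "0 \<le> a" "0 \<le> c" by (simp_all add: abc)
  have q: "0 \<le> t\<^sup>2 * a + 2 * t * b + c" for t
  proof -
    have "0 \<le> (\<integral>x. (t * f x + g x)\<^sup>2 \<partial>N)" by simp
    also have "\<dots> = t\<^sup>2 * a + 2 * t * b + c"
      unfolding abc integral_square_add[OF square_integrable_cmult[OF assms(1)] assms(2)]
      by (simp add: power_mult_distrib mult.assoc)
    finally show ?thesis .
  qed
  have "b\<^sup>2 \<le> a * c"
  proof (cases "a = 0")
    case True
    have "b = 0"
    proof (rule ccontr)
      assume "b \<noteq> 0"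
      \<comment> \<open>For \<open>a = 0\<close> the polynomial is affine in t, and at this t its
        value is -1.\<close>
      with q[of "- (c + 1) / (2 * b)"] True show False by (simp add: field_simps)
    qed
    then show ?thesis using a0 by simp
  next
    case False
    then have "0 < a" using a0 by simp
    \<comment> \<open>The minimiser of the polynomial.\<close>
    with q[of "- b / a"] have "0 \<le> c - b\<^sup>2 / a"
      by (simp add: power2_eq_square field_simps)
    with \<open>0 < a\<close> show ?thesis by (simp add: field_simps)
  qed
  then have "sqrt (b\<^sup>2) \<le> sqrt (a * c)" by (rule real_sqrt_le_mono)
  then show ?thesis by (simp add: abc real_sqrt_mult)
qed

lemma L2_tendsto_inner:
  assumes "\<And>k::nat. square_integrable N (f k)" "square_integrable N g" "square_integrable N u"
    and lim: "(\<lambda>k. \<integral>x. (f k x - g x)\<^sup>2 \<partial>N) \<longlonglongrightarrow> 0"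
  shows "(\<lambda>k. \<integral>x. f k x * u x \<partial>N) \<longlonglongrightarrow> (\<integral>x. g x * u x \<partial>N)"
proof (subst tendsto_dist_iff, rule tendsto_sandwich[of "\<lambda>_. 0"])
  show "\<forall>\<^sub>F k in sequentially. dist (\<integral>x. f k x * u x \<partial>N) (\<integral>x. g x * u x \<partial>N) \<le>
      sqrt (\<integral>x. (f k x - g x)\<^sup>2 \<partial>N) * sqrt (\<integral>x. (u x)\<^sup>2 \<partial>N)"
  proof (intro always_eventually allI)
    fix k
    have "(\<integral>x. f k x * u x \<partial>N) - (\<integral>x. g x * u x \<partial>N) = (\<integral>x. (f k x - g x) * u x \<partial>N)"
      using square_integrable_mult[OF assms(1,3), of k] square_integrable_mult[OF assms(2,3)]
      by (simp add: left_diff_distrib)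
    then show "dist (\<integral>x. f k x * u x \<partial>N) (\<integral>x. g x * u x \<partial>N) \<le>
        sqrt (\<integral>x. (f k x - g x)\<^sup>2 \<partial>N) * sqrt (\<integral>x. (u x)\<^sup>2 \<partial>N)"
      using L2_Cauchy_Schwarz[OF square_integrable_diff[OF assms(1,2)] assms(3), of k]
      by (simp add: dist_real_def)
  qed
  have "(\<lambda>k. sqrt (\<integral>x. (f k x - g x)\<^sup>2 \<partial>N) * sqrt (\<integral>x. (u x)\<^sup>2 \<partial>N)) \<longlonglongrightarrow>
      sqrt 0 * sqrt (\<integral>x. (u x)\<^sup>2 \<partial>N)"
    by (intro tendsto_intros lim)
  then show "(\<lambda>k. sqrt (\<integral>x. (f k x - g x)\<^sup>2 \<partial>N) * sqrt (\<integral>x. (u x)\<^sup>2 \<partial>N)) \<longlonglongrightarrow> 0" by simp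
qed auto

text \<open>Expanding the square of \<open>f k - g\<close> reduces the norms to inner products with
  the fixed function \<open>g\<close>.\<close>

lemma L2_tendsto_norm:
  assumes "\<And>k::nat. square_integrable N (f k)" "square_integrable N g"
    and lim: "(\<lambda>k. \<integral>x. (f k x - g x)\<^sup>2 \<partial>N) \<longlonglongrightarrow> 0"
  shows "(\<lambda>k. \<integral>x. (f k x)\<^sup>2 \<partial>N) \<longlonglongrightarrow> (\<integral>x. (g x)\<^sup>2 \<partial>N)"
proof -
  have "(\<integral>x. (f k x)\<^sup>2 \<partial>N) =
      (\<integral>x. (f k x - g x)\<^sup>2 \<partial>N) + 2 * (\<integral>x. f k x * g x \<partial>N) - (\<integral>x. (g x)\<^sup>2 \<partial>N)" for k
    using integral_square_diff[OF assms(1,2), of k] by simp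
  moreover have "(\<lambda>k. (\<integral>x. (f k x - g x)\<^sup>2 \<partial>N) + 2 * (\<integral>x. f k x * g x \<partial>N) - (\<integral>x. (g x)\<^sup>2 \<partial>N))
      \<longlonglongrightarrow> 0 + 2 * (\<integral>x. g x * g x \<partial>N) - (\<integral>x. (g x)\<^sup>2 \<partial>N)"
    by (intro tendsto_intros lim L2_tendsto_inner[OF assms(1,2,2) lim])
  ultimately show ?thesis by (simp add: power2_eq_square)
qed

lemma L2_tendsto_add:
  assumes sq: "\<And>k::nat. square_integrable N (f k)" "square_integrable N g"
    "\<And>k::nat. square_integrable N (f' k)" "square_integrable N g'"
    and lim: "(\<lambda>k. \<integral>x. (f k x - g x)\<^sup>2 \<partial>N) \<longlonglongrightarrow> 0" "(\<lambda>k. \<integral>x. (f' k x - g' x)\<^sup>2 \<partial>N) \<longlonglongrightarrow> 0"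
  shows "(\<lambda>k. \<integral>x. (f k x + f' k x - (g x + g' x))\<^sup>2 \<partial>N) \<longlonglongrightarrow> 0"
proof (rule tendsto_sandwich[of "\<lambda>_. 0"])
  show "\<forall>\<^sub>F k in sequentially. (\<integral>x. (f k x + f' k x - (g x + g' x))\<^sup>2 \<partial>N) \<le>
      2 * (\<integral>x. (f k x - g x)\<^sup>2 \<partial>N) + 2 * (\<integral>x. (f' k x - g' x)\<^sup>2 \<partial>N)"
  proof (intro always_eventually allI)
    fix k
    have a: "square_integrable N (\<lambda>x. f k x - g x)" "square_integrable N (\<lambda>x. f' k x - g' x)"
      by (intro square_integrable_diff sq)+
    have "(\<integral>x. (f k x + f' k x - (g x + g' x))\<^sup>2 \<partial>N) \<le>
        (\<integral>x. 2 * (f k x - g x)\<^sup>2 + 2 * (f' k x - g' x)\<^sup>2 \<partial>N)"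
    proof (rule integral_mono)
      show "integrable N (\<lambda>x. (f k x + f' k x - (g x + g' x))\<^sup>2)"
        using square_integrable_add[OF a] by (simp add: square_integrable_def algebra_simps)
      show "integrable N (\<lambda>x. 2 * (f k x - g x)\<^sup>2 + 2 * (f' k x - g' x)\<^sup>2)"
        using a by (simp add: square_integrable_def)
      have "(u + v)\<^sup>2 \<le> 2 * u\<^sup>2 + 2 * v\<^sup>2" for u v :: real
        using zero_le_power2[of "u - v"] by (simp add: power2_eq_square algebra_simps)
      from this[of "f k x - g x" "f' k x - g' x" for x]
      show "(f k x + f' k x - (g x + g' x))\<^sup>2 \<le> 2 * (f k x - g x)\<^sup>2 + 2 * (f' k x - g' x)\<^sup>2" for x
        by (simp add: algebra_simps)
    qed
    also have "\<dots> = 2 * (\<integral>x. (f k x - g x)\<^sup>2 \<partial>N) + 2 * (\<integral>x. (f' k x - g' x)\<^sup>2 \<partial>N)"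
      using a by (simp add: square_integrable_def)
    finally show "(\<integral>x. (f k x + f' k x - (g x + g' x))\<^sup>2 \<partial>N) \<le>
      2 * (\<integral>x. (f k x - g x)\<^sup>2 \<partial>N) + 2 * (\<integral>x. (f' k x - g' x)\<^sup>2 \<partial>N)" .
  qed
  show "(\<lambda>k. 2 * (\<integral>x. (f k x - g x)\<^sup>2 \<partial>N) + 2 * (\<integral>x. (f' k x - g' x)\<^sup>2 \<partial>N)) \<longlonglongrightarrow> 0"
    using tendsto_add[OF tendsto_mult_left[OF lim(1), of 2] tendsto_mult_left[OF lim(2), of 2]] by simp
qed (auto simp: sq)

lemma integral_square_eq_0_iff:
  assumes "square_integrable N f"
  shows "(\<integral>x. (f x)\<^sup>2 \<partial>N) = 0 \<longleftrightarrow> (AE x in N. f x = 0)"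
  using assms integral_nonneg_eq_0_iff_AE[of N "\<lambda>x. (f x)\<^sup>2"] by (simp add: square_integrable_def)

text \<open>Joint measurability makes the exceptional set a set of the product space, so null
  sections in one direction force null sections in the other. It is the device against null sets
  that depend on a parameter.\<close>

lemma AE_AE_eq_swap:
  fixes f g :: "'a \<times> 'b \<Rightarrow> 'c::{second_countable_topology, t2_space}"
  assumes "sigma_finite_measure N" "sigma_finite_measure W"
    and [measurable]: "f \<in> borel_measurable (N \<Otimes>\<^sub>M W)" "g \<in> borel_measurable (N \<Otimes>\<^sub>M W)"
    and ae: "\<And>y. y \<in> space W \<Longrightarrow> AE x in N. f (x, y) = g (x, y)"
  shows "AE x in N. AE y in W. f (x, y) = g (x, y)"
proof -
  interpret N: sigma_finite_measure N by fact
  interpret W: sigma_finite_measure W by fact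
  interpret pair_sigma_finite N W ..
  have "{z \<in> space (N \<Otimes>\<^sub>M W). f (fst z, snd z) = g (fst z, snd z)} \<in> sets (N \<Otimes>\<^sub>M W)"
    by measurable
  from AE_commute[OF this] show ?thesis using ae by (auto intro: AE_I2)
qed

text \<open>\<open>W\<close> may have infinite mass, but the integrable \<open>c\<close> makes |c|
  dW a finite measure. With a second moment bound uniform in y, Tonelli applies to the product with
  any square integrable function, and Cauchy-Schwarz for |c| dW bounds the mixture.\<close>

lemma mixture_square_integrable:
  fixes Y :: "'a \<times> 'b \<Rightarrow> complex" and c :: "'b \<Rightarrow> complex"
  assumes N: "finite_measure N" and W: "sigma_finite_measure W"
    and Y[measurable]: "Y \<in> borel_measurable (N \<Otimes>\<^sub>M W)"
    and c: "integrable W c"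
    and bound: "\<And>y. y \<in> space W \<Longrightarrow> (\<integral>\<^sup>+x. ennreal ((norm (Y (x, y)))\<^sup>2) \<partial>N) \<le> ennreal K"
  shows mixture_AE_integrable: "AE x in N. integrable W (\<lambda>y. Y (x, y) * c y)" (is ?ae)
    and mixture_measurable: "(\<lambda>x. \<integral>y. Y (x, y) * c y \<partial>W) \<in> borel_measurable N" (is ?meas)
    and mixture_bound: "(\<integral>\<^sup>+x. ennreal ((norm (\<integral>y. Y (x, y) * c y \<partial>W))\<^sup>2) \<partial>N) < \<infinity>" (is ?bd)
    and mixture_inner: "square_integrable N Z \<Longrightarrow>
      integrable N (\<lambda>x. complex_of_real (Z x) * (\<integral>y. Y (x, y) * c y \<partial>W)) \<and>
      (\<integral>x. complex_of_real (Z x) * (\<integral>y. Y (x, y) * c y \<partial>W) \<partial>N) =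
      (\<integral>y. (\<integral>x. complex_of_real (Z x) * Y (x, y) \<partial>N) * c y \<partial>W)" (is "_ \<Longrightarrow> ?in Z")
proof -
  interpret N: finite_measure N by fact
  interpret W: sigma_finite_measure W by fact
  interpret pair_sigma_finite N W ..
  have c_meas[measurable]: "c \<in> borel_measurable W" using c by auto
  define C where "C = (\<integral>\<^sup>+y. ennreal (norm (c y)) \<partial>W)"
  have C: "C < \<infinity>" using c by (simp add: integrable_iff_bounded C_def)
  \<comment> \<open>The one integrability fact behind Fubini: the test function 1 gives
    integrability of almost every slice, a general \<open>Z\<close> the exchange of pairing and
    mixing.\<close>
  have prod: "integrable (N \<Otimes>\<^sub>M W) (\<lambda>(x, y). complex_of_real (Z x) * (Y (x, y) * c y))"
    if Z: "square_integrable N Z" for Z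
  proof -
    have [measurable]: "Z \<in> borel_measurable N" using Z by (auto simp: square_integrable_def)
    let ?B = "ennreal (\<integral>x. (Z x)\<^sup>2 \<partial>N) + ennreal K"
    have "(\<integral>\<^sup>+z. ennreal (norm ((\<lambda>(x, y). complex_of_real (Z x) * (Y (x, y) * c y)) z)) \<partial>(N \<Otimes>\<^sub>M W)) =
        (\<integral>\<^sup>+y. \<integral>\<^sup>+x. ennreal (norm (complex_of_real (Z x) * (Y (x, y) * c y))) \<partial>N \<partial>W)"
      by (subst nn_integral_snd[symmetric]) (auto simp: case_prod_beta)
    also have "\<dots> \<le> (\<integral>\<^sup>+y. ennreal (norm (c y)) * ?B \<partial>W)"
    proof (rule nn_integral_mono)
      fix y assume y: "y \<in> space W"
      have "(\<integral>\<^sup>+x. ennreal (norm (complex_of_real (Z x) * (Y (x, y) * c y))) \<partial>N) \<le>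
          (\<integral>\<^sup>+x. ennreal (norm (c y)) * (ennreal ((Z x)\<^sup>2) + ennreal ((norm (Y (x, y)))\<^sup>2)) \<partial>N)"
      proof (rule nn_integral_mono)
        fix x
        have "0 \<le> (\<bar>Z x\<bar> - norm (Y (x, y)))\<^sup>2" by simp
        then have "2 * (\<bar>Z x\<bar> * norm (Y (x, y))) \<le> (Z x)\<^sup>2 + (norm (Y (x, y)))\<^sup>2"
          by (simp add: power2_diff)
        moreover have "0 \<le> \<bar>Z x\<bar> * norm (Y (x, y))" by (intro mult_nonneg_nonneg) auto
        ultimately have "\<bar>Z x\<bar> * norm (Y (x, y)) \<le> (Z x)\<^sup>2 + (norm (Y (x, y)))\<^sup>2" by linarith
        from mult_left_mono[OF this, of "norm (c y)"]
        have "norm (complex_of_real (Z x) * (Y (x, y) * c y)) \<le> norm (c y) * ((Z x)\<^sup>2 + (norm (Y (x, y)))\<^sup>2)"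
          by (simp add: norm_mult ac_simps)
        then show "ennreal (norm (complex_of_real (Z x) * (Y (x, y) * c y))) \<le>
            ennreal (norm (c y)) * (ennreal ((Z x)\<^sup>2) + ennreal ((norm (Y (x, y)))\<^sup>2))"
          by (simp add: ennreal_mult[symmetric] ennreal_plus[symmetric] del: ennreal_plus)
      qed
      also have "\<dots> = ennreal (norm (c y)) *
          ((\<integral>\<^sup>+x. ennreal ((Z x)\<^sup>2) \<partial>N) + (\<integral>\<^sup>+x. ennreal ((norm (Y (x, y)))\<^sup>2) \<partial>N))"
        using y by (subst nn_integral_cmult, measurable, subst nn_integral_add) auto
      also have "\<dots> \<le> ennreal (norm (c y)) * ?B"
        unfolding nn_integral_square[OF Z] by (intro mult_left_mono add_left_mono bound y) auto
      finally show "(\<integral>\<^sup>+x. ennreal (norm (complex_of_real (Z x) * (Y (x, y) * c y))) \<partial>N) \<le>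
        ennreal (norm (c y)) * ?B" .
    qed
    also have "\<dots> = C * ?B"
      unfolding C_def by (rule nn_integral_multc) simp
    also have "\<dots> < \<infinity>" using C by (simp add: ennreal_mult_less_top)
    finally show ?thesis
      by (intro integrableI_bounded) (auto simp: case_prod_beta)
  qed
  show ?ae
    using AE_integrable_fst[OF prod[OF square_integrable_const[OF N, of 1]]] by simp
  show ?meas
    by measurable
  show "?in Z" if Z: "square_integrable N Z"
  proof -
    have "(\<integral>y. complex_of_real (Z x) * (Y (x, y) * c y) \<partial>W) = complex_of_real (Z x) * (\<integral>y. Y (x, y) * c y \<partial>W)" for x
      by simp
    moreover have "(\<integral>x. complex_of_real (Z x) * (Y (x, y) * c y) \<partial>N) =
        (\<integral>x. complex_of_real (Z x) * Y (x, y) \<partial>N) * c y" for y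
      by (simp add: mult.assoc[symmetric])
    ultimately show ?thesis
      using integrable_fst[OF prod[OF Z]] integral_fst[OF prod[OF Z]] integral_snd[OF prod[OF Z]]
      by simp
  qed
  show ?bd
  proof -
    have "(\<integral>\<^sup>+x. ennreal ((norm (\<integral>y. Y (x, y) * c y \<partial>W))\<^sup>2) \<partial>N) \<le>
        (\<integral>\<^sup>+x. C * (\<integral>\<^sup>+y. ennreal (norm (c y)) * ennreal ((norm (Y (x, y)))\<^sup>2) \<partial>W) \<partial>N)"
    proof (rule nn_integral_mono)
      fix x assume x: "x \<in> space N"
      \<comment> \<open>Where the slice is not integrable, the Bochner integral has the default
        value 0 and the bound is trivial.\<close>
      have "ennreal (norm (\<integral>y. Y (x, y) * c y \<partial>W)) \<le> (\<integral>\<^sup>+y. ennreal (norm (Y (x, y) * c y)) \<partial>W)"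
        by (cases "integrable W (\<lambda>y. Y (x, y) * c y)")
          (auto intro: integral_norm_bound_ennreal simp: not_integrable_integral_eq)
      \<comment> \<open>Splitting |c| into two square roots lets Cauchy-Schwarz put one of them into
        the total mass \<open>C\<close>.\<close>
      also have "\<dots> = (\<integral>\<^sup>+y. ennreal (sqrt (norm (c y))) * ennreal (sqrt (norm (c y)) * norm (Y (x, y))) \<partial>W)"
        by (intro nn_integral_cong) (simp add: ennreal_mult[symmetric] norm_mult mult.assoc[symmetric] mult.commute)
      finally have "(ennreal (norm (\<integral>y. Y (x, y) * c y \<partial>W)))\<^sup>2 \<le>
        (\<integral>\<^sup>+y. ennreal (sqrt (norm (c y))) * ennreal (sqrt (norm (c y)) * norm (Y (x, y))) \<partial>W)\<^sup>2"
        by (intro power_mono) auto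
      also have "\<dots> \<le> (\<integral>\<^sup>+y. (ennreal (sqrt (norm (c y))))\<^sup>2 \<partial>W) *
          (\<integral>\<^sup>+y. (ennreal (sqrt (norm (c y)) * norm (Y (x, y))))\<^sup>2 \<partial>W)"
        using x by (intro Cauchy_Schwarz_nn_integral) measurable
      also have "\<dots> = C * (\<integral>\<^sup>+y. ennreal (norm (c y)) * ennreal ((norm (Y (x, y)))\<^sup>2) \<partial>W)"
        by (simp add: C_def ennreal_power power_mult_distrib ennreal_mult)
      finally show "ennreal ((norm (\<integral>y. Y (x, y) * c y \<partial>W))\<^sup>2) \<le>
        C * (\<integral>\<^sup>+y. ennreal (norm (c y)) * ennreal ((norm (Y (x, y)))\<^sup>2) \<partial>W)"
        by (simp add: ennreal_power)
    qed
    also have "\<dots> = C * (\<integral>\<^sup>+x. \<integral>\<^sup>+y. ennreal (norm (c y)) * ennreal ((norm (Y (x, y)))\<^sup>2) \<partial>W \<partial>N)"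
      by (rule nn_integral_cmult) measurable
    also have "(\<integral>\<^sup>+x. \<integral>\<^sup>+y. ennreal (norm (c y)) * ennreal ((norm (Y (x, y)))\<^sup>2) \<partial>W \<partial>N) =
        (\<integral>\<^sup>+y. \<integral>\<^sup>+x. ennreal (norm (c y)) * ennreal ((norm (Y (x, y)))\<^sup>2) \<partial>N \<partial>W)"
      by (rule Fubini'[symmetric]) measurable
    also have "\<dots> = (\<integral>\<^sup>+y. ennreal (norm (c y)) * (\<integral>\<^sup>+x. ennreal ((norm (Y (x, y)))\<^sup>2) \<partial>N) \<partial>W)"
      by (intro nn_integral_cong nn_integral_cmult) measurable
    also have "\<dots> \<le> (\<integral>\<^sup>+y. ennreal (norm (c y)) * ennreal K \<partial>W)"
      by (intro nn_integral_mono mult_left_mono bound) auto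
    also have "\<dots> = C * ennreal K"
      unfolding C_def by (rule nn_integral_multc) simp
    finally have "(\<integral>\<^sup>+x. ennreal ((norm (\<integral>y. Y (x, y) * c y \<partial>W))\<^sup>2) \<partial>N) \<le> C * (C * ennreal K)"
      by (simp add: mult_left_mono)
    also have "\<dots> < \<infinity>" using C by (simp add: ennreal_mult_less_top)
    finally show ?thesis .
  qed
qed

section \<open>Square integrable martingales\<close>

locale filtered_basis =
  fixes M :: "'a measure" and F :: "real \<Rightarrow> 'a measure" and T :: real
  assumes basis: "usual_basis M F T"
begin

lemma prob: "prob_space M" and T_pos: "0 < T" and F_top: "sets (F T) = sets M"
  and subalg: "t \<in> {0..T} \<Longrightarrow> subalgebra M (F t)"
  and F_mono: "0 \<le> s \<Longrightarrow> s \<le> t \<Longrightarrow> t \<le> T \<Longrightarrow> sets (F s) \<subseteq> sets (F t)"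
  and null_sets_complete: "\<And>B N. N \<in> null_sets M \<Longrightarrow> B \<subseteq> N \<Longrightarrow> B \<in> sets M"
  using basis by (simp_all add: usual_basis_def)

lemma null_sets_F0: "null_sets M \<subseteq> sets (F 0)"
  using basis unfolding usual_basis_def by (elim conjE)

lemma space_F: "t \<in> {0..T} \<Longrightarrow> space (F t) = space M"
  using subalg by (auto simp: subalgebra_def)

lemma sets_F_subset: "t \<in> {0..T} \<Longrightarrow> sets (F t) \<subseteq> sets M"
  using subalg by (auto simp: subalgebra_def)

lemma subalg_F: "0 \<le> s \<Longrightarrow> s \<le> t \<Longrightarrow> t \<le> T \<Longrightarrow> subalgebra (F t) (F s)"
  using F_mono space_F[of s] space_F[of t] by (auto simp: subalgebra_def)

lemma measurable_F_mono:
  "f \<in> measurable (F s) N \<Longrightarrow> 0 \<le> s \<Longrightarrow> s \<le> t \<Longrightarrow> t \<le> T \<Longrightarrow> f \<in> measurable (F t) N"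
  by (rule measurable_from_subalg[OF subalg_F])

lemma measurable_F_imp_M:
  "f \<in> measurable (F s) N \<Longrightarrow> s \<in> {0..T} \<Longrightarrow> f \<in> measurable M N"
  by (rule measurable_from_subalg[OF subalg])

lemma measurable_M_imp_F: "f \<in> measurable M N \<Longrightarrow> f \<in> measurable (F T) N"
  using measurable_cong_sets[OF F_top refl, of N] by simp

sublocale prob_space M by (rule prob)

lemma null_sets_F:
  assumes "B \<subseteq> N" "N \<in> null_sets M" "t \<in> {0..T}"
  shows "B \<in> sets (F t)"
proof -
  have "B \<in> sets M" using null_sets_complete[OF assms(2,1)] .
  then have "B \<in> null_sets M" using null_sets_subset[OF assms(2) _ assms(1)] by blast
  then have "B \<in> sets (F 0)" using null_sets_F0 by blast
  then show ?thesis using F_mono[of 0 t] assms by auto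
qed

text \<open>The preimages under \<open>f\<close> and \<open>g\<close> differ by subsets of a null
  set, and by the usual conditions these belong to every \<open>F t\<close>. Modifications therefore
  stay adapted.\<close>

lemma measurable_F_cong_AE:
  assumes f: "f \<in> measurable (F t) N" and ae: "AE \<omega> in M. f \<omega> = g \<omega>" and t: "t \<in> {0..T}"
    and g: "g \<in> space M \<rightarrow> space N"
  shows "g \<in> measurable (F t) N"
proof (rule measurableI)
  fix B assume B: "B \<in> sets N"
  from ae obtain Z where Z: "Z \<in> null_sets M" "{\<omega> \<in> space M. \<not> f \<omega> = g \<omega>} \<subseteq> Z"
    unfolding eventually_ae_filter by blast
  have "g -` B \<inter> space M = ((f -` B \<inter> space M) - ((f -` B \<inter> space M) \<inter> Z)) \<union> ((g -` B \<inter> space M) \<inter> Z)"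
    using Z by auto
  also have "\<dots> \<in> sets (F t)"
  proof (intro sets.Un sets.Diff)
    show "f -` B \<inter> space M \<in> sets (F t)" using measurable_sets[OF f B] space_F[OF t] by simp
    show "f -` B \<inter> space M \<inter> Z \<in> sets (F t)" by (rule null_sets_F[OF _ Z(1) t]) blast
    show "g -` B \<inter> space M \<inter> Z \<in> sets (F t)" by (rule null_sets_F[OF _ Z(1) t]) blast
  qed
  finally show "g -` B \<inter> space (F t) \<in> sets (F t)" using space_F[OF t] by simp
qed (use g space_F[OF t] in auto)

lemma sigma_finite_subalg: "t \<in> {0..T} \<Longrightarrow> sigma_finite_subalgebra M (F t)"
  using finite_measure_subalgebra_is_sigma_finite[OF finite_measure_subalgebra.intro[OF finite_measure_axioms]]
    subalg by (simp add: finite_measure_subalgebra_axioms_def)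

text \<open>Integrals over the events of \<open>F s\<close> characterise the conditional
  expectation.\<close>

lemma martingaleI:
  assumes meas: "\<And>t. t \<in> {0..T} \<Longrightarrow> U t \<in> borel_measurable (F t)"
    and int: "\<And>t. t \<in> {0..T} \<Longrightarrow> integrable M (U t)"
    and eq: "\<And>s t B. 0 \<le> s \<Longrightarrow> s \<le> t \<Longrightarrow> t \<le> T \<Longrightarrow> B \<in> sets (F s) \<Longrightarrow>
      (\<integral>\<omega>. indicator B \<omega> * U t \<omega> \<partial>M) = (\<integral>\<omega>. indicator B \<omega> * U s \<omega> \<partial>M)"
    and cad: "\<And>\<omega>. \<omega> \<in> space M \<Longrightarrow> cadlag_on T (\<lambda>t. U t \<omega>)"
  shows "martingale M F T U"
  unfolding martingale_def
proof (intro conjI allI impI ballI)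
  fix s t assume "0 \<le> s \<and> s \<le> t \<and> t \<le> T"
  then have st: "0 \<le> s" "s \<le> t" "t \<le> T" "s \<in> {0..T}" "t \<in> {0..T}" by auto
  interpret sigma_finite_subalgebra M "F s" by (rule sigma_finite_subalg) fact
  show "AE \<omega> in M. real_cond_exp M (F s) (U t) \<omega> = U s \<omega>"
    using eq[OF st(1-3)] st
    by (intro real_cond_exp_charact) (auto simp: set_lebesgue_integral_def int meas)
qed (use assms in auto)

text \<open>The test function may be unbounded as long as the product is integrable; later it
  contains values of another martingale.\<close>

lemma martingale_inner:
  assumes U: "martingale M F T U" and st: "0 \<le> s" "s \<le> t" "t \<le> T"
    and f: "f \<in> borel_measurable (F s)" and int: "integrable M (\<lambda>\<omega>. f \<omega> * U t \<omega>)"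
  shows "(\<integral>\<omega>. f \<omega> * U t \<omega> \<partial>M) = (\<integral>\<omega>. f \<omega> * U s \<omega> \<partial>M)"
    and "integrable M (\<lambda>\<omega>. f \<omega> * U s \<omega>)"
proof -
  have s: "s \<in> {0..T}" "t \<in> {0..T}" using st by auto
  interpret sigma_finite_subalgebra M "F s" by (rule sigma_finite_subalg) fact
  have [measurable]: "U t \<in> borel_measurable M" "U s \<in> borel_measurable M" "f \<in> borel_measurable M"
    using U s f measurable_F_imp_M unfolding martingale_def by blast+
  have ae: "AE \<omega> in M. f \<omega> * real_cond_exp M (F s) (U t) \<omega> = f \<omega> * U s \<omega>"
  proof -
    have "AE \<omega> in M. real_cond_exp M (F s) (U t) \<omega> = U s \<omega>"
      using U st unfolding martingale_def by blast
    then show ?thesis by eventually_elim simp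
  qed
  note r = real_cond_exp_intg[OF int f]
  have "(\<integral>\<omega>. f \<omega> * real_cond_exp M (F s) (U t) \<omega> \<partial>M) = (\<integral>\<omega>. f \<omega> * U s \<omega> \<partial>M)"
    by (rule integral_cong_AE[OF _ _ ae]) measurable
  then show "(\<integral>\<omega>. f \<omega> * U t \<omega> \<partial>M) = (\<integral>\<omega>. f \<omega> * U s \<omega> \<partial>M)" using r by simp
  show "integrable M (\<lambda>\<omega>. f \<omega> * U s \<omega>)"
    using integrable_cong_AE[OF _ _ ae] r(1) by simp
qed

lemma sq_martingale_meas:
  assumes "sq_martingale M F T U" "t \<in> {0..T}"
  shows "U t \<in> borel_measurable (F t)"
  using assms by (auto simp: sq_martingale_def martingale_def)

lemma sq_martingale_sqi:
  assumes "sq_martingale M F T U" "t \<in> {0..T}"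
  shows "square_integrable M (U t)"
  unfolding square_integrable_def
proof
  show "U t \<in> borel_measurable M" by (rule measurable_F_imp_M[OF sq_martingale_meas[OF assms] assms(2)])
  show "integrable M (\<lambda>\<omega>. (U t \<omega>)\<^sup>2)" using assms by (simp add: sq_martingale_def)
qed

lemma sq_martingale_cadlag:
  assumes "sq_martingale M F T U" "\<omega> \<in> space M"
  shows "cadlag_on T (\<lambda>t. U t \<omega>)"
  using assms by (auto simp: sq_martingale_def martingale_def)

lemma sq_martingale_inner:
  assumes U: "sq_martingale M F T U" and st: "0 \<le> s" "s \<le> t" "t \<le> T"
    and f: "f \<in> borel_measurable (F s)" "square_integrable M f"
  shows "(\<integral>\<omega>. f \<omega> * U t \<omega> \<partial>M) = (\<integral>\<omega>. f \<omega> * U s \<omega> \<partial>M)"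
proof (rule martingale_inner(1)[OF _ st f(1)])
  show "martingale M F T U" using U by (simp add: sq_martingale_def)
  show "integrable M (\<lambda>\<omega>. f \<omega> * U t \<omega>)"
    using st by (intro square_integrable_mult[OF f(2)] sq_martingale_sqi[OF U]) auto
qed

lemma sq_martingale_orth:
  assumes U: "sq_martingale M F T U" and st: "0 \<le> s" "s \<le> t" "t \<le> T"
    and f: "f \<in> borel_measurable (F s)" "square_integrable M f"
  shows "(\<integral>\<omega>. f \<omega> * (U t \<omega> - U s \<omega>) \<partial>M) = 0"
  using sq_martingale_inner[OF assms] st square_integrable_mult[OF f(2) sq_martingale_sqi[OF U, of t]]
    square_integrable_mult[OF f(2) sq_martingale_sqi[OF U, of s]]
  by (simp add: right_diff_distrib)

lemma sqi_mult_indicator: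
  assumes "square_integrable M f" "B \<in> sets M"
  shows "square_integrable M (\<lambda>\<omega>. indicator B \<omega> * f \<omega>)"
  using assms by (intro square_integrable_mult_bounded[of _ _ _ 1]) (auto simp: indicator_def)

lemma sqi_indicator: "B \<in> sets M \<Longrightarrow> square_integrable M (indicator B)"
  using sqi_mult_indicator[OF square_integrable_const[OF finite_measure_axioms, of 1]] by simp

lemma sq_martingaleI:
  assumes meas: "\<And>t. t \<in> {0..T} \<Longrightarrow> U t \<in> borel_measurable (F t)"
    and int: "\<And>t. t \<in> {0..T} \<Longrightarrow> square_integrable M (U t)"
    and eq: "\<And>s t B. 0 \<le> s \<Longrightarrow> s \<le> t \<Longrightarrow> t \<le> T \<Longrightarrow> B \<in> sets (F s) \<Longrightarrow>
      (\<integral>\<omega>. indicator B \<omega> * U t \<omega> \<partial>M) = (\<integral>\<omega>. indicator B \<omega> * U s \<omega> \<partial>M)"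
    and cad: "\<And>\<omega>. \<omega> \<in> space M \<Longrightarrow> cadlag_on T (\<lambda>t. U t \<omega>)"
  shows "sq_martingale M F T U"
  unfolding sq_martingale_def
proof (intro conjI ballI martingaleI meas eq cad)
  show "integrable M (U t)" if "t \<in> {0..T}" for t
    by (rule square_integrable_imp_integrable[OF int[OF that]])
  show "integrable M (\<lambda>\<omega>. (U t \<omega>)\<^sup>2)" if "t \<in> {0..T}" for t
    using int[OF that] by (simp add: square_integrable_def)
qed

lemma sq_martingale_lincomb:
  assumes U: "sq_martingale M F T U" and V: "sq_martingale M F T V"
  shows "sq_martingale M F T (\<lambda>t \<omega>. a * U t \<omega> + b * V t \<omega>)"
proof (rule sq_martingaleI)
  fix t assume "t \<in> {0..T}"
  then show "(\<lambda>\<omega>. a * U t \<omega> + b * V t \<omega>) \<in> borel_measurable (F t)"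
    using sq_martingale_meas[OF U] sq_martingale_meas[OF V] by (intro borel_measurable_add borel_measurable_times) auto
  show "square_integrable M (\<lambda>\<omega>. a * U t \<omega> + b * V t \<omega>)" if "t \<in> {0..T}" for t
    using sq_martingale_sqi[OF U that] sq_martingale_sqi[OF V that]
    by (intro square_integrable_add square_integrable_cmult)
next
  fix s t B assume st: "0 \<le> s" "s \<le> t" "t \<le> T" "B \<in> sets (F s)"
  then have s: "s \<in> {0..T}" "t \<in> {0..T}" by auto
  have B: "B \<in> sets M" using sets_F_subset[OF s(1)] st by auto
  have f: "indicator B \<in> borel_measurable (F s)" "square_integrable M (indicator B)"
    using st sqi_indicator[OF B] by auto
  have "(\<integral>\<omega>. indicator B \<omega> * (a * U t \<omega> + b * V t \<omega>) \<partial>M) =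
      a * (\<integral>\<omega>. indicator B \<omega> * U t \<omega> \<partial>M) + b * (\<integral>\<omega>. indicator B \<omega> * V t \<omega> \<partial>M)" if "t \<in> {0..T}" for t
    using square_integrable_mult[OF f(2) sq_martingale_sqi[OF U that]]
      square_integrable_mult[OF f(2) sq_martingale_sqi[OF V that]]
    by (simp add: distrib_left mult.left_commute[of _ a] mult.left_commute[of _ b])
  from this[OF s(1)] this[OF s(2)]
  show "(\<integral>\<omega>. indicator B \<omega> * (a * U t \<omega> + b * V t \<omega>) \<partial>M) = (\<integral>\<omega>. indicator B \<omega> * (a * U s \<omega> + b * V s \<omega>) \<partial>M)"
    using sq_martingale_inner[OF U st(1-3) f] sq_martingale_inner[OF V st(1-3) f] by simp
next
  fix \<omega> assume "\<omega> \<in> space M"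
  note c = sq_martingale_cadlag[OF U this] sq_martingale_cadlag[OF V this]
  show "cadlag_on T (\<lambda>t. a * U t \<omega> + b * V t \<omega>)"
    unfolding cadlag_on_def
  proof (intro conjI ballI)
    fix t assume "t \<in> {0..<T}"
    then show "((\<lambda>t. a * U t \<omega> + b * V t \<omega>) \<longlongrightarrow> a * U t \<omega> + b * V t \<omega>) (at_right t)"
      using c by (intro tendsto_intros) (auto simp: cadlag_on_def)
  next
    fix t assume "t \<in> {0<..T}"
    with c obtain l m where "((\<lambda>t. U t \<omega>) \<longlongrightarrow> l) (at_left t)" "((\<lambda>t. V t \<omega>) \<longlongrightarrow> m) (at_left t)"
      unfolding cadlag_on_def by blast
    then have "((\<lambda>t. a * U t \<omega> + b * V t \<omega>) \<longlongrightarrow> a * l + b * m) (at_left t)"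
      by (intro tendsto_intros)
    then show "\<exists>l. ((\<lambda>t. a * U t \<omega> + b * V t \<omega>) \<longlongrightarrow> l) (at_left t)" by blast
  qed
qed

lemma sq_martingale_diff:
  assumes "sq_martingale M F T U" "sq_martingale M F T V"
  shows "sq_martingale M F T (\<lambda>t \<omega>. U t \<omega> - V t \<omega>)"
  using sq_martingale_lincomb[OF assms, of 1 "-1"] by simp

lemma sq_martingale_zero: "sq_martingale M F T (\<lambda>_ _. 0)"
  by (rule sq_martingaleI) (auto simp: square_integrable_zero cadlag_on_def)

text \<open>On \<open>B\<close> the increment after \<open>s\<close> is orthogonal to
  \<open>U s\<close>, so Pythagoras applies. This is the submartingale property of the square,
  localised to an event of \<open>F s\<close> as Doob's inequality requires.\<close>

lemma sq_martingale_norm_mono: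
  assumes U: "sq_martingale M F T U" and st: "0 \<le> s" "s \<le> t" "t \<le> T"
    and B: "B \<in> sets (F s)"
  shows "(\<integral>\<omega>. indicator B \<omega> * (U s \<omega>)\<^sup>2 \<partial>M) \<le> (\<integral>\<omega>. indicator B \<omega> * (U t \<omega>)\<^sup>2 \<partial>M)"
proof -
  have s: "s \<in> {0..T}" "t \<in> {0..T}" using st by auto
  have B': "B \<in> sets M" using sets_F_subset[OF s(1)] B by auto
  let ?f = "\<lambda>\<omega>. indicator B \<omega> * U s \<omega>" and ?g = "\<lambda>\<omega>. indicator B \<omega> * (U t \<omega> - U s \<omega>)"
  have f: "?f \<in> borel_measurable (F s)" "square_integrable M ?f" "square_integrable M ?g"
    using sq_martingale_meas[OF U s(1)] B sq_martingale_sqi[OF U s(1)] sq_martingale_sqi[OF U s(2)]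
    by (auto intro!: sqi_mult_indicator B' square_integrable_diff)
  have "(\<integral>\<omega>. ?f \<omega> * (U t \<omega> - U s \<omega>) \<partial>M) = 0"
    by (rule sq_martingale_orth[OF U st f(1,2)])
  moreover have "?f \<omega> * (U t \<omega> - U s \<omega>) = ?f \<omega> * ?g \<omega>" for \<omega> by (simp add: indicator_def)
  ultimately have z: "(\<integral>\<omega>. ?f \<omega> * ?g \<omega> \<partial>M) = 0" by simp
  have "(\<integral>\<omega>. (?f \<omega>)\<^sup>2 \<partial>M) \<le> (\<integral>\<omega>. (?f \<omega> + ?g \<omega>)\<^sup>2 \<partial>M)"
    unfolding integral_square_add[OF f(2,3)] z by simp
  moreover have "?f \<omega> + ?g \<omega> = indicator B \<omega> * U t \<omega>" "(indicator B \<omega> * r)\<^sup>2 = indicator B \<omega> * r\<^sup>2" for \<omega> and r :: real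
    by (auto simp: indicator_def)
  ultimately show ?thesis by simp
qed

end

section \<open>Cadlag paths: algebra, stopping, and reduction to countably many times\<close>

lemma cadlag_onI:
  assumes "\<And>t. 0 \<le> t \<Longrightarrow> t < T \<Longrightarrow> (x \<longlongrightarrow> x t) (at_right t)"
    and "\<And>t. 0 < t \<Longrightarrow> t \<le> T \<Longrightarrow> \<exists>l. (x \<longlongrightarrow> l) (at_left t)"
  shows "cadlag_on T x"
  using assms by (auto simp: cadlag_on_def)

text \<open>Continuity of \<open>f\<close> is asked along an arbitrary filter, so that one
  hypothesis covers limits from the right and from the left.\<close>

lemma cadlag_on_map2:
  fixes x :: "real \<Rightarrow> 'b::topological_space" and y :: "real \<Rightarrow> 'c::topological_space"
  assumes x: "cadlag_on T x" and y: "cadlag_on T y"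
    and tend: "\<And>l m G. (x \<longlongrightarrow> l) G \<Longrightarrow> (y \<longlongrightarrow> m) G \<Longrightarrow> ((\<lambda>t. f (x t) (y t)) \<longlongrightarrow> f l m) G"
  shows "cadlag_on T (\<lambda>t. f (x t) (y t))"
proof (rule cadlag_onI)
  fix t assume "0 < t" "t \<le> T"
  then obtain l m where "(x \<longlongrightarrow> l) (at_left t)" "(y \<longlongrightarrow> m) (at_left t)"
    using x y unfolding cadlag_on_def by (meson greaterThanAtMost_iff)
  then show "\<exists>l. ((\<lambda>t. f (x t) (y t)) \<longlongrightarrow> l) (at_left t)" using tend by blast
qed (use x y in \<open>auto simp: cadlag_on_def intro!: tend\<close>)

lemma cadlag_on_const: "cadlag_on T (\<lambda>_. c)"
  by (auto simp: cadlag_on_def)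

lemma cadlag_on_diff:
  fixes x y :: "real \<Rightarrow> 'b::real_normed_vector"
  shows "cadlag_on T x \<Longrightarrow> cadlag_on T y \<Longrightarrow> cadlag_on T (\<lambda>t. x t - y t)"
  by (rule cadlag_on_map2[where f = "(-)"]) (auto intro: tendsto_diff)

lemma cadlag_on_mult:
  fixes x y :: "real \<Rightarrow> 'b::real_normed_algebra"
  shows "cadlag_on T x \<Longrightarrow> cadlag_on T y \<Longrightarrow> cadlag_on T (\<lambda>t. x t * y t)"
  by (rule cadlag_on_map2[where f = "(*)"]) (auto intro: tendsto_mult)

lemma cadlag_on_Re: "cadlag_on T x \<Longrightarrow> cadlag_on T (\<lambda>t. Re (x t))"
  by (rule cadlag_on_map2[where f = "\<lambda>a b. Re a" and y = x]) (auto intro: tendsto_Re)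

lemma cadlag_on_Im: "cadlag_on T x \<Longrightarrow> cadlag_on T (\<lambda>t. Im (x t))"
  by (rule cadlag_on_map2[where f = "\<lambda>a b. Im a" and y = x]) (auto intro: tendsto_Im)

text \<open>Near every time the stopped path is either the original one or a constant. The time
  \<open>u\<close> itself belongs to the constant side for right limits and to the original side for
  left limits.\<close>

lemma cadlag_on_stop:
  assumes x: "cadlag_on T x" and u: "u \<le> T"
  shows "cadlag_on T (\<lambda>t. x (min u t))"
proof (rule cadlag_onI)
  fix t assume t: "0 \<le> t" "t < T"
  show "((\<lambda>t. x (min u t)) \<longlongrightarrow> x (min u t)) (at_right t)"
  proof (cases "t < u")
    case True
    then have "\<forall>\<^sub>F s in at_right t. x s = x (min u s)"
      by (auto simp: eventually_at_right[of t u] intro!: exI[of _ u])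
    with True t x show ?thesis
      by (auto simp: cadlag_on_def intro: Lim_transform_eventually)
  next
    case False
    then have "\<forall>\<^sub>F s in at_right t. x (min u t) = x (min u s)"
      by (auto simp: eventually_at_right[of t "t + 1"] min_def intro!: exI[of _ "t + 1"])
    then show ?thesis by (rule Lim_transform_eventually[OF tendsto_const])
  qed
next
  fix t assume t: "0 < t" "t \<le> T"
  show "\<exists>l. ((\<lambda>t. x (min u t)) \<longlongrightarrow> l) (at_left t)"
  proof (cases "t \<le> u")
    case True
    then have ev: "\<forall>\<^sub>F s in at_left t. x s = x (min u s)"
      by (auto simp: eventually_at_left[of "t - 1" t] min_def intro!: exI[of _ "t - 1"])
    from t x obtain l where "(x \<longlongrightarrow> l) (at_left t)"
      unfolding cadlag_on_def by (meson greaterThanAtMost_iff)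
    from Lim_transform_eventually[OF this ev] show ?thesis by (rule exI)
  next
    case False
    then have "\<forall>\<^sub>F s in at_left t. x u = x (min u s)"
      by (auto simp: eventually_at_left[of u t] min_def intro!: exI[of _ u])
    from Lim_transform_eventually[OF tendsto_const this] show ?thesis by (rule exI)
  qed
qed

text \<open>Right continuity carries the bound from rational times to all times before
  \<open>T\<close>. At \<open>T\<close> no right limit is at hand, hence the extra point.\<close>

lemma cadlag_on_bound_dense:
  fixes x :: "real \<Rightarrow> real"
  assumes x: "cadlag_on T x" and bd: "\<And>t. t \<in> insert T ({0..T} \<inter> \<rat>) \<Longrightarrow> \<bar>x t\<bar> \<le> e"
    and t: "t \<in> {0..T}"
  shows "\<bar>x t\<bar> \<le> e"
proof (cases "t = T")
  case False
  with t have t': "t \<in> {0..<T}" by auto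
  show ?thesis
  proof (rule ccontr)
    assume "\<not> \<bar>x t\<bar> \<le> e"
    moreover have "((\<lambda>s. \<bar>x s\<bar>) \<longlongrightarrow> \<bar>x t\<bar>) (at_right t)"
      using x t' by (intro tendsto_rabs) (auto simp: cadlag_on_def)
    ultimately have "\<forall>\<^sub>F s in at_right t. e < \<bar>x s\<bar>"
      by (intro order_tendstoD(1)) auto
    then obtain b where b: "t < b" "\<And>s. t < s \<Longrightarrow> s < b \<Longrightarrow> e < \<bar>x s\<bar>"
      unfolding eventually_at_right[OF less_add_one] by auto
    obtain q where q: "q \<in> \<rat>" "t < q" "q < min b T"
      using Rats_dense_in_real[of t "min b T"] b t' by auto
    with bd[of q] b(2)[of q] t' show False by auto
  qed
qed (use bd in auto)

lemma countable_dense_times: "countable (insert T ({0..T} \<inter> \<rat>))"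
  by (intro countable_insert countable_Int2 countable_rat)

context filtered_basis
begin

text \<open>Off a single null set the processes agree on a countable dense set of times, and right
  continuity extends the equality to all times.\<close>

lemma indist_real_cadlagI:
  fixes U V :: "real \<Rightarrow> 'a \<Rightarrow> real"
  assumes "\<And>\<omega>. \<omega> \<in> space M \<Longrightarrow> cadlag_on T (\<lambda>t. U t \<omega>)" "\<And>\<omega>. \<omega> \<in> space M \<Longrightarrow> cadlag_on T (\<lambda>t. V t \<omega>)"
    and "\<And>t. t \<in> {0..T} \<Longrightarrow> AE \<omega> in M. U t \<omega> = V t \<omega>"
  shows "indist M T U V"
proof -
  have ae: "AE \<omega> in M. \<forall>t\<in>insert T ({0..T} \<inter> \<rat>). U t \<omega> = V t \<omega>"
    unfolding AE_ball_countable[OF countable_dense_times] using assms(3) T_pos by simp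
  have key: "U t \<omega> = V t \<omega>" if \<omega>: "\<omega> \<in> space M"
    and e: "\<forall>t\<in>insert T ({0..T} \<inter> \<rat>). U t \<omega> = V t \<omega>" and t: "t \<in> {0..T}" for \<omega> t
  proof -
    have "\<bar>U t \<omega> - V t \<omega>\<bar> \<le> 0"
      by (rule cadlag_on_bound_dense[OF cadlag_on_diff[OF assms(1,2)] _ t]) (use \<omega> e in auto)
    then show ?thesis by simp
  qed
  show ?thesis
    unfolding indist_def using ae AE_space by eventually_elim (blast intro: key)
qed

text \<open>Both processes are conditional expectations of their terminal values; cadlag paths make
  the equality simultaneous in time.\<close>

lemma sq_martingale_eq_terminal:
  assumes U: "sq_martingale M F T U" and V: "sq_martingale M F T V"
    and eq: "AE \<omega> in M. U T \<omega> = V T \<omega>"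
  shows "indist M T U V"
proof (rule indist_real_cadlagI)
  fix t assume t: "t \<in> {0..T}"
  have TT: "T \<in> {0..T}" using T_pos by auto
  interpret sigma_finite_subalgebra M "F t" by (rule sigma_finite_subalg) fact
  have m: "U T \<in> borel_measurable M" "V T \<in> borel_measurable M"
    using sq_martingale_sqi[OF U TT] sq_martingale_sqi[OF V TT] by (auto simp: square_integrable_def)
  have "AE \<omega> in M. real_cond_exp M (F t) (U T) \<omega> = U t \<omega>" "AE \<omega> in M. real_cond_exp M (F t) (V T) \<omega> = V t \<omega>"
    using U V t unfolding sq_martingale_def martingale_def by auto
  with real_cond_exp_cong[OF eq m] show "AE \<omega> in M. U t \<omega> = V t \<omega>"
    by auto
qed (use sq_martingale_cadlag U V in auto)

text \<open>The exceedance is split according to the first time in \<open>D\<close> at which it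
  happens. Each piece is an event known at that time, so Chebyshev bounds its mass by the second
  moment of \<open>U\<close> on it at that time, hence by the one at \<open>T\<close>.\<close>

lemma Doob_finite:
  assumes U: "sq_martingale M F T U" and e: "0 < e" and D: "finite D" "D \<subseteq> {0..T}"
  shows "measure M {\<omega> \<in> space M. \<exists>t\<in>D. e < \<bar>U t \<omega>\<bar>} * e\<^sup>2 \<le> (\<integral>\<omega>. (U T \<omega>)\<^sup>2 \<partial>M)"
proof -
  define B where "B t = {\<omega> \<in> space M. e < \<bar>U t \<omega>\<bar> \<and> (\<forall>s\<in>D. s < t \<longrightarrow> \<bar>U s \<omega>\<bar> \<le> e)}" for t
  have TT: "T \<in> {0..T}" using T_pos by auto
  have BF: "B t \<in> sets (F t)" if t: "t \<in> D" for t
  proof -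
    have m: "U s \<in> borel_measurable (F t)" if "s \<in> D" "s \<le> t" for s
      using that t D by (intro measurable_F_mono[OF sq_martingale_meas[OF U]]) auto
    have "{\<omega> \<in> space (F t). e < \<bar>U t \<omega>\<bar> \<and> (\<forall>s\<in>{s\<in>D. s < t}. \<bar>U s \<omega>\<bar> \<le> e)} \<in> sets (F t)"
    proof (intro sets.sets_Collect_conj sets.sets_Collect_finite_All)
      have [measurable]: "U t \<in> borel_measurable (F t)" using m[OF t] by simp
      show "{\<omega> \<in> space (F t). e < \<bar>U t \<omega>\<bar>} \<in> sets (F t)" by measurable
    next
      fix s assume s: "s \<in> {s \<in> D. s < t}"
      have [measurable]: "U s \<in> borel_measurable (F t)" using m[of s] s by simp
      show "{\<omega> \<in> space (F t). \<bar>U s \<omega>\<bar> \<le> e} \<in> sets (F t)" by measurable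
    qed (use D in auto)
    moreover have "{\<omega> \<in> space (F t). e < \<bar>U t \<omega>\<bar> \<and> (\<forall>s\<in>{s\<in>D. s < t}. \<bar>U s \<omega>\<bar> \<le> e)} = B t"
      using t D space_F[of t] by (auto simp: B_def)
    ultimately show ?thesis by simp
  qed
  then have B[measurable]: "B t \<in> sets M" if "t \<in> D" for t
    using BF[OF that] sets_F_subset[of t] that D by blast
  have disj: "disjoint_family_on B D"
    unfolding disjoint_family_on_def
  proof (intro ballI impI equals0I)
    fix s t \<omega> assume "s \<in> D" "t \<in> D" "s \<noteq> t" "\<omega> \<in> B s \<inter> B t"
    then show False by (cases "s < t") (force simp: B_def)+
  qed
  have un: "{\<omega> \<in> space M. \<exists>t\<in>D. e < \<bar>U t \<omega>\<bar>} = (\<Union>t\<in>D. B t)"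
  proof (intro equalityI subsetI)
    fix \<omega> assume "\<omega> \<in> {\<omega> \<in> space M. \<exists>t\<in>D. e < \<bar>U t \<omega>\<bar>}"
    then have \<omega>: "\<omega> \<in> space M" and ne: "{t\<in>D. e < \<bar>U t \<omega>\<bar>} \<noteq> {}" by auto
    define t where "t = Min {t\<in>D. e < \<bar>U t \<omega>\<bar>}"
    have "t \<in> {t\<in>D. e < \<bar>U t \<omega>\<bar>}" unfolding t_def using D ne by (intro Min_in) auto
    moreover have "\<bar>U s \<omega>\<bar> \<le> e" if "s \<in> D" "s < t" for s
    proof (rule ccontr)
      assume "\<not> \<bar>U s \<omega>\<bar> \<le> e"
      then have "t \<le> s" unfolding t_def using D that by (intro Min_le) auto
      with that show False by simp
    qed
    ultimately show "\<omega> \<in> (\<Union>t\<in>D. B t)" using \<omega> by (auto simp: B_def)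
  qed (auto simp: B_def)
  have sqT: "square_integrable M (U T)" by (rule sq_martingale_sqi[OF U TT])
  have intT: "integrable M (\<lambda>\<omega>. indicator (B t) \<omega> * (U T \<omega>)\<^sup>2)" if "t \<in> D" for t
    using integrable_mult_indicator[OF B[OF that], of "\<lambda>\<omega>. (U T \<omega>)\<^sup>2"] sqT
    by (simp add: square_integrable_def)
  have step: "measure M (B t) * e\<^sup>2 \<le> (\<integral>\<omega>. indicator (B t) \<omega> * (U T \<omega>)\<^sup>2 \<partial>M)" if t: "t \<in> D" for t
  proof -
    have t': "t \<in> {0..T}" using t D by auto
    have "measure M (B t) * e\<^sup>2 = (\<integral>\<omega>. indicator (B t) \<omega> * e\<^sup>2 \<partial>M)"
      using B[OF t] by simp
    also have "\<dots> \<le> (\<integral>\<omega>. indicator (B t) \<omega> * (U t \<omega>)\<^sup>2 \<partial>M)"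
    proof (rule integral_mono)
      show "integrable M (\<lambda>\<omega>. indicator (B t) \<omega> * e\<^sup>2)"
        by (intro integrable_mult_left square_integrable_imp_integrable sqi_indicator B[OF t])
      show "integrable M (\<lambda>\<omega>. indicator (B t) \<omega> * (U t \<omega>)\<^sup>2)"
        using integrable_mult_indicator[OF B[OF t], of "\<lambda>\<omega>. (U t \<omega>)\<^sup>2"] sq_martingale_sqi[OF U t']
        by (simp add: square_integrable_def)
      show "indicator (B t) \<omega> * e\<^sup>2 \<le> indicator (B t) \<omega> * (U t \<omega>)\<^sup>2" for \<omega>
        using e power_mono[of e "\<bar>U t \<omega>\<bar>" 2] by (auto simp: indicator_def B_def)
    qed
    also have "\<dots> \<le> (\<integral>\<omega>. indicator (B t) \<omega> * (U T \<omega>)\<^sup>2 \<partial>M)"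
      using t' by (intro sq_martingale_norm_mono[OF U _ _ _ BF[OF t]]) auto
    finally show ?thesis .
  qed
  have "measure M {\<omega> \<in> space M. \<exists>t\<in>D. e < \<bar>U t \<omega>\<bar>} * e\<^sup>2 = (\<Sum>t\<in>D. measure M (B t)) * e\<^sup>2"
    unfolding un using D B disj by (subst finite_measure_finite_Union) auto
  also have "\<dots> = (\<Sum>t\<in>D. measure M (B t) * e\<^sup>2)" by (rule sum_distrib_right)
  also have "\<dots> \<le> (\<Sum>t\<in>D. \<integral>\<omega>. indicator (B t) \<omega> * (U T \<omega>)\<^sup>2 \<partial>M)"
    by (rule sum_mono[OF step])
  also have "\<dots> = (\<integral>\<omega>. (\<Sum>t\<in>D. indicator (B t) \<omega> * (U T \<omega>)\<^sup>2) \<partial>M)"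
    by (rule Bochner_Integration.integral_sum[symmetric]) (rule intT)
  also have "\<dots> \<le> (\<integral>\<omega>. (U T \<omega>)\<^sup>2 \<partial>M)"
  proof (rule integral_mono)
    show "integrable M (\<lambda>\<omega>. \<Sum>t\<in>D. indicator (B t) \<omega> * (U T \<omega>)\<^sup>2)"
      by (rule Bochner_Integration.integrable_sum[OF intT])
    show "integrable M (\<lambda>\<omega>. (U T \<omega>)\<^sup>2)" using sqT by (simp add: square_integrable_def)
    fix \<omega>
    \<comment> \<open>The events are disjoint, so the indicators add up to at most 1.\<close>
    have "(\<Sum>t\<in>D. indicator (B t) \<omega>) = (indicator (\<Union>t\<in>D. B t) \<omega> :: real)"
      by (rule indicator_UN_disjoint[OF D(1) disj, symmetric])
    then have "(\<Sum>t\<in>D. indicator (B t) \<omega>) \<le> (1::real)" by (simp add: indicator_def)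
    then show "(\<Sum>t\<in>D. indicator (B t) \<omega> * (U T \<omega>)\<^sup>2) \<le> (U T \<omega>)\<^sup>2"
      unfolding sum_distrib_right[symmetric] by (intro mult_left_le_one_le) (auto intro: sum_nonneg)
  qed
  finally show ?thesis .
qed

text \<open>A strict exceedance at any time is also seen at a time of a countable set, by right
  continuity; this gives measurability as well. Finite subsets exhaust the countable set, and
  continuity from below carries the bound over.\<close>

lemma Doob_maximal:
  assumes U: "sq_martingale M F T U" and e: "0 < e"
  shows "{\<omega> \<in> space M. \<exists>t\<in>{0..T}. e < \<bar>U t \<omega>\<bar>} \<in> sets M" (is "?E \<in> _")
    and "measure M {\<omega> \<in> space M. \<exists>t\<in>{0..T}. e < \<bar>U t \<omega>\<bar>} * e\<^sup>2 \<le> (\<integral>\<omega>. (U T \<omega>)\<^sup>2 \<partial>M)"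
proof -
  define D where "D = insert T ({0..T} \<inter> \<rat>)"
  define d where "d = from_nat_into D"
  have D: "range d = D" "D \<subseteq> {0..T}"
  proof -
    show "range d = D"
      unfolding d_def by (rule range_from_nat_into) (simp_all only: D_def countable_dense_times, simp)
  qed (use T_pos in \<open>auto simp: D_def\<close>)
  define E where "E n = {\<omega> \<in> space M. \<exists>i\<in>{..n}. e < \<bar>U (d i) \<omega>\<bar>}" for n :: nat
  have dT: "d i \<in> {0..T}" for i using D(1,2) by blast
  have [measurable]: "U (d i) \<in> borel_measurable M" for i
    using sq_martingale_sqi[OF U dT] by (simp add: square_integrable_def)
  have E[measurable]: "E n \<in> sets M" for n
    unfolding E_def by measurable
  have "?E = (\<Union>n. E n)"
  proof (intro equalityI subsetI)
    fix \<omega> assume \<omega>: "\<omega> \<in> ?E"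
    have "\<exists>t\<in>D. e < \<bar>U t \<omega>\<bar>"
    proof (rule ccontr)
      assume "\<not> ?thesis"
      then have *: "\<bar>U t \<omega>\<bar> \<le> e" if "t \<in> D" for t using that by (auto simp: not_less)
      have "\<bar>U t \<omega>\<bar> \<le> e" if "t \<in> {0..T}" for t
        by (rule cadlag_on_bound_dense[OF sq_martingale_cadlag[OF U] _ that]) (use \<omega> * in \<open>auto simp: D_def\<close>)
      with \<omega> show False by force
    qed
    then show "\<omega> \<in> (\<Union>n. E n)" using \<omega> D(1)[symmetric] by (auto simp: E_def)
  qed (use D dT in \<open>auto simp: E_def\<close>)
  then show "?E \<in> sets M" by simp
  have "(\<lambda>n. measure M (E n)) \<longlonglongrightarrow> measure M ?E"
    unfolding \<open>?E = (\<Union>n. E n)\<close> by (intro finite_Lim_measure_incseq) (auto simp: incseq_def E_def)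
  then have "(\<lambda>n. measure M (E n) * e\<^sup>2) \<longlonglongrightarrow> measure M ?E * e\<^sup>2"
    by (rule tendsto_mult_right)
  then show "measure M ?E * e\<^sup>2 \<le> (\<integral>\<omega>. (U T \<omega>)\<^sup>2 \<partial>M)"
  proof (rule LIMSEQ_le_const2, intro exI allI impI)
    fix n
    show "measure M (E n) * e\<^sup>2 \<le> (\<integral>\<omega>. (U T \<omega>)\<^sup>2 \<partial>M)"
    proof -
      have "d ` {..n} \<subseteq> {0..T}" using dT by blast
      from Doob_finite[OF U e _ this] show ?thesis by (simp add: E_def)
    qed
  qed
qed

text \<open>Time is discretised from the right, where the paths are continuous. The discretised
  process is patched from countably many \<open>F t\<close>-measurable variables.\<close>

lemma adapted_cadlag_progressive:
  fixes U :: "real \<Rightarrow> 'a \<Rightarrow> real"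
  assumes meas: "\<And>t. t \<in> {0..T} \<Longrightarrow> U t \<in> borel_measurable (F t)"
    and cad: "\<And>\<omega>. \<omega> \<in> space M \<Longrightarrow> cadlag_on T (\<lambda>t. U t \<omega>)" and t: "t \<in> {0..T}"
  shows "(\<lambda>(s, \<omega>). U s \<omega>) \<in> borel_measurable (restrict_space borel {0..t} \<Otimes>\<^sub>M F t)"
proof -
  \<comment> \<open>With \<open>i\<close> the floor of \<open>s * Suc n\<close> this is the next
    grid point strictly after s, cut off at \<open>t\<close> so that only
    \<open>F t\<close>-measurable values occur.\<close>
  define r where "r i n = max 0 (min t ((real_of_int i + 1) / real (Suc n)))" for i and n :: nat
  have rt: "r i n \<in> {0..t}" for i n using t by (auto simp: r_def)
  show ?thesis
  proof (rule borel_measurable_LIMSEQ_real)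
    fix n
    have [measurable]: "U (r i n) \<in> borel_measurable (F t)" for i
      using rt[of i n] t by (intro measurable_F_mono[OF meas]) auto
    have [measurable]: "(\<lambda>z. \<lfloor>fst z * real (Suc n)\<rfloor>) \<in>
        measurable (restrict_space borel {0..t} \<Otimes>\<^sub>M F t) (count_space UNIV)"
    proof -
      have "(\<lambda>s. \<lfloor>s * real (Suc n)\<rfloor>) \<in> measurable borel (count_space UNIV)" by measurable
      from measurable_restrict_space1[OF this] show ?thesis
        by (rule measurable_compose[OF measurable_fst])
    qed
    show "(\<lambda>z. U (r \<lfloor>fst z * real (Suc n)\<rfloor> n) (snd z)) \<in> borel_measurable (restrict_space borel {0..t} \<Otimes>\<^sub>M F t)"
      by (rule measurable_compose_countable) measurable
  next
    fix z assume "z \<in> space (restrict_space borel {0..t} \<Otimes>\<^sub>M F t)"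
    then obtain s \<omega> where z: "z = (s, \<omega>)" "0 \<le> s" "s \<le> t" "\<omega> \<in> space M"
      using space_F[OF t] by (auto simp: space_pair_measure space_restrict_space)
    let ?i = "\<lambda>n. \<lfloor>s * real (Suc n)\<rfloor>"
    let ?r = "\<lambda>n. (real_of_int (?i n) + 1) / real (Suc n)"
    have r1: "s < ?r n" for n
      by (simp add: pos_less_divide_eq)
    have r2: "?r n \<le> s + 1 / real (Suc n)" for n
    proof -
      have "real_of_int (?i n) + 1 \<le> s * real (Suc n) + 1" by linarith
      then have "?r n \<le> (s * real (Suc n) + 1) / real (Suc n)" by (rule divide_right_mono) simp
      also have "\<dots> = s + 1 / real (Suc n)" by (simp add: add_divide_distrib)
      finally show ?thesis .
    qed
    have "(\<lambda>n. U (r (?i n) n) \<omega>) \<longlonglongrightarrow> U s \<omega>"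
    \<comment> \<open>At the right end the cut-off returns s itself, since values after
      \<open>t\<close> are not \<open>F t\<close>-measurable in general.\<close>
    proof (cases "s = t")
      case True
      have "r (?i n) n = s" for n using r1[of n] True z by (auto simp: r_def)
      then show ?thesis by simp
    next
      case False
      then have st: "s < t" using z by auto
      have lim: "?r \<longlonglongrightarrow> s"
      proof (rule tendsto_sandwich[of "\<lambda>_. s"])
        show "(\<lambda>n. s + 1 / real (Suc n)) \<longlonglongrightarrow> s"
          using tendsto_add[OF tendsto_const[of s] LIMSEQ_inverse_real_of_nat]
          by (simp add: inverse_eq_divide)
      qed (use r1 r2 in \<open>auto simp: less_imp_le\<close>)
      have ev: "\<forall>\<^sub>F n in sequentially. U (?r n) \<omega> = U (r (?i n) n) \<omega>"
        using order_tendstoD(2)[OF lim st]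
      proof eventually_elim
        case (elim n)
        then have "r (?i n) n = ?r n" using r1[of n] z by (auto simp: r_def)
        then show ?case by simp
      qed
      have "filterlim ?r (at_right s) sequentially"
        by (rule tendsto_imp_filterlim_at_right[OF lim]) (rule always_eventually, rule allI, rule r1)
      moreover have "((\<lambda>s. U s \<omega>) \<longlongrightarrow> U s \<omega>) (at_right s)"
        using cad[OF z(4)] z st t by (auto simp: cadlag_on_def)
      ultimately have "(\<lambda>n. U (?r n) \<omega>) \<longlonglongrightarrow> U s \<omega>"
        by (rule filterlim_compose[rotated])
      then show ?thesis by (rule Lim_transform_eventually[OF _ ev])
    qed
    then show "(\<lambda>n. U (r \<lfloor>fst z * real (Suc n)\<rfloor> n) (snd z)) \<longlonglongrightarrow> (case z of (s, \<omega>) \<Rightarrow> U s \<omega>)"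
      by (simp add: z)
  qed
qed

lemma sq_martingale_elementary_single:
  assumes S: "sq_martingale M F T S" and su: "0 \<le> s" "s \<le> u" "u \<le> T"
    and \<phi>: "\<phi> \<in> borel_measurable (F s)" "\<And>\<omega>. \<omega> \<in> space M \<Longrightarrow> \<bar>\<phi> \<omega>\<bar> \<le> c"
  shows "sq_martingale M F T (\<lambda>t \<omega>. \<phi> \<omega> * (S (min u t) \<omega> - S (min s t) \<omega>))"
proof (rule sq_martingaleI)
  have s0: "s \<in> {0..T}" using su by auto
  have \<phi>M: "\<phi> \<in> borel_measurable M" using measurable_F_imp_M[OF \<phi>(1) s0] .
  have sqi: "square_integrable M (S (min u t))" "square_integrable M (S (min s t))" if "t \<in> {0..T}" for t
    using that su by (auto intro!: sq_martingale_sqi[OF S])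
  show "square_integrable M (\<lambda>\<omega>. \<phi> \<omega> * (S (min u t) \<omega> - S (min s t) \<omega>))" if "t \<in> {0..T}" for t
    using sqi[OF that] \<phi>(2) by (intro square_integrable_mult_bounded[OF _ \<phi>M] square_integrable_diff)
  show "(\<lambda>\<omega>. \<phi> \<omega> * (S (min u t) \<omega> - S (min s t) \<omega>)) \<in> borel_measurable (F t)" if t: "t \<in> {0..T}" for t
  \<comment> \<open>Up to time \<open>s\<close> both stopped values are \<open>S t\<close> and the
    product vanishes, although \<open>\<phi>\<close> is in general not yet known.\<close>
  proof (cases "t \<le> s")
    case True
    then show ?thesis using su by (simp add: min_absorb2)
  next
    case False
    then have "\<phi> \<in> borel_measurable (F t)" "S (min u t) \<in> borel_measurable (F t)" "S (min s t) \<in> borel_measurable (F t)"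
      using t su by (auto intro!: measurable_F_mono[OF \<phi>(1)] measurable_F_mono[OF sq_martingale_meas[OF S]])
    then show ?thesis by measurable
  qed
  show "cadlag_on T (\<lambda>t. \<phi> \<omega> * (S (min u t) \<omega> - S (min s t) \<omega>))" if "\<omega> \<in> space M" for \<omega>
    using sq_martingale_cadlag[OF S that] su
    by (intro cadlag_on_mult cadlag_on_const cadlag_on_diff cadlag_on_stop) auto
  fix r t B assume rt: "0 \<le> r" "r \<le> t" "t \<le> T" and B: "B \<in> sets (F r)"
  have BM: "B \<in> sets M" using B sets_F_subset[of r] rt by auto
  show "(\<integral>\<omega>. indicator B \<omega> * (\<phi> \<omega> * (S (min u t) \<omega> - S (min s t) \<omega>)) \<partial>M) =
      (\<integral>\<omega>. indicator B \<omega> * (\<phi> \<omega> * (S (min u r) \<omega> - S (min s r) \<omega>)) \<partial>M)"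
  proof (cases "t \<le> s")
    case True
    then show ?thesis using su rt by (simp add: min_absorb2)
  next
    case False
    \<comment> \<open>the increments up to \<open>r\<close> cancel, and \<open>v = max s r\<close> starts the remaining one\<close>
    define v where "v = max s r"
    define w where "w = max v (min u t)"
    let ?f = "\<lambda>\<omega>. indicator B \<omega> * \<phi> \<omega>"
    have v: "0 \<le> v" "v \<le> w" "w \<le> T" using su rt False by (auto simp: v_def w_def)
    have f: "?f \<in> borel_measurable (F v)"
    proof (rule borel_measurable_times)
      have "B \<in> sets (F v)" using F_mono[of r v] B v rt su False by (auto simp: v_def)
      then show "indicator B \<in> borel_measurable (F v)" by simp
      show "\<phi> \<in> borel_measurable (F v)"
        using su rt False by (intro measurable_F_mono[OF \<phi>(1)]) (auto simp: v_def)
    qed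
    have sf: "square_integrable M ?f"
    proof -
      have "square_integrable M (\<lambda>\<omega>. \<phi> \<omega> * 1)"
        by (rule square_integrable_mult_bounded[OF square_integrable_const[OF finite_measure_axioms] \<phi>M \<phi>(2)])
      from sqi_mult_indicator[OF this BM] show ?thesis by simp
    qed
    have z: "(\<integral>\<omega>. ?f \<omega> * (S w \<omega> - S v \<omega>) \<partial>M) = 0"
      by (rule sq_martingale_orth[OF S v f sf])
    have rT: "r \<in> {0..T}" "v \<in> {0..T}" "w \<in> {0..T}" using rt v by auto
    have "indicator B \<omega> * (\<phi> \<omega> * (S (min u t) \<omega> - S (min s t) \<omega>)) =
      ?f \<omega> * (S w \<omega> - S v \<omega>) + ?f \<omega> * (S (min u r) \<omega> - S (min s r) \<omega>)" for \<omega>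
    proof -
      have "S (min u t) \<omega> - S (min s t) \<omega> = (S w \<omega> - S v \<omega>) + (S (min u r) \<omega> - S (min s r) \<omega>)"
        using su rt False by (auto simp: w_def v_def min_def max_def)
      then show ?thesis by (simp only: distrib_left[symmetric] mult.assoc)
    qed
    moreover have "integrable M (\<lambda>\<omega>. ?f \<omega> * (S w \<omega> - S v \<omega>))"
      by (intro square_integrable_mult[OF sf] square_integrable_diff sq_martingale_sqi[OF S] rT)
    moreover have "integrable M (\<lambda>\<omega>. ?f \<omega> * (S (min u r) \<omega> - S (min s r) \<omega>))"
      by (intro square_integrable_mult[OF sf] square_integrable_diff sqi rT)
    ultimately show ?thesis using z by (simp add: mult.assoc)
  qed
qed

lemma sq_martingale_elem_integral:
  assumes S: "sq_martingale M F T S" and E: "elementary M F T E"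
  shows "sq_martingale M F T (elem_integral S E)"
  using E
proof (induction E)
  case Nil
  then show ?case using sq_martingale_zero by (simp add: elem_integral_def[abs_def])
next
  case (Cons e E)
  obtain s u \<phi> where e: "e = (s, u, \<phi>)" by (cases e)
  from Cons.prems obtain c where su: "0 \<le> s" "s \<le> u" "u \<le> T" "\<phi> \<in> borel_measurable (F s)"
    "\<And>\<omega>. \<omega> \<in> space M \<Longrightarrow> \<bar>\<phi> \<omega>\<bar> \<le> c" and E: "elementary M F T E"
    by (auto simp: elementary_def e)
  show ?case
    using sq_martingale_lincomb[OF sq_martingale_elementary_single[OF S su] Cons.IH[OF E], of 1 1]
    by (simp add: elem_integral_def[abs_def] e)
qed

end

section \<open>Predictable processes and the measure \<open>d\<langle>S, S\<rangle> \<otimes> dP\<close>\<close>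

context filtered_basis
begin

abbreviation "predictable_gen \<equiv>
   {{0} \<times> B |B. B \<in> sets (F 0)} \<union>
   {{s<..t} \<times> B |s t B. 0 \<le> s \<and> s < t \<and> t \<le> T \<and> B \<in> sets (F s)}"

lemma predictable_gen_subset: "predictable_gen \<subseteq> Pow ({0..T} \<times> space M)"
proof -
  have "B \<subseteq> space M" if "B \<in> sets (F s)" "0 \<le> s" "s \<le> T" for B s
    using sets.sets_into_space[OF that(1)] space_F[of s] that by simp
  then show ?thesis using T_pos by force
qed

lemma space_in_F: "t \<in> {0..T} \<Longrightarrow> space M \<in> sets (F t)"
  using sets.top[of "F t"] space_F[of t] by simp

lemma space_predictable [simp]: "space (predictable_sigma M F T) = {0..T} \<times> space M"
  unfolding predictable_sigma_def by (rule space_measure_of[OF predictable_gen_subset])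

lemma sets_predictable:
  "sets (predictable_sigma M F T) = sigma_sets ({0..T} \<times> space M) predictable_gen"
  unfolding predictable_sigma_def by (rule sets_measure_of[OF predictable_gen_subset])

lemma predictable_zero_rect: "B \<in> sets (F 0) \<Longrightarrow> {0} \<times> B \<in> sets (predictable_sigma M F T)"
  unfolding sets_predictable by (rule sigma_sets.Basic) blast

lemma predictable_rect:
  assumes "0 \<le> s" "s \<le> t" "t \<le> T" "B \<in> sets (F s)"
  shows "{s<..t} \<times> B \<in> sets (predictable_sigma M F T)"
proof (cases "s = t")
  case False
  then show ?thesis
    unfolding sets_predictable using assms by (intro sigma_sets.Basic) auto
qed simp

text \<open>Overlapping intervals use that \<open>F\<close> increases, so both bases are known at
  the later left end. Disjoint time sets give the empty set, which is in the family as a rectangle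
  over time 0.\<close>

lemma Int_stable_predictable_gen: "Int_stable predictable_gen"
proof (rule Int_stableI)
  fix a b assume ab: "a \<in> predictable_gen" "b \<in> predictable_gen"
  define P where "P c \<longleftrightarrow> (\<exists>B\<in>sets (F 0). c = {0} \<times> B)" for c :: "(real \<times> 'a) set"
  define R where "R c \<longleftrightarrow> (\<exists>s t B. 0 \<le> s \<and> s < t \<and> t \<le> T \<and> B \<in> sets (F s) \<and> c = {s<..t} \<times> B)" for c :: "(real \<times> 'a) set"
  have gen: "c \<in> predictable_gen \<longleftrightarrow> P c \<or> R c" for c
    unfolding P_def R_def by blast
  have PP: "P (a \<inter> b)" if "P a" "P b" for a b
    using that unfolding P_def by (metis Times_Int_Times Int_absorb sets.Int)
  have empty: "P {}" unfolding P_def by (rule bexI[of _ "{}"]) auto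
  have PR: "P (a \<inter> b)" if "P a" "R b" for a b
  proof -
    have "a \<inter> b = {}" using that unfolding P_def R_def by force
    then show ?thesis using empty by simp
  qed
  have RR: "P (a \<inter> b) \<or> R (a \<inter> b)" if "R a" "R b" for a b
  proof -
    from that(1) obtain s t B where a: "0 \<le> s" "s < t" "t \<le> T" "B \<in> sets (F s)" "a = {s<..t} \<times> B"
      unfolding R_def by blast
    from that(2) obtain s' t' B' where b: "0 \<le> s'" "s' < t'" "t' \<le> T" "B' \<in> sets (F s')" "b = {s'<..t'} \<times> B'"
      unfolding R_def by blast
    have ab: "a \<inter> b = {max s s'<..min t t'} \<times> (B \<inter> B')" unfolding a(5) b(5) by auto
    show ?thesis
    proof (cases "max s s' < min t t'")
      case True
      have "B \<in> sets (F (max s s'))" "B' \<in> sets (F (max s s'))"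
        using a(1-3) b(1-3) True by (auto intro: subsetD[OF F_mono a(4)] subsetD[OF F_mono b(4)])
      then have "R (a \<inter> b)" unfolding R_def ab using a(1-4) b(1-4) True
        by (intro exI[of _ "max s s'"] exI[of _ "min t t'"] exI[of _ "B \<inter> B'"] conjI sets.Int refl) simp_all
      then show ?thesis ..
    next
      case False
      then have "a \<inter> b = {}" unfolding ab by auto
      then show ?thesis using empty by simp
    qed
  qed
  show "a \<inter> b \<in> predictable_gen"
    using ab PP[of a b] PR[of a b] PR[of b a] RR[of a b] unfolding gen Int_commute[of b a] by argo
qed

text \<open>Sections of predictable sets at a fixed scenario are Borel, as integration along a path
  requires.\<close>

lemma measurable_predictable_time:
  assumes \<omega>: "\<omega> \<in> space M"
  shows "(\<lambda>t. (t, \<omega>)) \<in> measurable (restrict_space borel {0..T}) (predictable_sigma M F T)"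
  unfolding predictable_sigma_def
proof (rule measurable_measure_of[OF predictable_gen_subset])
  show "(\<lambda>t. (t, \<omega>)) \<in> space (restrict_space borel {0..T}) \<rightarrow> {0..T} \<times> space M"
    using \<omega> by (auto simp: space_restrict_space)
  fix y assume "y \<in> predictable_gen"
  then obtain I B where y: "y = I \<times> B" "I \<in> sets borel"
    by (elim UnE CollectE exE conjE) auto
  have "(\<lambda>t. (t, \<omega>)) -` y \<inter> space (restrict_space borel {0..T}) = {0..T} \<inter> (if \<omega> \<in> B then I else {})"
    by (auto simp: y space_restrict_space)
  also have "\<dots> \<in> sets (restrict_space borel {0..T})"
    using y by (auto simp: sets_restrict_space)
  finally show "(\<lambda>t. (t, \<omega>)) -` y \<inter> space (restrict_space borel {0..T}) \<in> sets (restrict_space borel {0..T})" .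
qed

text \<open>Turns predictability into measurability at a fixed time; it is applied to the bracket
  \<open>A\<close>.\<close>

lemma measurable_predictable_point:
  assumes t: "t \<in> {0..T}"
  shows "(\<lambda>\<omega>. (t, \<omega>)) \<in> measurable M (predictable_sigma M F T)"
  unfolding predictable_sigma_def
proof (rule measurable_measure_of[OF predictable_gen_subset])
  show "(\<lambda>\<omega>. (t, \<omega>)) \<in> space M \<rightarrow> {0..T} \<times> space M" using t by auto
  fix y assume "y \<in> predictable_gen"
  then obtain I B s where y: "y = I \<times> B" and B: "s \<in> {0..T}" "B \<in> sets (F s)"
  proof (elim UnE CollectE exE conjE)
    fix B assume "y = {0} \<times> B" "B \<in> sets (F 0)"
    then show thesis using T_pos by (intro that[of _ B 0]) auto
  next
    fix s u B assume "y = {s<..u} \<times> B" "0 \<le> s" "s < u" "u \<le> T" "B \<in> sets (F s)"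
    then show thesis by (intro that[of _ B s]) auto
  qed
  then have BM: "B \<in> sets M" using sets_F_subset by blast
  have "(\<lambda>\<omega>. (t, \<omega>)) -` y \<inter> space M = (if t \<in> I then B else {})"
    using sets.sets_into_space[OF BM] by (auto simp: y)
  then show "(\<lambda>\<omega>. (t, \<omega>)) -` y \<inter> space M \<in> sets M" using BM by simp
qed

text \<open>\<open>\<phi>\<close> is measurable only for \<open>F s\<close>, and there is no product
  sigma-algebra to refer to. On the set \<open>{s<..u} \<times> space M\<close>, however, the
  projection to scenarios is measurable into \<open>F s\<close>, because
  \<open>{s<..u} \<times> B\<close> is predictable for every \<open>B\<close> in
  \<open>F s\<close>.\<close>

lemma measurable_elem_single:
  assumes "0 \<le> s" "s \<le> u" "u \<le> T" "\<phi> \<in> borel_measurable (F s)"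
  shows "(\<lambda>z. \<phi> (snd z) * indicator {s<..u} (fst z) :: real) \<in> borel_measurable (predictable_sigma M F T)"
proof -
  let ?P = "predictable_sigma M F T"
  have s: "s \<in> {0..T}" using assms by auto
  let ?D = "{s<..u} \<times> space M"
  have D: "?D \<in> sets ?P" by (rule predictable_rect[OF assms(1-3) space_in_F[OF s]])
  then have D': "?D \<inter> space ?P \<in> sets ?P" by (rule sets.Int[OF _ sets.top])
  have "snd \<in> measurable (restrict_space ?P ?D) (F s)"
  proof (rule measurableI)
    fix B assume B: "B \<in> sets (F s)"
    have E: "snd -` B \<inter> space (restrict_space ?P ?D) = {s<..u} \<times> B"
      using sets.sets_into_space[OF B] space_F[OF s] assms(1-3) by (auto simp: space_restrict_space)
    have "{s<..u} \<times> B \<subseteq> ?D" using sets.sets_into_space[OF B] space_F[OF s] by auto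
    then show "snd -` B \<inter> space (restrict_space ?P ?D) \<in> sets (restrict_space ?P ?D)"
      unfolding E sets_restrict_space_iff[OF D'] using predictable_rect[OF assms(1-3) B] by (rule conjI)
  next
    fix x assume "x \<in> space (restrict_space ?P ?D)"
    then show "snd x \<in> space (F s)"
      by (simp add: space_restrict_space space_F[OF s] mem_Times_iff)
  qed
  from measurable_compose[OF this assms(4)]
  have "(\<lambda>z. \<phi> (snd z)) \<in> borel_measurable (restrict_space ?P ?D)" .
  then have m: "(\<lambda>z. indicator ?D z *\<^sub>R \<phi> (snd z)) \<in> borel_measurable ?P"
    by (rule iffD1[OF borel_measurable_restrict_space_iff[OF D']])
  have eq: "indicator ?D z *\<^sub>R \<phi> (snd z) = \<phi> (snd z) * indicator {s<..u} (fst z)" if "z \<in> space ?P" for z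
    using that by (auto simp: indicator_def)
  show ?thesis
    by (rule iffD1[OF measurable_cong m]) (rule eq)
qed

lemma measurable_elem_process:
  assumes "elementary M F T E"
  shows "(\<lambda>z. elem_process E (fst z) (snd z)) \<in> borel_measurable (predictable_sigma M F T)"
  using assms
proof (induction E)
  case Nil
  then show ?case by (simp add: elem_process_def)
next
  case (Cons e E)
  obtain s u \<phi> where e: "e = (s, u, \<phi>)" by (cases e)
  have "(\<lambda>z. \<phi> (snd z) * indicator {s<..u} (fst z) + elem_process E (fst z) (snd z))
      \<in> borel_measurable (predictable_sigma M F T)"
    using Cons by (intro borel_measurable_add measurable_elem_single) (auto simp: elementary_def e)
  then show ?case by (simp add: elem_process_def e)
qed

end

section \<open>The measure on predictable sets induced by the bracket of the integrator\<close>

locale integrator = filtered_basis M F T for M :: "'a measure" and F T +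
  fixes S A :: "real \<Rightarrow> 'a \<Rightarrow> real"
  assumes S: "sq_martingale M F T S" and A: "quad_variation M F T S A"
begin

abbreviation "P \<equiv> predictable_sigma M F T"
abbreviation "dA \<equiv> path_measure T A"

lemma A_measurable: "t \<in> {0..T} \<Longrightarrow> A t \<in> borel_measurable M"
  using A measurable_compose[OF measurable_predictable_point, of t "\<lambda>(t, \<omega>). A t \<omega>" borel]
  by (simp add: quad_variation_def covariation_def predictable_def)

lemma A_zero: "\<omega> \<in> space M \<Longrightarrow> A 0 \<omega> = 0"
  and A_cadlag: "\<omega> \<in> space M \<Longrightarrow> cadlag_on T (\<lambda>t. A t \<omega>)"
  and A_mono: "\<omega> \<in> space M \<Longrightarrow> mono_on {0..T} (\<lambda>t. A t \<omega>)"
  and A_martingale: "martingale M F T (\<lambda>t \<omega>. S t \<omega> * S t \<omega> - A t \<omega>)"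
  using A by (simp_all add: quad_variation_def covariation_def)

lemma A_le: "\<omega> \<in> space M \<Longrightarrow> 0 \<le> s \<Longrightarrow> s \<le> t \<Longrightarrow> t \<le> T \<Longrightarrow> A s \<omega> \<le> A t \<omega>"
  using mono_onD[OF A_mono, of \<omega> s t] by auto

lemma A_integrable: "t \<in> {0..T} \<Longrightarrow> integrable M (A t)"
proof -
  assume t: "t \<in> {0..T}"
  have "integrable M (\<lambda>\<omega>. S t \<omega> * S t \<omega> - A t \<omega>)"
    using A_martingale t by (simp add: martingale_def)
  from Bochner_Integration.integrable_diff[OF square_integrable_mult[OF sq_martingale_sqi[OF S t] sq_martingale_sqi[OF S t]] this]
  have "integrable M (\<lambda>\<omega>. S t \<omega> * S t \<omega> - (S t \<omega> * S t \<omega> - A t \<omega>))" .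
  then show ?thesis by simp
qed

text \<open>The path extended by constants is still monotone and right continuous; right continuity
  is checked separately before 0, within the time interval and from \<open>T\<close> on.\<close>

lemma emeasure_path_Ioc:
  assumes \<omega>: "\<omega> \<in> space M" and ab: "a \<le> b"
  shows "emeasure (dA \<omega>) {a<..b} = ennreal (A (max 0 (min T b)) \<omega> - A (max 0 (min T a)) \<omega>)"
  unfolding path_measure_def
proof (rule emeasure_interval_measure_Ioc[OF ab])
  show "A (max 0 (min T x)) \<omega> \<le> A (max 0 (min T y)) \<omega>" if "x \<le> y" for x y
    using that T_pos by (intro A_le \<omega>) auto
  show "continuous (at_right a) (\<lambda>t. A (max 0 (min T t)) \<omega>)" for a
    unfolding continuous_within
  proof -
    consider "a < 0" | "0 \<le> a" "a < T" | "T \<le> a" by linarith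
    then show "((\<lambda>t. A (max 0 (min T t)) \<omega>) \<longlongrightarrow> A (max 0 (min T a)) \<omega>) (at_right a)"
    proof cases
      case 1
      then have "\<forall>\<^sub>F t in at_right a. A (max 0 (min T a)) \<omega> = A (max 0 (min T t)) \<omega>"
        using T_pos by (auto simp: eventually_at_right[of a 0] min_def max_def intro!: exI[of _ 0])
      then show ?thesis by (rule Lim_transform_eventually[OF tendsto_const])
    next
      case 2
      then have ev: "\<forall>\<^sub>F t in at_right a. A t \<omega> = A (max 0 (min T t)) \<omega>"
        by (auto simp: eventually_at_right[of a T] min_def max_def intro!: exI[of _ T])
      have "((\<lambda>t. A t \<omega>) \<longlongrightarrow> A a \<omega>) (at_right a)"
        using A_cadlag[OF \<omega>] 2 by (auto simp: cadlag_on_def)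
      from Lim_transform_eventually[OF this ev] 2 show ?thesis by (simp add: min_def)
    next
      case 3
      then have "\<forall>\<^sub>F t in at_right a. A (max 0 (min T a)) \<omega> = A (max 0 (min T t)) \<omega>"
        using T_pos by (auto simp: eventually_at_right[of a "a + 1"] min_def max_def intro!: exI[of _ "a + 1"])
      then show ?thesis by (rule Lim_transform_eventually[OF tendsto_const])
    qed
  qed
qed

lemma sets_path [simp, measurable_cong]: "sets (dA \<omega>) = sets borel"
  by (simp add: path_measure_def)

lemma space_path [simp]: "space (dA \<omega>) = UNIV"
  by (simp add: path_measure_def)

text \<open>The extension is constant up to and including time 0, so there is no jump and no mass
  there.\<close>

lemma emeasure_path_zero: "\<omega> \<in> space M \<Longrightarrow> emeasure (dA \<omega>) {0} = 0"
proof -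
  assume \<omega>: "\<omega> \<in> space M"
  have "emeasure (dA \<omega>) {0} \<le> emeasure (dA \<omega>) {-1<..0}"
    by (intro emeasure_mono) auto
  also have "\<dots> = 0" using emeasure_path_Ioc[OF \<omega>, of "-1" 0] T_pos by simp
  finally show ?thesis by simp
qed

text \<open>The path measure carried to the slice over one scenario and seen on predictable sets
  only. These slices form the kernel from which \<open>Q\<close> is composed.\<close>

definition section_measure :: "'a \<Rightarrow> (real \<times> 'a) measure" where
  "section_measure \<omega> = distr (restrict_space (dA \<omega>) {0..T}) P (\<lambda>t. (t, \<omega>))"

lemma measurable_path_section:
  "\<omega> \<in> space M \<Longrightarrow> (\<lambda>t. (t, \<omega>)) \<in> measurable (restrict_space (dA \<omega>) {0..T}) P"
  using measurable_predictable_time[of \<omega>]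
    measurable_cong_sets[OF sets_restrict_space_cong[of "dA \<omega>" borel "{0..T}"] refl, of P] by simp

lemma sets_section [simp, measurable_cong]: "sets (section_measure \<omega>) = sets P"
  by (simp add: section_measure_def)

lemma emeasure_section_rect:
  assumes \<omega>: "\<omega> \<in> space M" and st: "0 \<le> s" "s \<le> t" "t \<le> T" and B: "B \<in> sets (F s)"
  shows "emeasure (section_measure \<omega>) ({s<..t} \<times> B) = indicator B \<omega> * ennreal (A t \<omega> - A s \<omega>)"
proof -
  have "emeasure (section_measure \<omega>) ({s<..t} \<times> B) =
    emeasure (restrict_space (dA \<omega>) {0..T}) (if \<omega> \<in> B then {s<..t} else {})"
    unfolding section_measure_def using st
    by (subst emeasure_distr[OF measurable_path_section[OF \<omega>] predictable_rect[OF st B]])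
      (auto intro!: arg_cong2[where f = emeasure] simp: space_restrict_space)
  also have "\<dots> = (if \<omega> \<in> B then emeasure (dA \<omega>) {s<..t} else 0)"
    using st emeasure_restrict_space[of "{0..T}" "dA \<omega>" "{s<..t}"] by (auto simp: subset_eq)
  also have "\<dots> = indicator B \<omega> * ennreal (A t \<omega> - A s \<omega>)"
    using emeasure_path_Ioc[OF \<omega> st(2)] st by simp
  finally show ?thesis .
qed

lemma emeasure_section_zero:
  assumes \<omega>: "\<omega> \<in> space M" and B: "B \<in> sets (F 0)"
  shows "emeasure (section_measure \<omega>) ({0} \<times> B) = 0"
proof -
  have "emeasure (section_measure \<omega>) ({0} \<times> B) =
    emeasure (restrict_space (dA \<omega>) {0..T}) (if \<omega> \<in> B then {0} else {})"
    unfolding section_measure_def using T_pos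
    by (subst emeasure_distr[OF measurable_path_section[OF \<omega>] predictable_zero_rect[OF B]])
      (auto intro!: arg_cong2[where f = emeasure] simp: space_restrict_space)
  also have "\<dots> = 0"
    using T_pos emeasure_path_zero[OF \<omega>] by (auto simp: emeasure_restrict_space)
  finally show ?thesis .
qed

lemma emeasure_section_space:
  assumes \<omega>: "\<omega> \<in> space M"
  shows "emeasure (section_measure \<omega>) ({0..T} \<times> space M) = ennreal (A T \<omega>)"
proof -
  have F0: "space M \<in> sets (F 0)" using space_F[of 0] sets.top[of "F 0"] T_pos by auto
  have r: "{0<..T} \<times> space M \<in> sets P" "{0} \<times> space M \<in> sets P"
    using T_pos by (auto intro: predictable_rect predictable_zero_rect F0)
  have "{0..T} \<times> space M = ({0<..T} \<times> space M) \<union> ({0} \<times> space M)" using T_pos by auto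
  then have "emeasure (section_measure \<omega>) ({0..T} \<times> space M) =
      emeasure (section_measure \<omega>) ({0<..T} \<times> space M) + emeasure (section_measure \<omega>) ({0} \<times> space M)"
    using r by (subst plus_emeasure) auto
  then show ?thesis
    using emeasure_section_zero[OF \<omega> F0] emeasure_section_rect[OF \<omega> _ _ _ F0, of T] \<omega> T_pos A_zero[OF \<omega>] by simp
qed

text \<open>Dynkin's argument: on generating rectangles the mass is an explicit function of
  \<open>A\<close> at two times, and the finite total mass \<open>A T\<close> handles
  complements.\<close>

lemma measurable_emeasure_section:
  assumes "B \<in> sets P"
  shows "(\<lambda>\<omega>. emeasure (section_measure \<omega>) B) \<in> borel_measurable M"
proof -
  have "B \<in> sigma_sets ({0..T} \<times> space M) predictable_gen" using assms by (simp add: sets_predictable)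
  with Int_stable_predictable_gen predictable_gen_subset show ?thesis
  proof (induction B rule: sigma_sets_induct_disjoint)
    case (basic B)
    then consider C where "B = {0} \<times> C" "C \<in> sets (F 0)"
      | s t C where "B = {s<..t} \<times> C" "0 \<le> s" "s < t" "t \<le> T" "C \<in> sets (F s)" by blast
    then show ?case
    proof cases
      case 1
      then have "emeasure (section_measure \<omega>) B = 0" if "\<omega> \<in> space M" for \<omega>
        using emeasure_section_zero[OF that] by simp
      from measurable_cong[of M, OF this] show ?thesis by simp
    next
      case 2
      have [measurable]: "A t \<in> borel_measurable M" "A s \<in> borel_measurable M" using 2 by (auto intro!: A_measurable)
      have [measurable]: "C \<in> sets M" using sets_F_subset[of s] 2 by auto
      have "emeasure (section_measure \<omega>) B = indicator C \<omega> * ennreal (A t \<omega> - A s \<omega>)" if "\<omega> \<in> space M" for \<omega>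
        unfolding 2(1) using 2 by (intro emeasure_section_rect that) auto
      from measurable_cong[of M, OF this] show ?thesis by simp
    qed
  next
    case empty
    then show ?case by simp
  next
    case (compl B)
    have B: "B \<in> sets P" using compl by (simp add: sets_predictable)
    have [measurable]: "A T \<in> borel_measurable M" using T_pos by (intro A_measurable) auto
    have "emeasure (section_measure \<omega>) ({0..T} \<times> space M - B) =
        ennreal (A T \<omega>) - emeasure (section_measure \<omega>) B" if "\<omega> \<in> space M" for \<omega>
    proof (subst emeasure_Diff)
      have "emeasure (section_measure \<omega>) B \<le> emeasure (section_measure \<omega>) ({0..T} \<times> space M)"
        using B sets.sets_into_space[OF B] sets.top[of P] by (intro emeasure_mono) auto
      also have "\<dots> < \<infinity>" by (simp add: emeasure_section_space[OF that])
      finally show "emeasure (section_measure \<omega>) B \<noteq> \<infinity>" by simp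
      show "{0..T} \<times> space M \<in> sets (section_measure \<omega>)" using sets.top[of P] by simp
    qed (use B sets.sets_into_space[OF B] emeasure_section_space[OF that] in auto)
    from measurable_cong[of M, OF this] show ?case using compl(2) by simp
  next
    case (union B)
    have "range B \<subseteq> sets P" using union by (simp add: sets_predictable)
    then have "emeasure (section_measure \<omega>) (\<Union>i. B i) = (\<Sum>i. emeasure (section_measure \<omega>) (B i))" for \<omega>
      using union by (intro suminf_emeasure[symmetric]) auto
    then show ?case using union by simp
  qed
qed

text \<open>The Doleans measure d<S,S> dP: the kernel of path measures integrated over the
  scenarios. It lives on the predictable sigma-algebra.\<close>

definition Q :: "(real \<times> 'a) measure" where
  "Q = measure_of ({0..T} \<times> space M) (sets P) (\<lambda>B. \<integral>\<^sup>+\<omega>. emeasure (section_measure \<omega>) B \<partial>M)"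

lemma space_Q [simp]: "space Q = {0..T} \<times> space M"
  unfolding Q_def using sets.space_closed[of P] by (simp add: space_measure_of)

lemma sets_Q [simp, measurable_cong]: "sets Q = sets P"
  unfolding Q_def using sets.space_closed[of P] sets.sigma_sets_eq[of P] by (simp add: sets_measure_of)

lemma emeasure_Q:
  assumes B: "B \<in> sets P"
  shows "emeasure Q B = (\<integral>\<^sup>+\<omega>. emeasure (section_measure \<omega>) B \<partial>M)"
proof (rule emeasure_measure_of[OF Q_def])
  show "sets P \<subseteq> Pow ({0..T} \<times> space M)" using sets.space_closed[of P] by simp
  show "positive (sets Q) (\<lambda>B. \<integral>\<^sup>+\<omega>. emeasure (section_measure \<omega>) B \<partial>M)" by (simp add: positive_def)
  show "countably_additive (sets Q) (\<lambda>B. \<integral>\<^sup>+\<omega>. emeasure (section_measure \<omega>) B \<partial>M)"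
  proof (rule countably_additiveI)
    fix B :: "nat \<Rightarrow> (real \<times> 'a) set" assume B: "range B \<subseteq> sets Q" "disjoint_family B" "(\<Union>i. B i) \<in> sets Q"
    have "emeasure (section_measure \<omega>) (\<Union>i. B i) = (\<Sum>i. emeasure (section_measure \<omega>) (B i))" for \<omega>
      using B by (intro suminf_emeasure[symmetric]) auto
    then show "(\<Sum>i. \<integral>\<^sup>+\<omega>. emeasure (section_measure \<omega>) (B i) \<partial>M) = (\<integral>\<^sup>+\<omega>. emeasure (section_measure \<omega>) (\<Union>i. B i) \<partial>M)"
      using B measurable_emeasure_section by (simp add: nn_integral_suminf subset_eq)
  qed
  show "B \<in> sets Q" using B by simp
qed

lemma finite_Q: "finite_measure Q"
proof
  have T: "T \<in> {0..T}" using T_pos by simp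
  have "emeasure Q (space Q) = (\<integral>\<^sup>+\<omega>. ennreal (A T \<omega>) \<partial>M)"
    using sets.top[of P] by (simp add: emeasure_Q emeasure_section_space cong: nn_integral_cong)
  also have "\<dots> \<le> (\<integral>\<^sup>+\<omega>. ennreal (norm (A T \<omega>)) \<partial>M)"
    by (intro nn_integral_mono ennreal_leI) simp
  also have "\<dots> < \<infinity>" using A_integrable[OF T] by (simp add: integrable_iff_bounded)
  finally show "emeasure Q (space Q) \<noteq> \<infinity>" by simp
qed

sublocale Q: finite_measure Q by (rule finite_Q)

lemma nn_integral_section:
  assumes "f \<in> borel_measurable P" "\<omega> \<in> space M"
  shows "(\<integral>\<^sup>+z. f z \<partial>section_measure \<omega>) = (\<integral>\<^sup>+t\<in>{0..T}. f (t, \<omega>) \<partial>dA \<omega>)"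
  unfolding section_measure_def
  using assms by (simp add: nn_integral_distr[OF measurable_path_section] nn_integral_restrict_space)

text \<open>Disintegration of \<open>Q\<close>. Measurability of the inner integral is proved
  together with the identity, because additivity and monotone convergence over \<open>M\<close> need
  it at every step of the induction.\<close>

lemma nn_integral_Q_section:
  assumes "f \<in> borel_measurable P"
  shows "(\<lambda>\<omega>. \<integral>\<^sup>+z. f z \<partial>section_measure \<omega>) \<in> borel_measurable M \<and>
    (\<integral>\<^sup>+z. f z \<partial>Q) = (\<integral>\<^sup>+\<omega>. \<integral>\<^sup>+z. f z \<partial>section_measure \<omega> \<partial>M)"
  using assms
proof (induction f rule: borel_measurable_induct)
  case (cong f g)
  have "(\<integral>\<^sup>+z. f z \<partial>section_measure \<omega>) = (\<integral>\<^sup>+z. g z \<partial>section_measure \<omega>)" for \<omega>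
    using cong(3) sets_eq_imp_space_eq[OF sets_section] by (intro nn_integral_cong) auto
  moreover have "(\<integral>\<^sup>+z. f z \<partial>Q) = (\<integral>\<^sup>+z. g z \<partial>Q)"
    using cong(3) by (intro nn_integral_cong) auto
  ultimately show ?case using cong(4) by simp
next
  case (set B)
  then show ?case by (simp add: emeasure_Q measurable_emeasure_section)
next
  case (mult f c)
  then show ?case by (auto simp: nn_integral_cmult intro!: borel_measurable_times_ennreal)
next
  case (add f g)
  then show ?case by (auto simp: nn_integral_add intro!: borel_measurable_add)
next
  case (seq f)
  have f: "incseq f" "\<And>i. f i \<in> borel_measurable P" using seq by auto
  have 1: "(\<integral>\<^sup>+z. (SUP i. f i) z \<partial>section_measure \<omega>) = (SUP i. \<integral>\<^sup>+z. f i z \<partial>section_measure \<omega>)" for \<omega>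
    unfolding SUP_apply using f by (intro nn_integral_monotone_convergence_SUP) auto
  have 2: "(\<integral>\<^sup>+z. (SUP i. f i) z \<partial>Q) = (SUP i. \<integral>\<^sup>+z. f i z \<partial>Q)"
    unfolding SUP_apply using f by (intro nn_integral_monotone_convergence_SUP) auto
  have 3: "(\<integral>\<^sup>+\<omega>. (SUP i. \<integral>\<^sup>+z. f i z \<partial>section_measure \<omega>) \<partial>M) = (SUP i. \<integral>\<^sup>+\<omega>. \<integral>\<^sup>+z. f i z \<partial>section_measure \<omega> \<partial>M)"
    using seq f(1) by (intro nn_integral_monotone_convergence_SUP)
      (auto simp: incseq_def le_fun_def intro!: nn_integral_mono)
  show ?case unfolding 1 2 3 using seq.IH by (auto intro!: borel_measurable_SUP)
qed

lemma nn_integral_Q: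
  assumes "f \<in> borel_measurable P"
  shows "(\<integral>\<^sup>+z. f z \<partial>Q) = (\<integral>\<^sup>+\<omega>. (\<integral>\<^sup>+t\<in>{0..T}. f (t, \<omega>) \<partial>dA \<omega>) \<partial>M)"
  using nn_integral_Q_section[OF assms] nn_integral_section[OF assms] by (simp cong: nn_integral_cong)

lemma L2_energy_eq:
  fixes \<theta> :: "real \<Rightarrow> 'a \<Rightarrow> 'b::{real_normed_vector, second_countable_topology}"
  assumes "(\<lambda>z. \<theta> (fst z) (snd z)) \<in> borel_measurable P"
  shows "L2_energy M T A \<theta> = (\<integral>\<^sup>+z. ennreal ((norm (\<theta> (fst z) (snd z)))\<^sup>2) \<partial>Q)"
  using assms by (subst nn_integral_Q) (auto simp: L2_energy_def)

text \<open>A \<open>Q\<close>-null set has null sections over almost every scenario. This produces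
  the iterated form in which integrands are identified in the theorem.\<close>

lemma AE_Q_iterated:
  assumes "AE z in Q. p (fst z) (snd z)"
  shows "AE \<omega> in M. AE t in dA \<omega>. t \<in> {0..T} \<longrightarrow> p t \<omega>"
proof -
  obtain N where N: "N \<in> null_sets Q" "{z \<in> space Q. \<not> p (fst z) (snd z)} \<subseteq> N"
    using assms unfolding eventually_ae_filter by blast
  have NP: "N \<in> sets P" using N(1) by auto
  have "(\<integral>\<^sup>+\<omega>. emeasure (section_measure \<omega>) N \<partial>M) = 0"
    using N(1) emeasure_Q[OF NP] by auto
  then have "AE \<omega> in M. emeasure (section_measure \<omega>) N = 0"
    using measurable_emeasure_section[OF NP] by (simp add: nn_integral_0_iff_AE)
  then show ?thesis
    using AE_space
  proof eventually_elim
    case (elim \<omega>)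
    let ?R = "restrict_space (dA \<omega>) {0..T}"
    have m: "(\<lambda>t. (t, \<omega>)) \<in> measurable ?R P" by (rule measurable_path_section[OF elim(2)])
    have "emeasure ?R ((\<lambda>t. (t, \<omega>)) -` N \<inter> space ?R) = 0"
      using elim(1) emeasure_distr[OF m NP] by (simp add: section_measure_def)
    then have "(\<lambda>t. (t, \<omega>)) -` N \<inter> space ?R \<in> null_sets ?R"
      using measurable_sets[OF m NP] by auto
    then have "AE t in ?R. p t \<omega>"
      by (rule AE_I') (use N(2) elim(2) in \<open>force simp: space_restrict_space subset_eq\<close>)
    then show ?case by (subst (asm) AE_restrict_space_iff) auto
  qed
qed

end

section \<open>Elementary integrands and the Ito isometry\<close>

lemma integrable_mult_bounded:
  fixes f g :: "'a \<Rightarrow> real"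
  assumes "integrable N f" "g \<in> borel_measurable N" "\<And>x. x \<in> space N \<Longrightarrow> \<bar>g x\<bar> \<le> c"
  shows "integrable N (\<lambda>x. g x * f x)"
proof (rule Bochner_Integration.integrable_bound)
  show "integrable N (\<lambda>x. c * f x)" using assms(1) by simp
  show "(\<lambda>x. g x * f x) \<in> borel_measurable N" using assms by auto
  show "AE x in N. norm (g x * f x) \<le> norm (c * f x)"
  proof (rule AE_I2)
    fix x assume x: "x \<in> space N"
    have "0 \<le> c" "\<bar>g x\<bar> \<le> c" using assms(3)[OF x] by auto
    then show "norm (g x * f x) \<le> norm (c * f x)"
      by (simp add: abs_mult mult_right_mono)
  qed
qed

definition elem_scale :: "real \<Rightarrow> (real \<times> real \<times> ('a \<Rightarrow> real)) list \<Rightarrow> (real \<times> real \<times> ('a \<Rightarrow> real)) list" where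
  "elem_scale c E = map (\<lambda>(s, u, \<phi>). (s, u, \<lambda>\<omega>. c * \<phi> \<omega>)) E"

lemma elem_process_Nil [simp]: "elem_process [] t \<omega> = 0"
  by (simp add: elem_process_def)

lemma elem_integral_Nil [simp]: "elem_integral S [] t \<omega> = 0"
  by (simp add: elem_integral_def)

lemma elem_process_Cons: "elem_process (e # E) t \<omega> = elem_process [e] t \<omega> + elem_process E t \<omega>"
  by (simp add: elem_process_def)

lemma elem_integral_Cons: "elem_integral S (e # E) t \<omega> = elem_integral S [e] t \<omega> + elem_integral S E t \<omega>"
  by (simp add: elem_integral_def)

lemma elem_process_append: "elem_process (E @ E') t \<omega> = elem_process E t \<omega> + elem_process E' t \<omega>"
  by (simp add: elem_process_def)

lemma elem_integral_append: "elem_integral S (E @ E') t \<omega> = elem_integral S E t \<omega> + elem_integral S E' t \<omega>"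
  by (simp add: elem_integral_def)

lemma elem_process_scale: "elem_process (elem_scale c E) t \<omega> = c * elem_process E t \<omega>"
  by (induction E) (auto simp: elem_process_def elem_scale_def algebra_simps)

lemma elem_integral_scale: "elem_integral S (elem_scale c E) t \<omega> = c * elem_integral S E t \<omega>"
  by (induction E) (auto simp: elem_integral_def elem_scale_def algebra_simps)

lemma elementary_Nil [simp]: "elementary M F T []"
  by (simp add: elementary_def)

lemma elementary_append: "elementary M F T E \<Longrightarrow> elementary M F T E' \<Longrightarrow> elementary M F T (E @ E')"
  by (auto simp: elementary_def)

lemma elementary_Cons: "elementary M F T (e # E) \<longleftrightarrow> elementary M F T [e] \<and> elementary M F T E"
  by (auto simp: elementary_def)

lemma elementary_singleE:
  assumes "elementary M F T [e]"
  obtains s u \<phi> c where "e = (s, u, \<phi>)" "0 \<le> s" "s \<le> u" "u \<le> T" "\<phi> \<in> borel_measurable (F s)"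
    "\<And>\<omega>. \<omega> \<in> space M \<Longrightarrow> \<bar>\<phi> \<omega>\<bar> \<le> c"
proof -
  obtain s u \<phi> where e: "e = (s, u, \<phi>)" by (cases e)
  from assms obtain c where "0 \<le> s" "s \<le> u" "u \<le> T" "\<phi> \<in> borel_measurable (F s)"
    "\<And>\<omega>. \<omega> \<in> space M \<Longrightarrow> \<bar>\<phi> \<omega>\<bar> \<le> c"
    by (auto simp: elementary_def e)
  then show thesis by (rule that[OF e])
qed

lemma elementary_scale:
  assumes "elementary M F T E"
  shows "elementary M F T (elem_scale c E)"
  using assms
proof (induction E)
  case (Cons e E)
  then have "elementary M F T [e]" and E: "elementary M F T E" by (simp_all add: elementary_Cons[of M F T e E])
  from this(1) obtain s u \<phi> d where e: "e = (s, u, \<phi>)" "0 \<le> s" "s \<le> u" "u \<le> T" "\<phi> \<in> borel_measurable (F s)"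
    "\<And>\<omega>. \<omega> \<in> space M \<Longrightarrow> \<bar>\<phi> \<omega>\<bar> \<le> d" by (rule elementary_singleE) blast
  have "\<bar>c * \<phi> \<omega>\<bar> \<le> \<bar>c\<bar> * d" if "\<omega> \<in> space M" for \<omega>
    using e(6)[OF that] by (simp add: abs_mult mult_left_mono)
  then have "elementary M F T [(s, u, \<lambda>\<omega>. c * \<phi> \<omega>)]"
    using e(2-5) by (auto simp: elementary_def)
  moreover have "elem_scale c (e # E) = (s, u, \<lambda>\<omega>. c * \<phi> \<omega>) # elem_scale c E"
    by (simp add: elem_scale_def e)
  ultimately show ?case using Cons.IH[OF E] elementary_Cons by metis
qed (simp add: elem_scale_def)

context integrator
begin

lemma T_in: "T \<in> {0..T}" using T_pos by simp

lemma nn_integral_Q_rect: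
  assumes ab: "0 \<le> a" "a \<le> b" "b \<le> T" and \<xi>: "\<xi> \<in> borel_measurable (F a)" "\<And>\<omega>. \<omega> \<in> space M \<Longrightarrow> 0 \<le> \<xi> \<omega>"
  shows "(\<integral>\<^sup>+z. ennreal (\<xi> (snd z) * indicator {a<..b} (fst z)) \<partial>Q) = (\<integral>\<^sup>+\<omega>. ennreal (\<xi> \<omega> * (A b \<omega> - A a \<omega>)) \<partial>M)"
proof -
  have "(\<lambda>z. ennreal (\<xi> (snd z) * indicator {a<..b} (fst z))) \<in> borel_measurable P"
    using measurable_elem_single[OF ab \<xi>(1)] by measurable
  then have "(\<integral>\<^sup>+z. ennreal (\<xi> (snd z) * indicator {a<..b} (fst z)) \<partial>Q) =
      (\<integral>\<^sup>+\<omega>. (\<integral>\<^sup>+t\<in>{0..T}. ennreal (\<xi> \<omega> * indicator {a<..b} t) \<partial>dA \<omega>) \<partial>M)"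
    by (subst nn_integral_Q) auto
  also have "\<dots> = (\<integral>\<^sup>+\<omega>. ennreal (\<xi> \<omega> * (A b \<omega> - A a \<omega>)) \<partial>M)"
  proof (rule nn_integral_cong)
    fix \<omega> assume \<omega>: "\<omega> \<in> space M"
    have "(\<integral>\<^sup>+t\<in>{0..T}. ennreal (\<xi> \<omega> * indicator {a<..b} t) \<partial>dA \<omega>) =
        (\<integral>\<^sup>+t. ennreal (\<xi> \<omega>) * indicator {a<..b} t \<partial>dA \<omega>)"
      using ab by (intro nn_integral_cong) (auto simp: indicator_def)
    also have "\<dots> = ennreal (\<xi> \<omega>) * emeasure (dA \<omega>) {a<..b}"
      by (rule nn_integral_cmult_indicator) simp
    also have "\<dots> = ennreal (\<xi> \<omega> * (A b \<omega> - A a \<omega>))"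
      using ab \<xi>(2)[OF \<omega>] emeasure_path_Ioc[OF \<omega> ab(2)] A_le[OF \<omega> ab] by (simp add: ennreal_mult)
    finally show "(\<integral>\<^sup>+t\<in>{0..T}. ennreal (\<xi> \<omega> * indicator {a<..b} t) \<partial>dA \<omega>) = ennreal (\<xi> \<omega> * (A b \<omega> - A a \<omega>))" .
  qed
  finally show ?thesis .
qed

lemma integral_Q_rect:
  assumes ab: "0 \<le> a" "a \<le> b" "b \<le> T"
    and \<xi>: "\<xi> \<in> borel_measurable (F a)" "\<And>\<omega>. \<omega> \<in> space M \<Longrightarrow> \<bar>\<xi> \<omega>\<bar> \<le> c"
  shows "(\<integral>z. \<xi> (snd z) * indicator {a<..b} (fst z) \<partial>Q) = (\<integral>\<omega>. \<xi> \<omega> * (A b \<omega> - A a \<omega>) \<partial>M)"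
proof -
  have aT: "a \<in> {0..T}" "b \<in> {0..T}" using ab by auto
  have bd: "(\<integral>z. \<psi> (snd z) * indicator {a<..b} (fst z) \<partial>Q) = (\<integral>\<omega>. \<psi> \<omega> * (A b \<omega> - A a \<omega>) \<partial>M)"
    "integrable Q (\<lambda>z. \<psi> (snd z) * indicator {a<..b} (fst z))" "integrable M (\<lambda>\<omega>. \<psi> \<omega> * (A b \<omega> - A a \<omega>))"
    if \<psi>: "\<psi> \<in> borel_measurable (F a)" "\<And>\<omega>. \<omega> \<in> space M \<Longrightarrow> 0 \<le> \<psi> \<omega>" "\<And>\<omega>. \<omega> \<in> space M \<Longrightarrow> \<bar>\<psi> \<omega>\<bar> \<le> d" for \<psi> d
  proof -
    let ?f = "\<lambda>z. \<psi> (snd z) * indicator {a<..b} (fst z)"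
    let ?g = "\<lambda>\<omega>. \<psi> \<omega> * (A b \<omega> - A a \<omega>)"
    show g: "integrable M ?g"
      using A_integrable[OF aT(1)] A_integrable[OF aT(2)] measurable_F_imp_M[OF \<psi>(1) aT(1)] \<psi>(3)
      by (intro integrable_mult_bounded) auto
    have mf: "?f \<in> borel_measurable Q"
      using measurable_elem_single[OF ab \<psi>(1)] by measurable
    have f0: "AE z in Q. 0 \<le> ?f z"
      using \<psi>(2) by (intro AE_I2) auto
    have g0: "AE \<omega> in M. 0 \<le> ?g \<omega>"
      using \<psi>(2) A_le[OF _ ab] by (intro AE_I2) simp
    have eq: "(\<integral>\<^sup>+z. ennreal (?f z) \<partial>Q) = (\<integral>\<^sup>+\<omega>. ennreal (?g \<omega>) \<partial>M)"
      by (rule nn_integral_Q_rect[OF ab \<psi>(1,2)])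
    show "integrable Q ?f"
      using mf f0 eq nn_integral_eq_integral[OF g g0] by (intro integrableI_nonneg) auto
    show "(\<integral>z. ?f z \<partial>Q) = (\<integral>\<omega>. ?g \<omega> \<partial>M)"
      using integral_eq_nn_integral[OF mf f0] integral_eq_nn_integral[OF borel_measurable_integrable[OF g] g0] eq by simp
  qed
  \<comment> \<open>The signed case is the difference of two nonnegative ones,
    \<open>\<xi> + c\<close> and \<open>c\<close>. A probability space is not empty, so the bound
    \<open>c\<close> cannot be negative.\<close>
  have c: "0 \<le> c" using \<xi>(2) not_empty by fastforce
  have b1: "0 \<le> \<xi> \<omega> + c" "\<bar>\<xi> \<omega> + c\<bar> \<le> 2 * c" if "\<omega> \<in> space M" for \<omega>
    using \<xi>(2)[OF that] by auto
  have m1: "(\<lambda>\<omega>. \<xi> \<omega> + c) \<in> borel_measurable (F a)" using \<xi>(1) by simp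
  note P1 = bd[OF m1 b1]
  have "\<bar>c\<bar> \<le> c" using c by simp
  note P2 = bd[of "\<lambda>_. c" c, OF borel_measurable_const c this]
  have "(\<integral>z. \<xi> (snd z) * indicator {a<..b} (fst z) \<partial>Q) =
      (\<integral>z. (\<xi> (snd z) + c) * indicator {a<..b} (fst z) - c * indicator {a<..b} (fst z) \<partial>Q)"
    by (simp add: algebra_simps)
  also have "\<dots> = (\<integral>\<omega>. (\<xi> \<omega> + c) * (A b \<omega> - A a \<omega>) \<partial>M) - (\<integral>\<omega>. c * (A b \<omega> - A a \<omega>) \<partial>M)"
    using P1 P2 by (subst Bochner_Integration.integral_diff) simp_all
  also have "\<dots> = (\<integral>\<omega>. (\<xi> \<omega> + c) * (A b \<omega> - A a \<omega>) - c * (A b \<omega> - A a \<omega>) \<partial>M)"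
    using P1(3) P2(3) by (subst Bochner_Integration.integral_diff) simp_all
  also have "\<dots> = (\<integral>\<omega>. \<xi> \<omega> * (A b \<omega> - A a \<omega>) \<partial>M)"
    by (simp add: algebra_simps)
  finally show ?thesis .
qed

lemma sqi_S_diff: "s \<in> {0..T} \<Longrightarrow> u \<in> {0..T} \<Longrightarrow> square_integrable M (\<lambda>\<omega>. S u \<omega> - S s \<omega>)"
  by (intro square_integrable_diff sq_martingale_sqi[OF S])

text \<open>The squared increment is the increment of the square of \<open>S\<close> minus twice
  \<open>S a\<close> times the increment of \<open>S\<close>. The last term has mean zero, and the
  martingale \<open>S t * S t - A t\<close> trades the squares for \<open>A\<close>.\<close>

lemma increment_square:
  assumes ab: "0 \<le> a" "a \<le> b" "b \<le> T"
    and \<xi>: "\<xi> \<in> borel_measurable (F a)" "\<And>\<omega>. \<omega> \<in> space M \<Longrightarrow> \<bar>\<xi> \<omega>\<bar> \<le> c"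
  shows "(\<integral>\<omega>. \<xi> \<omega> * (S b \<omega> - S a \<omega>)\<^sup>2 \<partial>M) = (\<integral>\<omega>. \<xi> \<omega> * (A b \<omega> - A a \<omega>) \<partial>M)"
proof -
  have aT: "a \<in> {0..T}" "b \<in> {0..T}" using ab by auto
  have \<xi>M: "\<xi> \<in> borel_measurable M" by (rule measurable_F_imp_M[OF \<xi>(1) aT(1)])
  have sS: "square_integrable M (S a)" "square_integrable M (S b)" using aT by (auto intro: sq_martingale_sqi[OF S])
  let ?N = "\<lambda>t \<omega>. S t \<omega> * S t \<omega> - A t \<omega>"
  have iN: "integrable M (\<lambda>\<omega>. \<xi> \<omega> * ?N t \<omega>)" "integrable M (\<lambda>\<omega>. \<xi> \<omega> * A t \<omega>)" if "t \<in> {0..T}" for t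
    using A_martingale A_integrable[OF that] that \<xi>(2)
    by (auto intro!: integrable_mult_bounded[OF _ \<xi>M] simp: martingale_def)
  have N: "(\<integral>\<omega>. \<xi> \<omega> * ?N b \<omega> \<partial>M) = (\<integral>\<omega>. \<xi> \<omega> * ?N a \<omega> \<partial>M)"
    by (rule martingale_inner(1)[OF A_martingale ab \<xi>(1) iN(1)[OF aT(2)]])
  have f: "(\<lambda>\<omega>. \<xi> \<omega> * S a \<omega>) \<in> borel_measurable (F a)" "square_integrable M (\<lambda>\<omega>. \<xi> \<omega> * S a \<omega>)"
    using \<xi>(1) sq_martingale_meas[OF S aT(1)] square_integrable_mult_bounded[OF sS(1) \<xi>M \<xi>(2)] by auto
  have Z: "(\<integral>\<omega>. (\<xi> \<omega> * S a \<omega>) * (S b \<omega> - S a \<omega>) \<partial>M) = 0"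
    by (rule sq_martingale_orth[OF S ab f])
  have iZ: "integrable M (\<lambda>\<omega>. (\<xi> \<omega> * S a \<omega>) * (S b \<omega> - S a \<omega>))"
    using aT by (intro square_integrable_mult[OF f(2)] sqi_S_diff)
  have "(\<integral>\<omega>. \<xi> \<omega> * (S b \<omega> - S a \<omega>)\<^sup>2 \<partial>M) = (\<integral>\<omega>. (\<xi> \<omega> * ?N b \<omega> - \<xi> \<omega> * ?N a \<omega>) +
      (\<xi> \<omega> * A b \<omega> - \<xi> \<omega> * A a \<omega>) - 2 * ((\<xi> \<omega> * S a \<omega>) * (S b \<omega> - S a \<omega>)) \<partial>M)"
    by (intro Bochner_Integration.integral_cong refl) (simp add: power2_eq_square algebra_simps)
  also have "\<dots> = (\<integral>\<omega>. \<xi> \<omega> * A b \<omega> - \<xi> \<omega> * A a \<omega> \<partial>M)"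
    using iN[OF aT(1)] iN[OF aT(2)] iZ N Z by simp
  finally show ?thesis by (simp add: right_diff_distrib)
qed

text \<open>With the intervals ordered by their left ends, both coefficients are known at
  \<open>s'\<close>. Of the product of increments only the square over the common interval survives
  in the mean.\<close>

lemma isometry_pair_ordered:
  assumes "0 \<le> s" "s \<le> u" "u \<le> T" "\<phi> \<in> borel_measurable (F s)" "\<And>\<omega>. \<omega> \<in> space M \<Longrightarrow> \<bar>\<phi> \<omega>\<bar> \<le> c"
    and "0 \<le> s'" "s' \<le> u'" "u' \<le> T" "\<phi>' \<in> borel_measurable (F s')" "\<And>\<omega>. \<omega> \<in> space M \<Longrightarrow> \<bar>\<phi>' \<omega>\<bar> \<le> c'"
    and ss: "s \<le> s'"
  shows "(\<integral>\<omega>. (\<phi> \<omega> * (S u \<omega> - S s \<omega>)) * (\<phi>' \<omega> * (S u' \<omega> - S s' \<omega>)) \<partial>M) =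
    (\<integral>z. (\<phi> (snd z) * indicator {s<..u} (fst z)) * (\<phi>' (snd z) * indicator {s'<..u'} (fst z)) \<partial>Q)"
proof -
  have T': "s \<in> {0..T}" "u \<in> {0..T}" "s' \<in> {0..T}" "u' \<in> {0..T}" using assms by auto
  define \<xi> where "\<xi> \<omega> = \<phi> \<omega> * \<phi>' \<omega>" for \<omega>
  have \<xi>: "\<xi> \<in> borel_measurable (F s')"
    unfolding \<xi>_def[abs_def] using assms measurable_F_mono[OF assms(4), of s'] by (intro borel_measurable_times) auto
  have \<xi>M: "\<xi> \<in> borel_measurable M" by (rule measurable_F_imp_M[OF \<xi> T'(3)])
  have \<xi>b: "\<bar>\<xi> \<omega>\<bar> \<le> c * c'" if "\<omega> \<in> space M" for \<omega>
    unfolding \<xi>_def abs_mult using assms(5)[OF that] assms(10)[OF that] by (intro mult_mono) auto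
  have S_F: "S t \<in> borel_measurable (F r)" if "0 \<le> t" "t \<le> r" "r \<le> T" for t r
    using that by (intro measurable_F_mono[OF sq_martingale_meas[OF S]]) auto
  have sq: "square_integrable M (\<lambda>\<omega>. \<xi> \<omega> * (S r \<omega> - S t \<omega>))" if "t \<in> {0..T}" "r \<in> {0..T}" for t r
    using that \<xi>b by (intro square_integrable_mult_bounded[OF sqi_S_diff \<xi>M]) auto
  show ?thesis
  proof (cases "u \<le> s'")
    case True
    have "(\<integral>\<omega>. (\<xi> \<omega> * (S u \<omega> - S s \<omega>)) * (S u' \<omega> - S s' \<omega>) \<partial>M) = 0"
      using assms(1-3,6-8) True T' by (intro sq_martingale_orth[OF S] sq borel_measurable_times \<xi> borel_measurable_diff S_F) auto
    moreover have "(\<integral>z. (\<phi> (snd z) * indicator {s<..u} (fst z)) * (\<phi>' (snd z) * indicator {s'<..u'} (fst z)) \<partial>Q) = (\<integral>z. 0 \<partial>Q)"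
      using True by (intro Bochner_Integration.integral_cong refl) (auto simp: indicator_def)
    ultimately show ?thesis by (simp add: \<xi>_def ac_simps)
  next
    case False
    \<comment> \<open>The common interval is \<open>{s'<..b}\<close>, and \<open>d\<close> is the
      later right end. The two cross terms vanish, being increments from \<open>s'\<close> or from
      \<open>b\<close> multiplied by something known at that time.\<close>
    define b where "b = min u u'"
    define d where "d = max u u'"
    have b: "0 \<le> s'" "s' \<le> b" "b \<le> d" "d \<le> T" "b \<le> T" "b \<in> {0..T}" "d \<in> {0..T}" "0 \<le> b"
      using assms(1-3,6-8) False by (auto simp: b_def d_def)
    have m1: "(\<lambda>\<omega>. \<xi> \<omega> * (S s' \<omega> - S s \<omega>)) \<in> borel_measurable (F s')"
      using assms(1-3,6-8) ss by (intro borel_measurable_times \<xi> borel_measurable_diff S_F) auto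
    have Z1: "(\<integral>\<omega>. (\<xi> \<omega> * (S s' \<omega> - S s \<omega>)) * (S u' \<omega> - S s' \<omega>) \<partial>M) = 0"
      using assms(6-8) T' by (intro sq_martingale_orth[OF S] sq m1) auto
    have m3: "(\<lambda>\<omega>. \<xi> \<omega> * (S b \<omega> - S s' \<omega>)) \<in> borel_measurable (F b)"
      using b by (intro borel_measurable_times measurable_F_mono[OF \<xi>] borel_measurable_diff S_F) auto
    have Z3: "(\<integral>\<omega>. (\<xi> \<omega> * (S b \<omega> - S s' \<omega>)) * (S d \<omega> - S b \<omega>) \<partial>M) = 0"
      using b T' by (intro sq_martingale_orth[OF S] sq m3) auto
    have i1: "integrable M (\<lambda>\<omega>. (\<xi> \<omega> * (S s' \<omega> - S s \<omega>)) * (S u' \<omega> - S s' \<omega>))"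
      using T' by (intro square_integrable_mult sq sqi_S_diff)
    have i3: "integrable M (\<lambda>\<omega>. (\<xi> \<omega> * (S b \<omega> - S s' \<omega>)) * (S d \<omega> - S b \<omega>))"
      using T' b by (intro square_integrable_mult sq sqi_S_diff)
    have "integrable M (\<lambda>\<omega>. (\<xi> \<omega> * (S b \<omega> - S s' \<omega>)) * (S b \<omega> - S s' \<omega>))"
      using T' b by (intro square_integrable_mult sq sqi_S_diff)
    then have i2: "integrable M (\<lambda>\<omega>. \<xi> \<omega> * (S b \<omega> - S s' \<omega>)\<^sup>2)"
      by (simp add: power2_eq_square mult.assoc)
    have "(\<phi> \<omega> * (S u \<omega> - S s \<omega>)) * (\<phi>' \<omega> * (S u' \<omega> - S s' \<omega>)) =
        (\<xi> \<omega> * (S s' \<omega> - S s \<omega>)) * (S u' \<omega> - S s' \<omega>) + \<xi> \<omega> * (S b \<omega> - S s' \<omega>)\<^sup>2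
        + (\<xi> \<omega> * (S b \<omega> - S s' \<omega>)) * (S d \<omega> - S b \<omega>)" for \<omega>
      unfolding \<xi>_def b_def d_def by (cases "u \<le> u'") (auto simp: min_def max_def power2_eq_square algebra_simps)
    then have "(\<integral>\<omega>. (\<phi> \<omega> * (S u \<omega> - S s \<omega>)) * (\<phi>' \<omega> * (S u' \<omega> - S s' \<omega>)) \<partial>M) =
        (\<integral>\<omega>. \<xi> \<omega> * (S b \<omega> - S s' \<omega>)\<^sup>2 \<partial>M)"
      using i1 i2 i3 Z1 Z3 by simp
    also have "\<dots> = (\<integral>\<omega>. \<xi> \<omega> * (A b \<omega> - A s' \<omega>) \<partial>M)"
      by (rule increment_square[OF b(1,2,5) \<xi> \<xi>b])
    also have "\<dots> = (\<integral>z. \<xi> (snd z) * indicator {s'<..b} (fst z) \<partial>Q)"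
      by (rule integral_Q_rect[OF b(1,2,5) \<xi> \<xi>b, symmetric])
    also have "\<dots> = (\<integral>z. (\<phi> (snd z) * indicator {s<..u} (fst z)) * (\<phi>' (snd z) * indicator {s'<..u'} (fst z)) \<partial>Q)"
      using ss by (intro Bochner_Integration.integral_cong refl) (auto simp: \<xi>_def b_def indicator_def)
    finally show ?thesis .
  qed
qed

lemma isometry_single:
  assumes "elementary M F T [e]" "elementary M F T [e']"
  shows "(\<integral>\<omega>. elem_integral S [e] T \<omega> * elem_integral S [e'] T \<omega> \<partial>M) =
    (\<integral>z. elem_process [e] (fst z) (snd z) * elem_process [e'] (fst z) (snd z) \<partial>Q)"
proof -
  from assms(1) obtain s u \<phi> c where e: "e = (s, u, \<phi>)" "0 \<le> s" "s \<le> u" "u \<le> T" "\<phi> \<in> borel_measurable (F s)"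
    "\<And>\<omega>. \<omega> \<in> space M \<Longrightarrow> \<bar>\<phi> \<omega>\<bar> \<le> c" by (rule elementary_singleE) blast
  from assms(2) obtain s' u' \<phi>' c' where e': "e' = (s', u', \<phi>')" "0 \<le> s'" "s' \<le> u'" "u' \<le> T" "\<phi>' \<in> borel_measurable (F s')"
    "\<And>\<omega>. \<omega> \<in> space M \<Longrightarrow> \<bar>\<phi>' \<omega>\<bar> \<le> c'" by (rule elementary_singleE) blast
  have 1: "elem_integral S [e] T \<omega> = \<phi> \<omega> * (S u \<omega> - S s \<omega>)" "elem_integral S [e'] T \<omega> = \<phi>' \<omega> * (S u' \<omega> - S s' \<omega>)" for \<omega>
    using e(2-4) e'(2-4) by (simp_all add: elem_integral_def e(1) e'(1) min_def)
  have 2: "elem_process [e] t \<omega> = \<phi> \<omega> * indicator {s<..u} t" "elem_process [e'] t \<omega> = \<phi>' \<omega> * indicator {s'<..u'} t" for t \<omega>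
    by (simp_all add: elem_process_def e(1) e'(1))
  show ?thesis
  proof (cases "s \<le> s'")
    case True
    show ?thesis unfolding 1 2 by (rule isometry_pair_ordered[OF e(2-6) e'(2-6) True])
  next
    case False
    then have "s' \<le> s" by simp
    from isometry_pair_ordered[OF e'(2-6) e(2-6) this]
    show ?thesis unfolding 1 2
      by (simp only: mult.commute[of "\<phi>' _ * (S u' _ - S s' _)"] mult.commute[of "\<phi>' _ * indicator {s'<..u'} _"])
  qed
qed

lemma sqi_elem_process:
  assumes "elementary M F T E"
  shows "square_integrable Q (\<lambda>z. elem_process E (fst z) (snd z))"
  using assms
proof (induction E)
  case Nil
  then show ?case by (simp add: square_integrable_zero)
next
  case (Cons e E)
  then have e: "elementary M F T [e]" and E: "elementary M F T E" by (simp_all add: elementary_Cons[of M F T e E])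
  from e obtain s u \<phi> c where e': "e = (s, u, \<phi>)" "0 \<le> s" "s \<le> u" "u \<le> T" "\<phi> \<in> borel_measurable (F s)"
    "\<And>\<omega>. \<omega> \<in> space M \<Longrightarrow> \<bar>\<phi> \<omega>\<bar> \<le> c" by (rule elementary_singleE) blast
  have "square_integrable Q (\<lambda>z. elem_process [e] (fst z) (snd z))"
  proof (rule square_integrable_bound[OF square_integrable_const[OF finite_Q, of c]])
    show "(\<lambda>z. elem_process [e] (fst z) (snd z)) \<in> borel_measurable Q"
      using measurable_elem_process[OF e] by measurable
    show "AE z in Q. \<bar>elem_process [e] (fst z) (snd z)\<bar> \<le> \<bar>c\<bar>"
      using e'(6) by (intro AE_I2) (force simp: elem_process_def e'(1) indicator_def)
  qed
  from square_integrable_add[OF this Cons.IH[OF E]] show ?case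
    by (simp add: elem_process_Cons[of e E])
qed

lemma sqi_elem_integral:
  "elementary M F T E \<Longrightarrow> square_integrable M (elem_integral S E T)"
  using sq_martingale_sqi[OF sq_martingale_elem_integral[OF S] T_in] .

lemma elementary_isometry:
  assumes "elementary M F T E" "elementary M F T E'"
  shows "(\<integral>\<omega>. elem_integral S E T \<omega> * elem_integral S E' T \<omega> \<partial>M) =
    (\<integral>z. elem_process E (fst z) (snd z) * elem_process E' (fst z) (snd z) \<partial>Q)"
  using assms(1)
proof (induction E)
  case (Cons e E)
  then have e: "elementary M F T [e]" and E: "elementary M F T E" by (simp_all add: elementary_Cons[of M F T e E])
  have "(\<integral>\<omega>. elem_integral S [e] T \<omega> * elem_integral S E' T \<omega> \<partial>M) =
    (\<integral>z. elem_process [e] (fst z) (snd z) * elem_process E' (fst z) (snd z) \<partial>Q)"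
    using assms(2)
  proof (induction E')
    case (Cons e' E')
    then have e': "elementary M F T [e']" and E': "elementary M F T E'" by (simp_all add: elementary_Cons[of M F T e' E'])
    show ?case
      unfolding elem_integral_Cons[of S e' E'] elem_process_Cons[of e' E'] distrib_left
      using isometry_single[OF e e'] Cons.IH[OF E']
        square_integrable_mult[OF sqi_elem_integral[OF e] sqi_elem_integral[OF e']]
        square_integrable_mult[OF sqi_elem_integral[OF e] sqi_elem_integral[OF E']]
        square_integrable_mult[OF sqi_elem_process[OF e] sqi_elem_process[OF e']]
        square_integrable_mult[OF sqi_elem_process[OF e] sqi_elem_process[OF E']]
      by simp
  qed simp
  then show ?case
    unfolding elem_integral_Cons[of S e E] elem_process_Cons[of e E] distrib_right
    using Cons.IH[OF E]
      square_integrable_mult[OF sqi_elem_integral[OF e] sqi_elem_integral[OF assms(2)]]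
      square_integrable_mult[OF sqi_elem_integral[OF E] sqi_elem_integral[OF assms(2)]]
      square_integrable_mult[OF sqi_elem_process[OF e] sqi_elem_process[OF assms(2)]]
      square_integrable_mult[OF sqi_elem_process[OF E] sqi_elem_process[OF assms(2)]]
    by simp
qed simp

end

lemma tendsto_0_ennrealD:
  assumes "(\<lambda>k::nat. ennreal (f k)) \<longlonglongrightarrow> 0" "\<And>k. 0 \<le> f k"
  shows "f \<longlonglongrightarrow> 0"
  using tendsto_ennrealD[of f 0 sequentially] assms by (simp add: ennreal_0)

section \<open>Limits of elementary integrals: isometry, uniqueness, orthogonality\<close>

context integrator
begin

text \<open>A square integrable martingale is determined by its terminal value, so \<open>ito \<theta> X\<close> only
  records \<open>X = (\<theta> \<cdot> S)\<^sub>T\<close>.\<close>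
definition ito :: "(real \<times> 'a \<Rightarrow> real) \<Rightarrow> ('a \<Rightarrow> real) \<Rightarrow> bool" where
  "ito \<theta> X \<longleftrightarrow> square_integrable Q \<theta> \<and> square_integrable M X \<and>
     (\<exists>E. (\<forall>k::nat. elementary M F T (E k)) \<and>
       (\<lambda>k. \<integral>z. (elem_process (E k) (fst z) (snd z) - \<theta> z)\<^sup>2 \<partial>Q) \<longlonglongrightarrow> 0 \<and>
       (\<lambda>k. \<integral>\<omega>. (elem_integral S (E k) T \<omega> - X \<omega>)\<^sup>2 \<partial>M) \<longlonglongrightarrow> 0)"

lemma ito_sqi: "ito \<theta> X \<Longrightarrow> square_integrable Q \<theta>" "ito \<theta> X \<Longrightarrow> square_integrable M X"
  by (simp_all add: ito_def)

lemma ito_elem: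
  assumes "elementary M F T E"
  shows "ito (\<lambda>z. elem_process E (fst z) (snd z)) (elem_integral S E T)"
  unfolding ito_def using sqi_elem_process[OF assms] sqi_elem_integral[OF assms] assms
  by (auto intro!: exI[of _ "\<lambda>_. E"])

text \<open>Approximants are subtracted by concatenating the lists, the second one scaled by
  -1.\<close>

lemma ito_diff:
  assumes "ito \<theta> X" "ito \<theta>' X'"
  shows "ito (\<lambda>z. \<theta> z - \<theta>' z) (\<lambda>\<omega>. X \<omega> - X' \<omega>)"
proof -
  obtain E where E: "\<And>k::nat. elementary M F T (E k)"
      "(\<lambda>k. \<integral>z. (elem_process (E k) (fst z) (snd z) - \<theta> z)\<^sup>2 \<partial>Q) \<longlonglongrightarrow> 0"
      "(\<lambda>k. \<integral>\<omega>. (elem_integral S (E k) T \<omega> - X \<omega>)\<^sup>2 \<partial>M) \<longlonglongrightarrow> 0"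
    using assms(1) unfolding ito_def by blast
  obtain E' where E': "\<And>k::nat. elementary M F T (E' k)"
      "(\<lambda>k. \<integral>z. (elem_process (E' k) (fst z) (snd z) - \<theta>' z)\<^sup>2 \<partial>Q) \<longlonglongrightarrow> 0"
      "(\<lambda>k. \<integral>\<omega>. (elem_integral S (E' k) T \<omega> - X' \<omega>)\<^sup>2 \<partial>M) \<longlonglongrightarrow> 0"
    using assms(2) unfolding ito_def by blast
  note sq = ito_sqi[OF assms(1)] ito_sqi[OF assms(2)]
  have sqE: "square_integrable Q (\<lambda>z. elem_process (E k) (fst z) (snd z))"
    "square_integrable Q (\<lambda>z. - elem_process (E' k) (fst z) (snd z))"
    "square_integrable M (\<lambda>\<omega>. elem_integral S (E k) T \<omega>)"
    "square_integrable M (\<lambda>\<omega>. - elem_integral S (E' k) T \<omega>)" for k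
    using square_integrable_cmult[OF sqi_elem_process[OF E'(1)], of "-1" k]
      square_integrable_cmult[OF sqi_elem_integral[OF E'(1)], of "-1" k]
    by (simp_all add: sqi_elem_process[OF E(1)] sqi_elem_integral[OF E(1)])
  have sqn: "square_integrable Q (\<lambda>z. - \<theta>' z)" "square_integrable M (\<lambda>\<omega>. - X' \<omega>)"
    using square_integrable_cmult[OF sq(3), of "-1"] square_integrable_cmult[OF sq(4), of "-1"] by simp_all
  have neg: "(- a - - b)\<^sup>2 = (a - b)\<^sup>2" for a b :: real by (simp add: power2_commute)
  have "(\<lambda>k. \<integral>z. (elem_process (E k) (fst z) (snd z) + - elem_process (E' k) (fst z) (snd z) - (\<theta> z + - \<theta>' z))\<^sup>2 \<partial>Q) \<longlonglongrightarrow> 0"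
    by (rule L2_tendsto_add[OF sqE(1) sq(1) sqE(2) sqn(1) E(2)]) (simp only: neg E'(2))
  moreover have "(\<lambda>k. \<integral>\<omega>. (elem_integral S (E k) T \<omega> + - elem_integral S (E' k) T \<omega> - (X \<omega> + - X' \<omega>))\<^sup>2 \<partial>M) \<longlonglongrightarrow> 0"
    by (rule L2_tendsto_add[OF sqE(3) sq(2) sqE(4) sqn(2) E(3)]) (simp only: neg E'(3))
  ultimately show ?thesis
    unfolding ito_def
    by (intro conjI square_integrable_diff sq exI[of _ "\<lambda>k. E k @ elem_scale (-1) (E' k)"])
      (auto simp: elem_process_append elem_process_scale elem_integral_append elem_integral_scale
        intro!: elementary_append elementary_scale E(1) E'(1))
qed

lemma ito_isometry:
  assumes "ito \<theta> X"
  shows "(\<integral>\<omega>. (X \<omega>)\<^sup>2 \<partial>M) = (\<integral>z. (\<theta> z)\<^sup>2 \<partial>Q)"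
proof -
  obtain E where E: "\<And>k::nat. elementary M F T (E k)"
      "(\<lambda>k. \<integral>z. (elem_process (E k) (fst z) (snd z) - \<theta> z)\<^sup>2 \<partial>Q) \<longlonglongrightarrow> 0"
      "(\<lambda>k. \<integral>\<omega>. (elem_integral S (E k) T \<omega> - X \<omega>)\<^sup>2 \<partial>M) \<longlonglongrightarrow> 0"
    using assms(1) unfolding ito_def by blast
  note 1 = L2_tendsto_norm[OF sqi_elem_process[OF E(1)] ito_sqi(1)[OF assms] E(2)]
  note 2 = L2_tendsto_norm[OF sqi_elem_integral[OF E(1)] ito_sqi(2)[OF assms] E(3)]
  from 2 have "(\<lambda>k. \<integral>z. (elem_process (E k) (fst z) (snd z))\<^sup>2 \<partial>Q) \<longlonglongrightarrow> (\<integral>\<omega>. (X \<omega>)\<^sup>2 \<partial>M)"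
    using elementary_isometry[OF E(1) E(1)] by (simp add: power2_eq_square)
  from LIMSEQ_unique[OF this 1] show ?thesis .
qed

text \<open>Polarisation: the isometry for the difference is compared with the isometries for the
  two terms.\<close>

lemma ito_inner:
  assumes "ito \<theta> X" "ito \<theta>' X'"
  shows "(\<integral>\<omega>. X \<omega> * X' \<omega> \<partial>M) = (\<integral>z. \<theta> z * \<theta>' z \<partial>Q)"
  using ito_isometry[OF ito_diff[OF assms]] ito_isometry[OF assms(1)] ito_isometry[OF assms(2)]
  unfolding integral_square_diff[OF ito_sqi(1)[OF assms(1)] ito_sqi(1)[OF assms(2)]]
    integral_square_diff[OF ito_sqi(2)[OF assms(1)] ito_sqi(2)[OF assms(2)]]
  by simp

text \<open>The inner product with \<open>Z\<close> is continuous along the approximating elementary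
  integrals.\<close>

lemma ito_orth:
  assumes "ito \<theta> X" and Z: "square_integrable M Z"
    and orth: "\<And>E. elementary M F T E \<Longrightarrow> (\<integral>\<omega>. Z \<omega> * elem_integral S E T \<omega> \<partial>M) = 0"
  shows "(\<integral>\<omega>. Z \<omega> * X \<omega> \<partial>M) = 0"
proof -
  obtain E where E: "\<And>k::nat. elementary M F T (E k)"
      "(\<lambda>k. \<integral>\<omega>. (elem_integral S (E k) T \<omega> - X \<omega>)\<^sup>2 \<partial>M) \<longlonglongrightarrow> 0"
    using assms(1) unfolding ito_def by blast
  have "(\<integral>\<omega>. elem_integral S (E k) T \<omega> * Z \<omega> \<partial>M) = 0" for k
    using orth[OF E(1)] by (simp add: mult.commute)
  with L2_tendsto_inner[OF sqi_elem_integral[OF E(1)] ito_sqi(2)[OF assms(1)] Z E(2)]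
  show ?thesis by (simp add: LIMSEQ_const_iff mult.commute)
qed

text \<open>Only the class of the integrand in L2(\<open>Q\<close>) matters; the same approximants
  serve \<open>\<theta>'\<close>.\<close>

lemma ito_cong:
  assumes "ito \<theta> X" and \<theta>': "\<theta>' \<in> borel_measurable P" "AE z in Q. \<theta> z = \<theta>' z"
  shows "ito \<theta>' X"
proof -
  note sq = ito_sqi[OF assms(1)]
  have sq': "square_integrable Q \<theta>'"
    using \<theta>' by (intro square_integrable_cong_AE[OF sq(1)]) auto
  have "(\<integral>z. (elem_process E (fst z) (snd z) - \<theta> z)\<^sup>2 \<partial>Q) = (\<integral>z. (elem_process E (fst z) (snd z) - \<theta>' z)\<^sup>2 \<partial>Q)"
    if "elementary M F T E" for E
  proof (rule integral_cong_AE)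
    show "AE z in Q. (elem_process E (fst z) (snd z) - \<theta> z)\<^sup>2 = (elem_process E (fst z) (snd z) - \<theta>' z)\<^sup>2"
      using \<theta>'(2) by eventually_elim simp
  qed (use square_integrable_diff[OF sqi_elem_process[OF that] sq(1)]
      square_integrable_diff[OF sqi_elem_process[OF that] sq'] in \<open>auto simp: square_integrable_def\<close>)
  then show ?thesis using assms(1) sq' unfolding ito_def by auto
qed

text \<open>Through \<open>Q\<close> the energy is a squared L2 norm, so limits of extended
  nonnegative integrals become limits of real ones.\<close>

lemma stoch_integral_ito:
  assumes "stoch_integral M F T S A \<theta> I"
  shows "ito (\<lambda>z. \<theta> (fst z) (snd z)) (I T)"
proof -
  have pred: "(\<lambda>z. \<theta> (fst z) (snd z)) \<in> borel_measurable P"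
    using assms unfolding stoch_integral_def L2_integrand_def predictable_def by (simp add: case_prod_beta')
  then have predQ: "(\<lambda>z. \<theta> (fst z) (snd z)) \<in> borel_measurable Q" by measurable
  have sq\<theta>: "square_integrable Q (\<lambda>z. \<theta> (fst z) (snd z))"
    using assms L2_energy_eq[OF pred] square_integrable_iff_nn_integral[OF predQ]
    by (simp add: stoch_integral_def L2_integrand_def)
  have sqI: "square_integrable M (I T)"
    using assms sq_martingale_sqi[OF _ T_in] by (simp add: stoch_integral_def)
  obtain E where E: "\<And>k::nat. elementary M F T (E k)"
    "(\<lambda>k. L2_energy M T A (\<lambda>t \<omega>. elem_process (E k) t \<omega> - \<theta> t \<omega>)) \<longlonglongrightarrow> 0"
    "(\<lambda>k. \<integral>\<^sup>+\<omega>. ennreal ((elem_integral S (E k) T \<omega> - I T \<omega>)\<^sup>2) \<partial>M) \<longlonglongrightarrow> 0"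
    using assms unfolding stoch_integral_def by blast
  have "L2_energy M T A (\<lambda>t \<omega>. elem_process (E k) t \<omega> - \<theta> t \<omega>) =
      ennreal (\<integral>z. (elem_process (E k) (fst z) (snd z) - \<theta> (fst z) (snd z))\<^sup>2 \<partial>Q)" for k
  proof (subst L2_energy_eq)
    show "(\<lambda>z. elem_process (E k) (fst z) (snd z) - \<theta> (fst z) (snd z)) \<in> borel_measurable P"
      using pred measurable_elem_process[OF E(1)] by measurable
  qed (use nn_integral_square[OF square_integrable_diff[OF sqi_elem_process[OF E(1)] sq\<theta>]] in simp)
  with E(2) have 1: "(\<lambda>k. \<integral>z. (elem_process (E k) (fst z) (snd z) - \<theta> (fst z) (snd z))\<^sup>2 \<partial>Q) \<longlonglongrightarrow> 0"
    by (intro tendsto_0_ennrealD) auto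
  have 2: "(\<lambda>k. \<integral>\<omega>. (elem_integral S (E k) T \<omega> - I T \<omega>)\<^sup>2 \<partial>M) \<longlonglongrightarrow> 0"
    using E(3) nn_integral_square[OF square_integrable_diff[OF sqi_elem_integral[OF E(1)] sqI]]
    by (intro tendsto_0_ennrealD) auto
  show ?thesis unfolding ito_def using sq\<theta> sqI E(1) 1 2 by blast
qed

lemma ito_stoch_integral:
  assumes pred: "(\<lambda>z. \<theta> (fst z) (snd z)) \<in> borel_measurable P" and I: "sq_martingale M F T I"
    and ito: "ito (\<lambda>z. \<theta> (fst z) (snd z)) (I T)"
  shows "stoch_integral M F T S A \<theta> I"
proof -
  note sq = ito_sqi[OF ito]
  obtain E where E: "\<And>k::nat. elementary M F T (E k)"
      "(\<lambda>k. \<integral>z. (elem_process (E k) (fst z) (snd z) - \<theta> (fst z) (snd z))\<^sup>2 \<partial>Q) \<longlonglongrightarrow> 0"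
      "(\<lambda>k. \<integral>\<omega>. (elem_integral S (E k) T \<omega> - I T \<omega>)\<^sup>2 \<partial>M) \<longlonglongrightarrow> 0"
    using ito unfolding ito_def by blast
  have "L2_energy M T A (\<lambda>t \<omega>. elem_process (E k) t \<omega> - \<theta> t \<omega>) =
      ennreal (\<integral>z. (elem_process (E k) (fst z) (snd z) - \<theta> (fst z) (snd z))\<^sup>2 \<partial>Q)" for k
  proof (subst L2_energy_eq)
    show "(\<lambda>z. elem_process (E k) (fst z) (snd z) - \<theta> (fst z) (snd z)) \<in> borel_measurable P"
      using pred measurable_elem_process[OF E(1)] by measurable
  qed (use nn_integral_square[OF square_integrable_diff[OF sqi_elem_process[OF E(1)] sq(1)]] in simp)
  moreover have "(\<lambda>k. ennreal (\<integral>z. (elem_process (E k) (fst z) (snd z) - \<theta> (fst z) (snd z))\<^sup>2 \<partial>Q)) \<longlonglongrightarrow> 0"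
    using tendsto_ennrealI[OF E(2)] by (simp add: ennreal_0)
  moreover have "(\<lambda>k. \<integral>\<^sup>+\<omega>. ennreal ((elem_integral S (E k) T \<omega> - I T \<omega>)\<^sup>2) \<partial>M) \<longlonglongrightarrow> 0"
    unfolding nn_integral_square[OF square_integrable_diff[OF sqi_elem_integral[OF E(1)] sq(2)]]
    using tendsto_ennrealI[OF E(3)] by (simp add: ennreal_0)
  moreover have "L2_energy M T A \<theta> < \<infinity>"
    using L2_energy_eq[OF pred] nn_integral_square[OF sq(1)] by simp
  moreover have "predictable M F T \<theta>"
    using pred by (simp add: predictable_def case_prod_beta')
  ultimately show ?thesis
    unfolding stoch_integral_def L2_integrand_def using I E(1) by (auto intro!: exI[of _ E])
qed

text \<open>The isometry makes the terminal values agree, and these determine the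
  martingales.\<close>

lemma stoch_integral_unique:
  assumes I: "stoch_integral M F T S A \<theta> I" and I': "stoch_integral M F T S A \<theta>' I'"
    and eq: "AE z in Q. \<theta> (fst z) (snd z) = \<theta>' (fst z) (snd z)"
  shows "indist M T I I'"
proof (rule sq_martingale_eq_terminal)
  note d = ito_diff[OF stoch_integral_ito[OF I] stoch_integral_ito[OF I']]
  have "(\<integral>z. (\<theta> (fst z) (snd z) - \<theta>' (fst z) (snd z))\<^sup>2 \<partial>Q) = 0"
    using eq by (subst integral_square_eq_0_iff[OF ito_sqi(1)[OF d]]) auto
  then have "(\<integral>\<omega>. (I T \<omega> - I' T \<omega>)\<^sup>2 \<partial>M) = 0"
    using ito_isometry[OF d] by simp
  then show "AE \<omega> in M. I T \<omega> = I' T \<omega>"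
    by (subst (asm) integral_square_eq_0_iff[OF ito_sqi(2)[OF d]]) auto
qed (use I I' in \<open>auto simp: stoch_integral_def\<close>)

text \<open>For \<open>r\<close> from \<open>s\<close> on, the mean of
  \<open>\<phi> * S r * L T\<close> does not depend on \<open>r\<close>: conditioning replaces
  \<open>L T\<close> by \<open>L r\<close>, and the martingale \<open>L * S\<close> then goes back
  to \<open>s\<close>. Hence \<open>L T\<close> is orthogonal to \<open>\<phi>\<close> times an
  increment of \<open>S\<close> after \<open>s\<close>.\<close>

lemma covariation_zero_orth:
  assumes L: "sq_martingale M F T L" and cov: "covariation M F T L S (\<lambda>_ _. 0)"
    and E: "elementary M F T E"
  shows "(\<integral>\<omega>. L T \<omega> * elem_integral S E T \<omega> \<partial>M) = 0"
  using E
proof (induction E)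
  case (Cons e E)
  then have e: "elementary M F T [e]" and E: "elementary M F T E" by (simp_all add: elementary_Cons[of M F T e E])
  from e obtain s u \<phi> c where e': "e = (s, u, \<phi>)" "0 \<le> s" "s \<le> u" "u \<le> T" "\<phi> \<in> borel_measurable (F s)"
    "\<And>\<omega>. \<omega> \<in> space M \<Longrightarrow> \<bar>\<phi> \<omega>\<bar> \<le> c" by (rule elementary_singleE) blast
  have su: "s \<in> {0..T}" "u \<in> {0..T}" using e' by auto
  have \<phi>M: "\<phi> \<in> borel_measurable M" by (rule measurable_F_imp_M[OF e'(5) su(1)])
  have LS: "martingale M F T (\<lambda>t \<omega>. L t \<omega> * S t \<omega>)" using cov by (simp add: covariation_def)
  have sq: "square_integrable M (\<lambda>\<omega>. \<phi> \<omega> * S r \<omega>)" if "r \<in> {0..T}" for r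
    by (rule square_integrable_mult_bounded[OF sq_martingale_sqi[OF S that] \<phi>M e'(6)])
  have int: "integrable M (\<lambda>\<omega>. (\<phi> \<omega> * S r \<omega>) * L T \<omega>)" if "r \<in> {0..T}" for r
    by (rule square_integrable_mult[OF sq[OF that] sq_martingale_sqi[OF L T_in]])
  have step: "(\<integral>\<omega>. (\<phi> \<omega> * S r \<omega>) * L T \<omega> \<partial>M) = (\<integral>\<omega>. \<phi> \<omega> * (L s \<omega> * S s \<omega>) \<partial>M)" if r: "s \<le> r" "r \<le> T" for r
  proof -
    have rT: "r \<in> {0..T}" "0 \<le> r" using r su by auto
    have "\<phi> \<in> borel_measurable (F r)" "S r \<in> borel_measurable (F r)"
      using measurable_F_mono[OF e'(5,2) r] sq_martingale_meas[OF S rT(1)] by auto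
    then have "(\<integral>\<omega>. (\<phi> \<omega> * S r \<omega>) * L T \<omega> \<partial>M) = (\<integral>\<omega>. (\<phi> \<omega> * S r \<omega>) * L r \<omega> \<partial>M)"
      using rT r T_pos by (intro sq_martingale_inner[OF L] sq) auto
    also have "\<dots> = (\<integral>\<omega>. \<phi> \<omega> * (L r \<omega> * S r \<omega>) \<partial>M)" by (simp add: ac_simps)
    also have "\<dots> = (\<integral>\<omega>. \<phi> \<omega> * (L s \<omega> * S s \<omega>) \<partial>M)"
    proof (rule martingale_inner(1)[OF LS e'(2) r e'(5)])
      show "integrable M (\<lambda>\<omega>. \<phi> \<omega> * (L r \<omega> * S r \<omega>))"
        by (intro integrable_mult_bounded[OF _ \<phi>M e'(6)] square_integrable_mult
            sq_martingale_sqi[OF L rT(1)] sq_martingale_sqi[OF S rT(1)])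
    qed
    finally show ?thesis .
  qed
  have "elem_integral S [e] T \<omega> = \<phi> \<omega> * (S u \<omega> - S s \<omega>)" for \<omega>
    using e'(2-4) by (simp add: elem_integral_def e'(1) min_def)
  then have "(\<integral>\<omega>. L T \<omega> * elem_integral S [e] T \<omega> \<partial>M) =
      (\<integral>\<omega>. (\<phi> \<omega> * S u \<omega>) * L T \<omega> - (\<phi> \<omega> * S s \<omega>) * L T \<omega> \<partial>M)"
    by (simp only: right_diff_distrib mult.commute left_diff_distrib mult.assoc)
  also have "\<dots> = 0"
    using step[of u] step[of s] e' int[OF su(1)] int[OF su(2)] by simp
  finally have 1: "(\<integral>\<omega>. L T \<omega> * elem_integral S [e] T \<omega> \<partial>M) = 0" .
  show ?case
    unfolding elem_integral_Cons[of S e E] distrib_left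
    using 1 Cons.IH[OF E] square_integrable_mult[OF sq_martingale_sqi[OF L T_in] sqi_elem_integral[OF e]]
      square_integrable_mult[OF sq_martingale_sqi[OF L T_in] sqi_elem_integral[OF E]]
    by simp
qed simp

end

section \<open>Jointly progressive versions of stochastic integrals\<close>

lemma sum_sq_le: "(a + b)\<^sup>2 \<le> 2 * a\<^sup>2 + 2 * b\<^sup>2" for a b :: real
  using zero_le_power2[of "a - b"] by (simp add: power2_eq_square algebra_simps)

context filtered_basis
begin

text \<open>Parameter space and values are left open: the strip and a one-point space occur as
  parameters, and real as well as complex families occur.\<close>

definition progressive_family :: "'z measure \<Rightarrow> ('z \<Rightarrow> real \<Rightarrow> 'a \<Rightarrow> 'b::topological_space) \<Rightarrow> bool" where
  "progressive_family Z W \<longleftrightarrow> (\<forall>t\<in>{0..T}. (\<lambda>((s, \<omega>), z). W z s \<omega>)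
     \<in> borel_measurable ((restrict_space borel {0..t} \<Otimes>\<^sub>M F t) \<Otimes>\<^sub>M Z))"

lemma progressive_familyD:
  "progressive_family Z W \<Longrightarrow> t \<in> {0..T} \<Longrightarrow>
    (\<lambda>x. W (snd x) (fst (fst x)) (snd (fst x))) \<in> borel_measurable ((restrict_space borel {0..t} \<Otimes>\<^sub>M F t) \<Otimes>\<^sub>M Z)"
  by (simp add: progressive_family_def case_prod_beta')

lemma progressive_familyI:
  "(\<And>t. t \<in> {0..T} \<Longrightarrow> (\<lambda>x. W (snd x) (fst (fst x)) (snd (fst x)))
     \<in> borel_measurable ((restrict_space borel {0..t} \<Otimes>\<^sub>M F t) \<Otimes>\<^sub>M Z)) \<Longrightarrow> progressive_family Z W"
  by (simp add: progressive_family_def case_prod_beta')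

end

section \<open>Approximation by elementary integrands depending measurably on a parameter\<close>

context integrator
begin

text \<open>The elementary approximants may use different partitions for different parameters;
  only the resulting integral processes have to be jointly measurable.\<close>
definition approx :: "'z measure \<Rightarrow> ((real \<times> 'a) \<times> 'z \<Rightarrow> real) \<Rightarrow> bool" where
  "approx Z f \<longleftrightarrow> (\<forall>\<epsilon>>0. \<exists>E. (\<forall>z\<in>space Z. elementary M F T (E z)) \<and>
     progressive_family Z (\<lambda>z. elem_integral S (E z)) \<and>
     (\<forall>z\<in>space Z. (\<integral>\<^sup>+x. ennreal ((elem_process (E z) (fst x) (snd x) - f (x, z))\<^sup>2) \<partial>Q) < ennreal \<epsilon>))"

lemma approxE:
  assumes "approx Z f" "0 < \<epsilon>"
  obtains E where "\<And>z. z \<in> space Z \<Longrightarrow> elementary M F T (E z)"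
    "progressive_family Z (\<lambda>z. elem_integral S (E z))"
    "\<And>z. z \<in> space Z \<Longrightarrow> (\<integral>\<^sup>+x. ennreal ((elem_process (E z) (fst x) (snd x) - f (x, z))\<^sup>2) \<partial>Q) < ennreal \<epsilon>"
  using assms unfolding approx_def by blast

lemma approxI:
  assumes "\<And>\<epsilon>. 0 < \<epsilon> \<Longrightarrow> \<exists>E. (\<forall>z\<in>space Z. elementary M F T (E z)) \<and>
     progressive_family Z (\<lambda>z. elem_integral S (E z)) \<and>
     (\<forall>z\<in>space Z. (\<integral>\<^sup>+x. ennreal ((elem_process (E z) (fst x) (snd x) - f (x, z))\<^sup>2) \<partial>Q) < ennreal \<epsilon>)"
  shows "approx Z f"
  using assms by (simp add: approx_def)

lemma approx_cong:
  assumes "approx Z f" "\<And>x z. x \<in> space Q \<Longrightarrow> z \<in> space Z \<Longrightarrow> f (x, z) = g (x, z)"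
  shows "approx Z g"
proof -
  have "(\<integral>\<^sup>+x. ennreal ((elem_process E (fst x) (snd x) - f (x, z))\<^sup>2) \<partial>Q) =
      (\<integral>\<^sup>+x. ennreal ((elem_process E (fst x) (snd x) - g (x, z))\<^sup>2) \<partial>Q)" if "z \<in> space Z" for E z
    using assms(2)[OF _ that] by (intro nn_integral_cong) simp
  then show ?thesis using assms(1) unfolding approx_def by simp
qed

text \<open>The quarters come from
  \<open>(a + b)\<^sup>2 \<le> 2 * a\<^sup>2 + 2 * b\<^sup>2\<close>.\<close>

lemma nn_square_add_less:
  assumes [measurable]: "a \<in> borel_measurable N" "b \<in> borel_measurable N" and e: "0 < e"
    and a: "(\<integral>\<^sup>+x. ennreal ((a x)\<^sup>2) \<partial>N) < ennreal (e / 4)"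
    and b: "(\<integral>\<^sup>+x. ennreal ((b x)\<^sup>2) \<partial>N) < ennreal (e / 4)"
  shows "(\<integral>\<^sup>+x. ennreal ((a x + b x)\<^sup>2) \<partial>N) < ennreal e"
proof -
  have "(\<integral>\<^sup>+x. ennreal ((a x + b x)\<^sup>2) \<partial>N) \<le> (\<integral>\<^sup>+x. 2 * ennreal ((a x)\<^sup>2) + 2 * ennreal ((b x)\<^sup>2) \<partial>N)"
  proof (rule nn_integral_mono)
    fix x
    have "ennreal ((a x + b x)\<^sup>2) \<le> ennreal (2 * (a x)\<^sup>2 + 2 * (b x)\<^sup>2)"
      by (rule ennreal_leI[OF sum_sq_le])
    then show "ennreal ((a x + b x)\<^sup>2) \<le> 2 * ennreal ((a x)\<^sup>2) + 2 * ennreal ((b x)\<^sup>2)"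
      by (simp add: ennreal_mult)
  qed
  also have "\<dots> = 2 * (\<integral>\<^sup>+x. ennreal ((a x)\<^sup>2) \<partial>N) + 2 * (\<integral>\<^sup>+x. ennreal ((b x)\<^sup>2) \<partial>N)"
    by (simp add: nn_integral_add nn_integral_cmult)
  also have "\<dots> < 2 * ennreal (e / 4) + 2 * ennreal (e / 4)"
    using a b by (intro add_strict_mono ennreal_mult_strict_left_mono) auto
  also have "\<dots> = ennreal e"
    using e by (simp add: ennreal_mult[symmetric] ennreal_plus[symmetric] mult.commute flip: ennreal_numeral del: ennreal_plus)
  finally show ?thesis .
qed

lemma measurable_Q_elem_process:
  "elementary M F T E \<Longrightarrow> (\<lambda>x. elem_process E (fst x) (snd x)) \<in> borel_measurable Q"
  using sqi_elem_process square_integrableD(1) by blast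

lemma measurable_Q_section:
  assumes "f \<in> borel_measurable (Q \<Otimes>\<^sub>M Z)" "z \<in> space Z"
  shows "(\<lambda>x. f (x, z)) \<in> borel_measurable Q"
  using assms by measurable

lemma approx_add:
  assumes f: "approx Z f" and g: "approx Z g"
    and m: "f \<in> borel_measurable (Q \<Otimes>\<^sub>M Z)" "g \<in> borel_measurable (Q \<Otimes>\<^sub>M Z)"
  shows "approx Z (\<lambda>y. f y + g y)"
proof (rule approxI)
  fix e :: real assume e: "0 < e"
  then have e4: "0 < e / 4" by simp
  obtain E where E: "\<And>z. z \<in> space Z \<Longrightarrow> elementary M F T (E z)"
    "progressive_family Z (\<lambda>z. elem_integral S (E z))"
    "\<And>z. z \<in> space Z \<Longrightarrow> (\<integral>\<^sup>+x. ennreal ((elem_process (E z) (fst x) (snd x) - f (x, z))\<^sup>2) \<partial>Q) < ennreal (e / 4)"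
    by (rule approxE[OF f e4]) blast
  obtain E' where E': "\<And>z. z \<in> space Z \<Longrightarrow> elementary M F T (E' z)"
    "progressive_family Z (\<lambda>z. elem_integral S (E' z))"
    "\<And>z. z \<in> space Z \<Longrightarrow> (\<integral>\<^sup>+x. ennreal ((elem_process (E' z) (fst x) (snd x) - g (x, z))\<^sup>2) \<partial>Q) < ennreal (e / 4)"
    by (rule approxE[OF g e4]) blast
  show "\<exists>E. (\<forall>z\<in>space Z. elementary M F T (E z)) \<and> progressive_family Z (\<lambda>z. elem_integral S (E z)) \<and>
     (\<forall>z\<in>space Z. (\<integral>\<^sup>+x. ennreal ((elem_process (E z) (fst x) (snd x) - (f (x, z) + g (x, z)))\<^sup>2) \<partial>Q) < ennreal e)"
  proof (intro exI[of _ "\<lambda>z. E z @ E' z"] conjI ballI)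
    show "elementary M F T (E z @ E' z)" if "z \<in> space Z" for z
      by (rule elementary_append[OF E(1)[OF that] E'(1)[OF that]])
    show "progressive_family Z (\<lambda>z. elem_integral S (E z @ E' z))"
    proof (rule progressive_familyI)
      fix t assume t: "t \<in> {0..T}"
      show "(\<lambda>x. elem_integral S (E (snd x) @ E' (snd x)) (fst (fst x)) (snd (fst x)))
          \<in> borel_measurable ((restrict_space borel {0..t} \<Otimes>\<^sub>M F t) \<Otimes>\<^sub>M Z)"
        unfolding elem_integral_append
        by (rule borel_measurable_add[OF progressive_familyD[OF E(2) t] progressive_familyD[OF E'(2) t]])
    qed
    fix z assume z: "z \<in> space Z"
    have "(\<integral>\<^sup>+x. ennreal ((elem_process (E z) (fst x) (snd x) - f (x, z) + (elem_process (E' z) (fst x) (snd x) - g (x, z)))\<^sup>2) \<partial>Q) < ennreal e"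
      using measurable_Q_elem_process[OF E(1)[OF z]] measurable_Q_elem_process[OF E'(1)[OF z]]
        measurable_Q_section[OF m(1) z] measurable_Q_section[OF m(2) z]
      by (intro nn_square_add_less e E(3) E'(3) z borel_measurable_diff)
    then show "(\<integral>\<^sup>+x. ennreal ((elem_process (E z @ E' z) (fst x) (snd x) - (f (x, z) + g (x, z)))\<^sup>2) \<partial>Q) < ennreal e"
      by (simp add: elem_process_append algebra_simps)
  qed
qed

lemma approx_zero: "approx Z (\<lambda>_. 0)"
proof (rule approxI)
  fix e :: real assume "0 < e"
  then show "\<exists>E. (\<forall>z\<in>space Z. elementary M F T (E z)) \<and> progressive_family Z (\<lambda>z. elem_integral S (E z)) \<and>
     (\<forall>z\<in>space Z. (\<integral>\<^sup>+x. ennreal ((elem_process (E z) (fst x) (snd x) - 0)\<^sup>2) \<partial>Q) < ennreal e)"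
    by (intro exI[of _ "\<lambda>_. []"]) (simp add: progressive_family_def case_prod_beta')
qed

lemma approx_cmult:
  assumes f: "approx Z f" and m: "f \<in> borel_measurable (Q \<Otimes>\<^sub>M Z)"
  shows "approx Z (\<lambda>y. c * f y)"
proof (rule approxI)
  fix e :: real assume e: "0 < e"
  \<comment> \<open>Dividing by \<open>c\<^sup>2 + 1\<close> instead of \<open>c\<^sup>2\<close>
    covers \<open>c = 0\<close> and keeps the final inequality strict.\<close>
  have c: "0 < c\<^sup>2 + 1" by (simp add: add_nonneg_pos)
  with e have e': "0 < e / (c\<^sup>2 + 1)" by simp
  obtain E where E: "\<And>z. z \<in> space Z \<Longrightarrow> elementary M F T (E z)"
    "progressive_family Z (\<lambda>z. elem_integral S (E z))"
    "\<And>z. z \<in> space Z \<Longrightarrow> (\<integral>\<^sup>+x. ennreal ((elem_process (E z) (fst x) (snd x) - f (x, z))\<^sup>2) \<partial>Q) < ennreal (e / (c\<^sup>2 + 1))"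
    by (rule approxE[OF f e']) blast
  show "\<exists>E. (\<forall>z\<in>space Z. elementary M F T (E z)) \<and> progressive_family Z (\<lambda>z. elem_integral S (E z)) \<and>
     (\<forall>z\<in>space Z. (\<integral>\<^sup>+x. ennreal ((elem_process (E z) (fst x) (snd x) - c * f (x, z))\<^sup>2) \<partial>Q) < ennreal e)"
  proof (intro exI[of _ "\<lambda>z. elem_scale c (E z)"] conjI ballI)
    show "elementary M F T (elem_scale c (E z))" if "z \<in> space Z" for z
      by (rule elementary_scale[OF E(1)[OF that]])
    show "progressive_family Z (\<lambda>z. elem_integral S (elem_scale c (E z)))"
    proof (rule progressive_familyI)
      fix t assume t: "t \<in> {0..T}"
      show "(\<lambda>x. elem_integral S (elem_scale c (E (snd x))) (fst (fst x)) (snd (fst x)))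
          \<in> borel_measurable ((restrict_space borel {0..t} \<Otimes>\<^sub>M F t) \<Otimes>\<^sub>M Z)"
        unfolding elem_integral_scale
        by (rule borel_measurable_times[OF borel_measurable_const progressive_familyD[OF E(2) t]])
    qed
    fix z assume z: "z \<in> space Z"
    let ?I = "\<integral>\<^sup>+x. ennreal ((elem_process (E z) (fst x) (snd x) - f (x, z))\<^sup>2) \<partial>Q"
    have [measurable]: "(\<lambda>x. elem_process (E z) (fst x) (snd x)) \<in> borel_measurable Q" "(\<lambda>x. f (x, z)) \<in> borel_measurable Q"
      using measurable_Q_elem_process[OF E(1)[OF z]] measurable_Q_section[OF m z] by auto
    have "(\<integral>\<^sup>+x. ennreal ((elem_process (elem_scale c (E z)) (fst x) (snd x) - c * f (x, z))\<^sup>2) \<partial>Q) =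
      (\<integral>\<^sup>+x. ennreal (c\<^sup>2) * ennreal ((elem_process (E z) (fst x) (snd x) - f (x, z))\<^sup>2) \<partial>Q)"
      by (simp add: elem_process_scale right_diff_distrib[symmetric] power_mult_distrib ennreal_mult)
    also have "\<dots> = ennreal (c\<^sup>2) * ?I"
      by (rule nn_integral_cmult) measurable
    also have "\<dots> \<le> ennreal (c\<^sup>2) * ennreal (e / (c\<^sup>2 + 1))"
      by (rule mult_left_mono[OF less_imp_le[OF E(3)[OF z]]]) simp
    also have "\<dots> = ennreal (c\<^sup>2 * e / (c\<^sup>2 + 1))"
      using e' by (simp add: ennreal_mult[symmetric])
    also have "\<dots> < ennreal e"
    proof (rule ennreal_lessI[OF e])
      show "c\<^sup>2 * e / (c\<^sup>2 + 1) < e" using e c by (simp add: pos_divide_less_eq algebra_simps)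
    qed
    finally show "(\<integral>\<^sup>+x. ennreal ((elem_process (elem_scale c (E z)) (fst x) (snd x) - c * f (x, z))\<^sup>2) \<partial>Q) < ennreal e" .
  qed
qed

lemma approx_diff:
  assumes "approx Z f" "approx Z g"
    and "f \<in> borel_measurable (Q \<Otimes>\<^sub>M Z)" "g \<in> borel_measurable (Q \<Otimes>\<^sub>M Z)"
  shows "approx Z (\<lambda>y. f y - g y)"
proof -
  have "approx Z (\<lambda>y. f y + (-1) * g y)"
    using assms by (intro approx_add approx_cmult borel_measurable_times) auto
  then show ?thesis by simp
qed

text \<open>The convergence may fail to be uniform in z, so the index is chosen for each z as the
  first one with a small error. The errors are measurable in z by Tonelli, hence so is the index,
  and patching countably many families along it preserves joint measurability.\<close>

lemma approx_limit:
  assumes g: "\<And>n::nat. approx Z (g n)" and m: "\<And>n. g n \<in> borel_measurable (Q \<Otimes>\<^sub>M Z)" "f \<in> borel_measurable (Q \<Otimes>\<^sub>M Z)"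
    and lim: "\<And>z. z \<in> space Z \<Longrightarrow> (\<lambda>n. \<integral>\<^sup>+x. ennreal ((g n (x, z) - f (x, z))\<^sup>2) \<partial>Q) \<longlonglongrightarrow> 0"
  shows "approx Z f"
proof (rule approxI)
  fix e :: real assume e: "0 < e"
  then have e4: "0 < e / 4" by simp
  note [measurable] = m
  define D where "D n z = (\<integral>\<^sup>+x. ennreal ((g n (x, z) - f (x, z))\<^sup>2) \<partial>Q)" for n z
  have D_meas[measurable]: "D n \<in> borel_measurable Z" for n
    unfolding D_def by measurable
  define N where "N z = (LEAST n. D n z < ennreal (e / 4))" for z
  have N_meas[measurable]: "N \<in> measurable Z (count_space UNIV)"
    unfolding N_def by measurable
  have N: "D (N z) z < ennreal (e / 4)" if "z \<in> space Z" for z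
  proof -
    have "\<forall>\<^sub>F n in sequentially. D n z < ennreal (e / 4)"
      unfolding D_def using e4 by (intro order_tendstoD(2)[OF lim[OF that]]) simp
    then obtain n where "D n z < ennreal (e / 4)" by (auto simp: eventually_sequentially)
    then show ?thesis unfolding N_def by (rule LeastI)
  qed
  have "\<forall>n. \<exists>E. (\<forall>z\<in>space Z. elementary M F T (E z)) \<and> progressive_family Z (\<lambda>z. elem_integral S (E z)) \<and>
     (\<forall>z\<in>space Z. (\<integral>\<^sup>+x. ennreal ((elem_process (E z) (fst x) (snd x) - g n (x, z))\<^sup>2) \<partial>Q) < ennreal (e / 4))"
    using g e4 unfolding approx_def by simp
  from choice[OF this] obtain E where EE: "\<And>n. (\<forall>z\<in>space Z. elementary M F T (E n z)) \<and>
     progressive_family Z (\<lambda>z. elem_integral S (E n z)) \<and>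
     (\<forall>z\<in>space Z. (\<integral>\<^sup>+x. ennreal ((elem_process (E n z) (fst x) (snd x) - g n (x, z))\<^sup>2) \<partial>Q) < ennreal (e / 4))"
    by blast
  have E: "elementary M F T (E n z)"
    "(\<integral>\<^sup>+x. ennreal ((elem_process (E n z) (fst x) (snd x) - g n (x, z))\<^sup>2) \<partial>Q) < ennreal (e / 4)"
    if "z \<in> space Z" for n z
    using EE[of n] that by blast+
  have EP: "progressive_family Z (\<lambda>z. elem_integral S (E n z))" for n
    using EE[of n] by blast
  show "\<exists>E. (\<forall>z\<in>space Z. elementary M F T (E z)) \<and> progressive_family Z (\<lambda>z. elem_integral S (E z)) \<and>
     (\<forall>z\<in>space Z. (\<integral>\<^sup>+x. ennreal ((elem_process (E z) (fst x) (snd x) - f (x, z))\<^sup>2) \<partial>Q) < ennreal e)"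
  proof (intro exI[of _ "\<lambda>z. E (N z) z"] conjI ballI)
    show "elementary M F T (E (N z) z)" if "z \<in> space Z" for z by (rule E(1)[OF that])
    show "progressive_family Z (\<lambda>z. elem_integral S (E (N z) z))"
    proof (rule progressive_familyI)
      fix t assume t: "t \<in> {0..T}"
      have "(\<lambda>x. N (snd x)) \<in> measurable ((restrict_space borel {0..t} \<Otimes>\<^sub>M F t) \<Otimes>\<^sub>M Z) (count_space UNIV)"
        by measurable
      from measurable_compose_countable[OF progressive_familyD[OF EP t] this]
      show "(\<lambda>x. elem_integral S (E (N (snd x)) (snd x)) (fst (fst x)) (snd (fst x)))
          \<in> borel_measurable ((restrict_space borel {0..t} \<Otimes>\<^sub>M F t) \<Otimes>\<^sub>M Z)" .
    qed
    fix z assume z: "z \<in> space Z"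
    have "(\<integral>\<^sup>+x. ennreal ((elem_process (E (N z) z) (fst x) (snd x) - g (N z) (x, z) + (g (N z) (x, z) - f (x, z)))\<^sup>2) \<partial>Q) < ennreal e"
      using measurable_Q_elem_process[OF E(1)[OF z]] measurable_Q_section[OF m(1) z] measurable_Q_section[OF m(2) z]
        N[OF z] unfolding D_def
      by (intro nn_square_add_less e E(2) z borel_measurable_diff)
    then show "(\<integral>\<^sup>+x. ennreal ((elem_process (E (N z) z) (fst x) (snd x) - f (x, z))\<^sup>2) \<partial>Q) < ennreal e"
      by simp
  qed
qed

text \<open>Since \<open>g n\<close> stays below \<open>f\<close> in modulus, the squared error is
  dominated by four times the square of \<open>f\<close>.\<close>

lemma approx_dominated:
  assumes g: "\<And>n::nat. approx Z (g n)" and m: "\<And>n. g n \<in> borel_measurable (Q \<Otimes>\<^sub>M Z)" "f \<in> borel_measurable (Q \<Otimes>\<^sub>M Z)"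
    and lim: "\<And>x z. x \<in> space Q \<Longrightarrow> z \<in> space Z \<Longrightarrow> (\<lambda>n. g n (x, z)) \<longlonglongrightarrow> f (x, z)"
    and bd: "\<And>n x z. x \<in> space Q \<Longrightarrow> z \<in> space Z \<Longrightarrow> \<bar>g n (x, z)\<bar> \<le> \<bar>f (x, z)\<bar>"
    and fin: "\<And>z. z \<in> space Z \<Longrightarrow> (\<integral>\<^sup>+x. ennreal ((f (x, z))\<^sup>2) \<partial>Q) < \<infinity>"
  shows "approx Z f"
proof (rule approx_limit[OF g m])
  fix z assume z: "z \<in> space Z"
  note [measurable] = measurable_Q_section[OF m(1) z] measurable_Q_section[OF m(2) z]
  have "(\<lambda>n. \<integral>\<^sup>+x. ennreal ((g n (x, z) - f (x, z))\<^sup>2) \<partial>Q) \<longlonglongrightarrow> (\<integral>\<^sup>+x. 0 \<partial>Q)"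
  proof (rule nn_integral_dominated_convergence)
    show "AE x in Q. ennreal ((g n (x, z) - f (x, z))\<^sup>2) \<le> ennreal (4 * (f (x, z))\<^sup>2)" for n
    proof (intro AE_I2 ennreal_leI)
      fix x assume x: "x \<in> space Q"
      have "\<bar>g n (x, z) - f (x, z)\<bar> \<le> \<bar>2 * f (x, z)\<bar>" using bd[OF x z, of n] by linarith
      then show "(g n (x, z) - f (x, z))\<^sup>2 \<le> 4 * (f (x, z))\<^sup>2"
        by (simp add: abs_le_square_iff power_mult_distrib)
    qed
    show "(\<integral>\<^sup>+x. ennreal (4 * (f (x, z))\<^sup>2) \<partial>Q) < \<infinity>"
      using fin[OF z] by (simp add: ennreal_mult nn_integral_cmult ennreal_mult_less_top)
    show "AE x in Q. (\<lambda>n. ennreal ((g n (x, z) - f (x, z))\<^sup>2)) \<longlonglongrightarrow> 0"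
    proof (rule AE_I2)
      fix x assume "x \<in> space Q"
      have "(\<lambda>n. (g n (x, z) - f (x, z))\<^sup>2) \<longlonglongrightarrow> (f (x, z) - f (x, z))\<^sup>2"
        by (intro tendsto_intros lim z) fact
      from tendsto_ennrealI[OF this] show "(\<lambda>n. ennreal ((g n (x, z) - f (x, z))\<^sup>2)) \<longlonglongrightarrow> 0" by simp
    qed
  qed measurable
  then show "(\<lambda>n. \<integral>\<^sup>+x. ennreal ((g n (x, z) - f (x, z))\<^sup>2) \<partial>Q) \<longlonglongrightarrow> 0" by simp
qed

text \<open>Products of generators suffice because the rectangles over time 0 and over
  \<open>{0<..T}\<close> cover the predictable space by finitely many generators.\<close>

lemma sets_Q_pair:
  "sets (Q \<Otimes>\<^sub>M Z) = sigma_sets (space (Q \<Otimes>\<^sub>M Z)) {a \<times> C |a C. a \<in> predictable_gen \<and> C \<in> sets Z}"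
proof -
  let ?\<Omega> = "{0..T} \<times> space M"
  have "sets (Q \<Otimes>\<^sub>M Z) = sets (sigma (space Q \<times> space Z) {a \<times> C |a C. a \<in> predictable_gen \<and> C \<in> sets Z})"
  proof (rule sets_pair_eq)
    show "predictable_gen \<subseteq> Pow (space Q)" using predictable_gen_subset by simp
    show "sets Q = sigma_sets (space Q) predictable_gen" by (simp add: sets_predictable)
    show "countable {{0} \<times> space M, {0<..T} \<times> space M}" by simp
    show "{{0} \<times> space M, {0<..T} \<times> space M} \<subseteq> predictable_gen"
      using space_in_F[of 0] T_pos by fastforce
    show "\<Union> {{0} \<times> space M, {0<..T} \<times> space M} = space Q" using T_pos by auto
    show "sets Z = sigma_sets (space Z) (sets Z)" by (simp add: sets.sigma_sets_eq)
    show "sets Z \<subseteq> Pow (space Z)" by (rule sets.space_closed)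
    show "countable {space Z}" "{space Z} \<subseteq> sets Z" "\<Union>{space Z} = space Z" by simp_all
  qed
  also have "\<dots> = sigma_sets (space Q \<times> space Z) {a \<times> C |a C. a \<in> predictable_gen \<and> C \<in> sets Z}"
  proof (rule sets_measure_of)
    have "a \<times> C \<subseteq> space Q \<times> space Z" if "a \<in> predictable_gen" "C \<in> sets Z" for a C
      using subsetD[OF predictable_gen_subset that(1)] sets.sets_into_space[OF that(2)] by auto
    then show "{a \<times> C |a C. a \<in> predictable_gen \<and> C \<in> sets Z} \<subseteq> Pow (space Q \<times> space Z)" by blast
  qed
  finally show ?thesis by (simp add: space_pair_measure)
qed

lemma approx_rect:
  assumes a: "a \<in> predictable_gen" and C: "C \<in> sets Z"
  shows "approx Z (indicator (a \<times> C))"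
proof -
  consider D where "a = {0} \<times> D" "D \<in> sets (F 0)"
    | s t D where "a = {s<..t} \<times> D" "0 \<le> s" "s < t" "t \<le> T" "D \<in> sets (F s)" using a by blast
  then show ?thesis
  proof cases
    case 1
    \<comment> \<open>Time 0 carries no mass, so the empty list approximates the indicator without
      error.\<close>
    have aP: "a \<in> sets Q" unfolding 1 using predictable_zero_rect[OF 1(2)] by simp
    have "emeasure Q a = (\<integral>\<^sup>+\<omega>. 0 \<partial>M)"
      unfolding 1 emeasure_Q[OF predictable_zero_rect[OF 1(2)]]
      by (intro nn_integral_cong) (simp add: emeasure_section_zero[OF _ 1(2)])
    then have a0: "emeasure Q a = 0" by simp
    have "(\<integral>\<^sup>+x. ennreal ((0 - indicator (a \<times> C) (x, z))\<^sup>2) \<partial>Q) \<le> (\<integral>\<^sup>+x. indicator a x \<partial>Q)" for z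
      by (intro nn_integral_mono) (auto simp: indicator_def)
    then have 0: "(\<integral>\<^sup>+x. ennreal ((0 - indicator (a \<times> C) (x, z))\<^sup>2) \<partial>Q) = 0" for z
      using a0 aP by simp
    show ?thesis
      by (rule approxI) (intro exI[of _ "\<lambda>_. []"], simp only: elem_process_Nil 0,
        simp add: progressive_family_def case_prod_beta')
  next
    case 2
    have s: "s \<in> {0..T}" using 2 by auto
    \<comment> \<open>An elementary integrand equal to the indicator, switched off for parameters
      outside \<open>C\<close>; here the list itself depends on z.\<close>
    define E where "E z = (if z \<in> C then [(s, t, indicator D :: 'a \<Rightarrow> real)] else [])" for z
    have el: "elementary M F T [(s, t, indicator D :: 'a \<Rightarrow> real)]"
      using 2 by (auto simp: elementary_def indicator_def intro!: exI[of _ 1])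
    have prog: "progressive_family Z (\<lambda>z. elem_integral S (E z))"
    proof (rule progressive_familyI)
      fix r assume r: "r \<in> {0..T}"
      note I = sq_martingale_elem_integral[OF S el]
      have "(\<lambda>(r, \<omega>). elem_integral S [(s, t, indicator D)] r \<omega>) \<in> borel_measurable (restrict_space borel {0..r} \<Otimes>\<^sub>M F r)"
        by (rule adapted_cadlag_progressive[OF sq_martingale_meas[OF I] sq_martingale_cadlag[OF I] r])
      then have "(\<lambda>y. elem_integral S [(s, t, indicator D)] (fst y) (snd y)) \<in> borel_measurable (restrict_space borel {0..r} \<Otimes>\<^sub>M F r)"
        by (simp add: case_prod_beta')
      from measurable_compose[OF measurable_fst this]
      have [measurable]: "(\<lambda>x. elem_integral S [(s, t, indicator D)] (fst (fst x)) (snd (fst x)))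
          \<in> borel_measurable ((restrict_space borel {0..r} \<Otimes>\<^sub>M F r) \<Otimes>\<^sub>M Z)" .
      have [measurable]: "C \<in> sets Z" by fact
      have "(\<lambda>x. elem_integral S [(s, t, indicator D)] (fst (fst x)) (snd (fst x)) * indicator C (snd x))
          \<in> borel_measurable ((restrict_space borel {0..r} \<Otimes>\<^sub>M F r) \<Otimes>\<^sub>M Z)"
        by measurable
      moreover have "elem_integral S (E z) r' \<omega> = elem_integral S [(s, t, indicator D)] r' \<omega> * indicator C z" for z r' \<omega>
        by (simp add: E_def indicator_def)
      ultimately show "(\<lambda>x. elem_integral S (E (snd x)) (fst (fst x)) (snd (fst x)))
          \<in> borel_measurable ((restrict_space borel {0..r} \<Otimes>\<^sub>M F r) \<Otimes>\<^sub>M Z)" by simp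
    qed
    have "elem_process (E z) (fst x) (snd x) - indicator (a \<times> C) (x, z) = 0" for x z
      by (auto simp: E_def elem_process_def 2(1) indicator_def mem_Times_iff)
    then have 0: "(\<integral>\<^sup>+x. ennreal ((elem_process (E z) (fst x) (snd x) - indicator (a \<times> C) (x, z))\<^sup>2) \<partial>Q) = 0" for z
      by simp
    show ?thesis
      using el prog by (intro approxI exI[of _ E]) (simp only: 0, simp add: E_def)
  qed
qed

lemma approx_sum:
  assumes "\<And>i. i < (n::nat) \<Longrightarrow> approx Z (f i)" "\<And>i. i < n \<Longrightarrow> f i \<in> borel_measurable (Q \<Otimes>\<^sub>M Z)"
  shows "approx Z (\<lambda>y. \<Sum>i<n. f i y)"
  using assms
proof (induction n)
  case 0
  then show ?case by (simp add: approx_zero)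
next
  case (Suc n)
  have "approx Z (\<lambda>y. (\<Sum>i<n. f i y) + f n y)"
    using Suc by (intro approx_add borel_measurable_sum) auto
  then show ?case by simp
qed

text \<open>Dynkin's theorem over the rectangles: differences settle complements, and the finite
  unions of a disjoint sequence converge under domination because \<open>Q\<close> is
  finite.\<close>

lemma approx_indicator:
  assumes "B \<in> sets (Q \<Otimes>\<^sub>M Z)"
  shows "approx Z (indicator B)"
proof -
  define PG where "PG = predictable_gen"
  have PG_subset: "PG \<subseteq> Pow ({0..T} \<times> space M)" and PG_stable: "Int_stable PG"
    unfolding PG_def by (rule predictable_gen_subset, rule Int_stable_predictable_gen)
  have PG_rect: "approx Z (indicator (a \<times> C))" if "a \<in> PG" "C \<in> sets Z" for a C
    using that unfolding PG_def by (rule approx_rect)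
  have sets_pair: "sets (Q \<Otimes>\<^sub>M Z) = sigma_sets (space (Q \<Otimes>\<^sub>M Z)) {a \<times> C |a C. a \<in> PG \<and> C \<in> sets Z}"
    unfolding PG_def by (rule sets_Q_pair)
  have r: "{0<..T} \<times> space M \<in> PG" "{0} \<times> space M \<in> PG"
    unfolding PG_def using space_in_F[of 0] T_pos by fastforce+
  let ?G = "{a \<times> C |a C. a \<in> PG \<and> C \<in> sets Z}"
  have G: "?G \<subseteq> Pow (space (Q \<Otimes>\<^sub>M Z))"
  proof -
    have "a \<times> C \<subseteq> space (Q \<Otimes>\<^sub>M Z)" if "a \<in> PG" "C \<in> sets Z" for a C
      using subsetD[OF PG_subset that(1)] sets.sets_into_space[OF that(2)] by (auto simp: space_pair_measure)
    then show ?thesis by blast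
  qed
  have st: "Int_stable ?G"
  proof (rule Int_stableI)
    fix x y assume "x \<in> ?G" "y \<in> ?G"
    then obtain a C a' C' where xy: "x = a \<times> C" "y = a' \<times> C'" "C \<in> sets Z" "C' \<in> sets Z"
      and a: "a \<in> PG" "a' \<in> PG" by blast
    have "a \<inter> a' \<in> PG" using PG_stable a unfolding Int_stable_def by blast
    moreover have "x \<inter> y = (a \<inter> a') \<times> (C \<inter> C')" "C \<inter> C' \<in> sets Z" using xy by auto
    ultimately show "x \<inter> y \<in> ?G" by blast
  qed
  have meas: "(indicator B :: _ \<Rightarrow> real) \<in> borel_measurable (Q \<Otimes>\<^sub>M Z)"
    if "B \<in> sigma_sets (space (Q \<Otimes>\<^sub>M Z)) ?G" for B
    using that by (simp add: sets_pair[symmetric])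
  have "B \<in> sigma_sets (space (Q \<Otimes>\<^sub>M Z)) ?G" using assms unfolding sets_pair .
  from st G this show ?thesis
  proof (induction B rule: sigma_sets_induct_disjoint)
    case (basic B)
    then obtain a C where "B = a \<times> C" "a \<in> PG" "C \<in> sets Z" by blast
    then show ?case using PG_rect by simp
  next
    case empty
    have "approx Z (indicator {})" by (rule approx_cong[OF approx_zero]) simp
    then show ?case .
  next
    case (compl B)
    have m: "(indicator (a \<times> space Z) :: _ \<Rightarrow> real) \<in> borel_measurable (Q \<Otimes>\<^sub>M Z)" if "a \<in> PG" for a
    proof (rule meas, rule sigma_sets.Basic)
      show "a \<times> space Z \<in> ?G" using that sets.top[of Z] by blast
    qed
    \<comment> \<open>The whole space is the disjoint union of two rectangles, one over
      \<open>{0<..T}\<close> and one over time 0.\<close>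
    have "approx Z (\<lambda>y. indicator (({0<..T} \<times> space M) \<times> space Z) y + indicator (({0} \<times> space M) \<times> space Z) y - indicator B y)"
      using meas[OF compl(1)] m[OF r(1)] m[OF r(2)]
      by (intro approx_diff approx_add PG_rect r sets.top compl(2) borel_measurable_add)
    then show ?case
      by (rule approx_cong) (use T_pos in \<open>auto simp: indicator_def space_pair_measure\<close>)
  next
    case (union B)
    have Bi: "B i \<in> sigma_sets (space (Q \<Otimes>\<^sub>M Z)) ?G" for i using union(2) by blast
    have Bi': "B i \<in> sets (Q \<Otimes>\<^sub>M Z)" for i using Bi[of i] unfolding sets_pair .
    have UN: "(\<Union>i<n. B i) \<in> sets (Q \<Otimes>\<^sub>M Z)" for n :: nat
      by (intro sets.finite_UN Bi') simp
    have U: "(\<Union>i. B i) \<in> sets (Q \<Otimes>\<^sub>M Z)" by (intro sets.countable_UN) (use Bi' in blast)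
    show ?case
    proof (rule approx_dominated[where g = "\<lambda>n. indicator (\<Union>i<n. B i)"])
      fix n :: nat
      have "approx Z (\<lambda>y. \<Sum>i<n. indicator (B i) y)"
        by (intro approx_sum union(3) meas Bi)
      then show "approx Z (indicator (\<Union>i<n. B i))"
      proof (rule approx_cong)
        have "disjoint_family_on B {..<n}" using union(1) by (auto simp: disjoint_family_on_def)
        then show "(\<Sum>i<n. indicator (B i) (x, z)) = (indicator (\<Union>i<n. B i) (x, z) :: real)" for x z
          by (rule indicator_UN_disjoint[OF finite_lessThan, symmetric])
      qed
      show "(indicator (\<Union>i<n. B i) :: _ \<Rightarrow> real) \<in> borel_measurable (Q \<Otimes>\<^sub>M Z)" using UN[of n] by simp
    next
      show "(indicator (\<Union>i. B i) :: _ \<Rightarrow> real) \<in> borel_measurable (Q \<Otimes>\<^sub>M Z)" using U by simp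
      show "(\<lambda>n. indicator (\<Union>i<n. B i) (x, z) :: real) \<longlonglongrightarrow> indicator (\<Union>i. B i) (x, z)" for x z
        by (rule LIMSEQ_indicator_UN)
      show "\<bar>indicator (\<Union>i<n. B i) (x, z) :: real\<bar> \<le> \<bar>indicator (\<Union>i. B i) (x, z)\<bar>" for n x z
        by (auto simp: indicator_def)
      show "(\<integral>\<^sup>+x. ennreal ((indicator (\<Union>i. B i) (x, z))\<^sup>2) \<partial>Q) < \<infinity>" for z
      proof -
        have "(\<integral>\<^sup>+x. ennreal ((indicator (\<Union>i. B i) (x, z))\<^sup>2) \<partial>Q) \<le> (\<integral>\<^sup>+x. 1 \<partial>Q)"
          by (intro nn_integral_mono) (auto simp: indicator_def)
        also have "\<dots> < \<infinity>" using Q.finite_emeasure_space by (simp add: less_top[symmetric])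
        finally show ?thesis .
      qed
    qed
  qed
qed

text \<open>The finiteness condition stands inside the claim: the induction passes to other
  functions, whose finiteness must be derived anew from that of the compound function.\<close>

lemma approx_nonneg:
  assumes "f \<in> borel_measurable (Q \<Otimes>\<^sub>M Z)" "\<And>y. 0 \<le> f y"
  shows "(\<forall>z\<in>space Z. (\<integral>\<^sup>+x. ennreal ((f (x, z))\<^sup>2) \<partial>Q) < \<infinity>) \<longrightarrow> approx Z f"
  using assms
proof (induction f rule: borel_measurable_induct_real)
  case (set B)
  then show ?case by (intro impI approx_indicator)
next
  case (mult u c)
  show ?case
  proof (intro impI)
    assume fin: "\<forall>z\<in>space Z. (\<integral>\<^sup>+x. ennreal ((c * u (x, z))\<^sup>2) \<partial>Q) < \<infinity>"
    show "approx Z (\<lambda>x. c * u x)"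
    \<comment> \<open>For \<open>c = 0\<close> finiteness of the product says nothing about
      \<open>u\<close>, but then the product is zero.\<close>
    proof (cases "c = 0")
      case True
      then show ?thesis by (simp add: approx_zero)
    next
      case False
      have "(\<integral>\<^sup>+x. ennreal ((u (x, z))\<^sup>2) \<partial>Q) < \<infinity>" if z: "z \<in> space Z" for z
      proof -
        have [measurable]: "(\<lambda>x. u (x, z)) \<in> borel_measurable Q" by (rule measurable_Q_section[OF mult(2) z])
        have "(\<integral>\<^sup>+x. ennreal ((u (x, z))\<^sup>2) \<partial>Q) = (\<integral>\<^sup>+x. ennreal (1 / c\<^sup>2) * ennreal ((c * u (x, z))\<^sup>2) \<partial>Q)"
          using False by (intro nn_integral_cong) (simp add: ennreal_mult[symmetric] power_mult_distrib)
        also have "\<dots> = ennreal (1 / c\<^sup>2) * (\<integral>\<^sup>+x. ennreal ((c * u (x, z))\<^sup>2) \<partial>Q)"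
          by (rule nn_integral_cmult) measurable
        also have "\<dots> < \<infinity>" using fin z by (simp add: ennreal_mult_less_top)
        finally show ?thesis .
      qed
      with mult(4) show ?thesis by (intro approx_cmult mult(2)) auto
    qed
  qed
next
  case (add u v)
  show ?case
  proof (intro impI)
    assume fin: "\<forall>z\<in>space Z. (\<integral>\<^sup>+x. ennreal ((v (x, z) + u (x, z))\<^sup>2) \<partial>Q) < \<infinity>"
    have fin_le: "(\<integral>\<^sup>+x. ennreal ((w (x, z))\<^sup>2) \<partial>Q) < \<infinity>"
      if z: "z \<in> space Z" and w: "\<And>y. 0 \<le> w y" "\<And>y. w y \<le> v y + u y" for w z
    proof -
      have "(\<integral>\<^sup>+x. ennreal ((w (x, z))\<^sup>2) \<partial>Q) \<le> (\<integral>\<^sup>+x. ennreal ((v (x, z) + u (x, z))\<^sup>2) \<partial>Q)"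
        by (intro nn_integral_mono ennreal_leI power_mono w)
      also have "\<dots> < \<infinity>" using fin z by blast
      finally show ?thesis .
    qed
    have u: "approx Z u"
      by (rule mp[OF add.IH(1)], rule ballI, rule fin_le[of _ u]) (use add.hyps(2,4) in auto)
    have v: "approx Z v"
      by (rule mp[OF add.IH(2)], rule ballI, rule fin_le[of _ v]) (use add.hyps(2,4) in auto)
    show "approx Z (\<lambda>x. v x + u x)"
      by (rule approx_add[OF v u add.hyps(3,1)])
  qed
next
  case (seq U)
  show ?case
  proof (intro impI)
    assume fin: "\<forall>z\<in>space Z. (\<integral>\<^sup>+x. ennreal ((f (x, z))\<^sup>2) \<partial>Q) < \<infinity>"
    have le: "U i (x, z) \<le> f (x, z)" if "x \<in> space Q" "z \<in> space Z" for i x z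
    proof (rule incseq_le)
      show "incseq (\<lambda>i. U i (x, z))" using seq.hyps(3) unfolding incseq_def le_fun_def by blast
      show "(\<lambda>i. U i (x, z)) \<longlonglongrightarrow> f (x, z)" using seq.hyps(4)[of "(x, z)"] that by (simp add: space_pair_measure)
    qed
    show "approx Z f"
    proof (rule approx_dominated[of Z U])
      fix n
      have "(\<integral>\<^sup>+x. ennreal ((U n (x, z))\<^sup>2) \<partial>Q) < \<infinity>" if z: "z \<in> space Z" for z
      proof -
        have "(\<integral>\<^sup>+x. ennreal ((U n (x, z))\<^sup>2) \<partial>Q) \<le> (\<integral>\<^sup>+x. ennreal ((f (x, z))\<^sup>2) \<partial>Q)"
          using le z seq.hyps(2) by (intro nn_integral_mono ennreal_leI power_mono) auto
        also have "\<dots> < \<infinity>" using fin z by blast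
        finally show ?thesis .
      qed
      then show "approx Z (U n)" using seq.IH by blast
      show "U n \<in> borel_measurable (Q \<Otimes>\<^sub>M Z)" by (rule seq.hyps(1))
      show "\<bar>U n (x, z)\<bar> \<le> \<bar>f (x, z)\<bar>" if "x \<in> space Q" "z \<in> space Z" for x z
        using le[OF that, of n] seq.hyps(2)[of n "(x, z)"] by linarith
    next
      show "(\<lambda>i. U i (x, z)) \<longlonglongrightarrow> f (x, z)" if "x \<in> space Q" "z \<in> space Z" for x z
        using seq.hyps(4)[of "(x, z)"] that by (simp add: space_pair_measure)
      show "f \<in> borel_measurable (Q \<Otimes>\<^sub>M Z)" by fact
      show "(\<integral>\<^sup>+x. ennreal ((f (x, z))\<^sup>2) \<partial>Q) < \<infinity>" if "z \<in> space Z" for z using fin that by blast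
    qed
  qed
qed

text \<open>Positive and negative part are both dominated by the modulus of \<open>f\<close>, so the
  nonnegative case applies to each.\<close>

lemma approx_measurable:
  assumes f[measurable]: "f \<in> borel_measurable (Q \<Otimes>\<^sub>M Z)"
    and fin: "\<And>z. z \<in> space Z \<Longrightarrow> (\<integral>\<^sup>+x. ennreal ((f (x, z))\<^sup>2) \<partial>Q) < \<infinity>"
  shows "approx Z f"
proof -
  have part: "approx Z g" if g: "g \<in> borel_measurable (Q \<Otimes>\<^sub>M Z)" "\<And>y. 0 \<le> g y" "\<And>y. g y \<le> \<bar>f y\<bar>" for g
  proof -
    have "(\<integral>\<^sup>+x. ennreal ((g (x, z))\<^sup>2) \<partial>Q) < \<infinity>" if "z \<in> space Z" for z
    proof -
      have "(g (x, z))\<^sup>2 \<le> (f (x, z))\<^sup>2" for x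
        using power_mono[OF g(3) g(2), of "(x, z)" 2] by simp
      then have "(\<integral>\<^sup>+x. ennreal ((g (x, z))\<^sup>2) \<partial>Q) \<le> (\<integral>\<^sup>+x. ennreal ((f (x, z))\<^sup>2) \<partial>Q)"
        by (intro nn_integral_mono ennreal_leI)
      also have "\<dots> < \<infinity>" by (rule fin[OF that])
      finally show ?thesis .
    qed
    with approx_nonneg[OF g(1,2)] show ?thesis by blast
  qed
  have "approx Z (\<lambda>y. max 0 (f y) - max 0 (- f y))"
    by (intro approx_diff part) auto
  then show ?thesis by (rule approx_cong) auto
qed

end

section \<open>Fast convergence, density, and jointly measurable versions of integrals\<close>

context filtered_basis
begin

text \<open>Doob's inequality at level \<open>(1/2) ^ k\<close> bounds the probability of exceedance
  by \<open>(1/8) ^ k / (1/4) ^ k = (1/2) ^ k\<close>, which is summable. Borel-Cantelli then leaves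
  finitely many exceedances on almost every path, for all times at once.\<close>

lemma sq_martingale_fast_limit:
  assumes U: "\<And>k::nat. sq_martingale M F T (U k)"
    and small: "\<And>k. (\<integral>\<omega>. (U k T \<omega>)\<^sup>2 \<partial>M) \<le> (1/8) ^ k"
  shows "AE \<omega> in M. \<forall>t\<in>{0..T}. (\<lambda>k. U k t \<omega>) \<longlonglongrightarrow> 0"
proof -
  define B where "B k = {\<omega> \<in> space M. \<exists>t\<in>{0..T}. (1/2) ^ k < \<bar>U k t \<omega>\<bar>}" for k
  have B: "B k \<in> sets M" for k
    unfolding B_def by (rule Doob_maximal(1)[OF U]) simp
  have meas: "measure M (B k) \<le> (1/2) ^ k" for k
  proof -
    have "measure M (B k) * ((1/2) ^ k)\<^sup>2 \<le> (1/8) ^ k"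
      using Doob_maximal(2)[OF U, of "(1/2) ^ k" k] small[of k] unfolding B_def by simp
    also have "(1/8 :: real) ^ k = (1/2) ^ k * ((1/2) ^ k)\<^sup>2"
      by (simp add: power_mult_distrib[symmetric] power2_eq_square)
    finally show ?thesis by simp
  qed
  have "summable (\<lambda>k. measure M (B k))"
    by (rule summable_comparison_test'[of "\<lambda>k. (1/2) ^ k" 0]) (use meas in auto)
  then have "AE \<omega> in M. \<forall>\<^sub>F k in sequentially. \<omega> \<in> space M - B k"
    by (intro borel_cantelli_AE1 B) (auto simp: less_top[symmetric])
  then show ?thesis
  proof eventually_elim
    case (elim \<omega>)
    show ?case
    proof
      fix t assume t: "t \<in> {0..T}"
      from elim have "\<forall>\<^sub>F k in sequentially. norm (U k t \<omega>) \<le> (1/2) ^ k"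
        by eventually_elim (use t in \<open>auto simp: B_def not_less\<close>)
      moreover have "(\<lambda>k. (1/2 :: real) ^ k) \<longlonglongrightarrow> 0" by (rule LIMSEQ_realpow_zero) auto
      ultimately show "(\<lambda>k. U k t \<omega>) \<longlonglongrightarrow> 0" by (rule Lim_null_comparison)
    qed
  qed
qed

end

context integrator
begin

text \<open>Parametric approximation over a one-point space yields elementary approximants of
  \<open>f\<close> itself. Being orthogonal to all of them, \<open>f\<close> is orthogonal to
  itself.\<close>

lemma elementary_dense:
  assumes f: "square_integrable Q f"
    and orth: "\<And>E. elementary M F T E \<Longrightarrow> (\<integral>x. elem_process E (fst x) (snd x) * f x \<partial>Q) = 0"
  shows "AE x in Q. f x = 0"
proof -
  let ?Z = "count_space {()}"
  have fm: "f \<in> borel_measurable Q" by (rule square_integrableD(1)[OF f])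
  have "approx ?Z (\<lambda>y. f (fst y))"
  proof (rule approx_measurable)
    show "(\<lambda>y. f (fst y)) \<in> borel_measurable (Q \<Otimes>\<^sub>M ?Z)"
      by (rule measurable_compose[OF measurable_fst fm])
    show "(\<integral>\<^sup>+x. ennreal ((f (fst (x, z)))\<^sup>2) \<partial>Q) < \<infinity>" for z
      using nn_integral_square[OF f] by simp
  qed
  then have "\<exists>E. elementary M F T E \<and> (\<integral>\<^sup>+x. ennreal ((elem_process E (fst x) (snd x) - f x)\<^sup>2) \<partial>Q) < ennreal e"
    if "0 < e" for e using that unfolding approx_def by auto
  then have "\<forall>k::nat. \<exists>E. elementary M F T E \<and>
      (\<integral>\<^sup>+x. ennreal ((elem_process E (fst x) (snd x) - f x)\<^sup>2) \<partial>Q) < ennreal (1 / real (Suc k))" by simp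
  from choice[OF this] obtain E where E: "\<And>k. elementary M F T (E k)"
    "\<And>k. (\<integral>\<^sup>+x. ennreal ((elem_process (E k) (fst x) (snd x) - f x)\<^sup>2) \<partial>Q) < ennreal (1 / real (Suc k))" by blast
  note sqE = sqi_elem_process[OF E(1)]
  have le: "(\<integral>x. (elem_process (E k) (fst x) (snd x) - f x)\<^sup>2 \<partial>Q) \<le> 1 / real (Suc k)" for k
    using E(2)[of k] unfolding nn_integral_square[OF square_integrable_diff[OF sqE f]]
    by (simp add: ennreal_less_iff)
  have "(\<lambda>k. \<integral>x. (elem_process (E k) (fst x) (snd x) - f x)\<^sup>2 \<partial>Q) \<longlonglongrightarrow> 0"
  proof (rule tendsto_sandwich[of "\<lambda>_. 0"])
    show "(\<lambda>k. 1 / real (Suc k)) \<longlonglongrightarrow> 0"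
      using LIMSEQ_inverse_real_of_nat by (simp add: inverse_eq_divide)
  qed (use le in auto)
  from L2_tendsto_inner[OF sqE f f this] have "(\<integral>x. f x * f x \<partial>Q) = 0"
    using orth[OF E(1)] by (simp add: LIMSEQ_const_iff)
  then have "(\<integral>x. (f x)\<^sup>2 \<partial>Q) = 0" by (simp add: power2_eq_square)
  then show ?thesis by (subst (asm) integral_square_eq_0_iff[OF f])
qed

text \<open>The tolerance \<open>(1/8) ^ k\<close> is the same for all z, so one sequence of
  families serves every z and the limit can be taken before any null set is discarded.\<close>

lemma stoch_integral_progressive_version:
  assumes f: "f \<in> borel_measurable (Q \<Otimes>\<^sub>M Z)"
    and I: "\<And>z. z \<in> space Z \<Longrightarrow> stoch_integral M F T S A (\<lambda>t \<omega>. f ((t, \<omega>), z)) (I z)"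
  shows "\<exists>Y. progressive_family Z Y \<and> (\<forall>z\<in>space Z. indist M T (I z) (Y z))"
proof -
  have sqf: "square_integrable Q (\<lambda>x. f (x, z))" if "z \<in> space Z" for z
    using ito_sqi(1)[OF stoch_integral_ito[OF I[OF that]]] by simp
  have ap: "approx Z f"
  proof (rule approx_measurable[OF f])
    show "(\<integral>\<^sup>+x. ennreal ((f (x, z))\<^sup>2) \<partial>Q) < \<infinity>" if "z \<in> space Z" for z
      using nn_integral_square[OF sqf[OF that]] by simp
  qed
  have "\<forall>k::nat. \<exists>E. (\<forall>z\<in>space Z. elementary M F T (E z)) \<and> progressive_family Z (\<lambda>z. elem_integral S (E z)) \<and>
     (\<forall>z\<in>space Z. (\<integral>\<^sup>+x. ennreal ((elem_process (E z) (fst x) (snd x) - f (x, z))\<^sup>2) \<partial>Q) < ennreal ((1/8) ^ k))"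
    using ap unfolding approx_def by simp
  from choice[OF this] obtain E where EE: "\<And>k. (\<forall>z\<in>space Z. elementary M F T (E k z)) \<and>
     progressive_family Z (\<lambda>z. elem_integral S (E k z)) \<and>
     (\<forall>z\<in>space Z. (\<integral>\<^sup>+x. ennreal ((elem_process (E k z) (fst x) (snd x) - f (x, z))\<^sup>2) \<partial>Q) < ennreal ((1/8) ^ k))"
    by blast
  \<comment> \<open>\<open>lim\<close> has a fixed default value where the sequence diverges, so
    \<open>Y\<close> is jointly measurable everywhere; it has to equal \<open>I z\<close> only off a
    null set that may depend on z.\<close>
  define Y where "Y z t \<omega> = lim (\<lambda>k. elem_integral S (E k z) t \<omega>)" for z t \<omega>
  have "progressive_family Z Y"
  proof (rule progressive_familyI)
    fix t assume t: "t \<in> {0..T}"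
    have "(\<lambda>x. elem_integral S (E k (snd x)) (fst (fst x)) (snd (fst x)))
        \<in> borel_measurable ((restrict_space borel {0..t} \<Otimes>\<^sub>M F t) \<Otimes>\<^sub>M Z)" for k
      using progressive_familyD[OF _ t, of Z "\<lambda>z. elem_integral S (E k z)"] EE[of k] by blast
    then show "(\<lambda>x. Y (snd x) (fst (fst x)) (snd (fst x))) \<in> borel_measurable ((restrict_space borel {0..t} \<Otimes>\<^sub>M F t) \<Otimes>\<^sub>M Z)"
      unfolding Y_def by (rule borel_measurable_lim_metric)
  qed
  moreover have "indist M T (I z) (Y z)" if z: "z \<in> space Z" for z
  proof -
    have El: "elementary M F T (E k z)" for k using EE[of k] z by blast
    have Im: "sq_martingale M F T (I z)" using I[OF z] by (simp add: stoch_integral_def)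
    define U where "U k t \<omega> = elem_integral S (E k z) t \<omega> - I z t \<omega>" for k t \<omega>
    have "AE \<omega> in M. \<forall>t\<in>{0..T}. (\<lambda>k. U k t \<omega>) \<longlonglongrightarrow> 0"
    proof (rule sq_martingale_fast_limit)
      show "sq_martingale M F T (U k)" for k
        unfolding U_def[abs_def] by (rule sq_martingale_diff[OF sq_martingale_elem_integral[OF S El] Im])
      fix k
      note d = ito_diff[OF ito_elem[OF El[of k]] stoch_integral_ito[OF I[OF z]]]
      have "(\<integral>\<^sup>+x. ennreal ((elem_process (E k z) (fst x) (snd x) - f (x, z))\<^sup>2) \<partial>Q) < ennreal ((1/8) ^ k)"
        using EE[of k] z by blast
      then have "(\<integral>x. (elem_process (E k z) (fst x) (snd x) - f ((fst x, snd x), z))\<^sup>2 \<partial>Q) < (1/8) ^ k"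
        using nn_integral_square[OF ito_sqi(1)[OF d]] by (simp add: ennreal_less_iff)
      then show "(\<integral>\<omega>. (U k T \<omega>)\<^sup>2 \<partial>M) \<le> (1/8) ^ k"
        unfolding U_def ito_isometry[OF d] by simp
    qed
    then show ?thesis
      unfolding indist_def
    proof eventually_elim
      case (elim \<omega>)
      show ?case
      proof
        fix t assume t: "t \<in> {0..T}"
        have "(\<lambda>k. U k t \<omega> + I z t \<omega>) \<longlonglongrightarrow> 0 + I z t \<omega>"
          using elim t by (intro tendsto_intros) blast
        then have "(\<lambda>k. elem_integral S (E k z) t \<omega>) \<longlonglongrightarrow> I z t \<omega>" by (simp add: U_def)
        then show "I z t \<omega> = Y z t \<omega>" unfolding Y_def by (rule limI[symmetric])
      qed
    qed
  qed
  ultimately show ?thesis by blast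
qed

end

section \<open>Mixtures over the strip\<close>

lemma complex_inner_integral:
  fixes f :: "'a \<Rightarrow> complex"
  assumes Z: "square_integrable N Z"
    and f: "square_integrable N (\<lambda>x. Re (f x))" "square_integrable N (\<lambda>x. Im (f x))"
  shows "integrable N (\<lambda>x. complex_of_real (Z x) * f x)"
    and "(\<integral>x. complex_of_real (Z x) * f x \<partial>N) = Complex (\<integral>x. Z x * Re (f x) \<partial>N) (\<integral>x. Z x * Im (f x) \<partial>N)"
proof -
  have eq: "complex_of_real (Z x) * f x = complex_of_real (Z x * Re (f x)) + \<i> * complex_of_real (Z x * Im (f x))" for x
    by (simp add: complex_eq_iff)
  note i = square_integrable_mult[OF Z f(1)] square_integrable_mult[OF Z f(2)]
  show "integrable N (\<lambda>x. complex_of_real (Z x) * f x)"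
    unfolding eq using i by (intro Bochner_Integration.integrable_add integrable_mult_right integrable_of_real)
  show "(\<integral>x. complex_of_real (Z x) * f x \<partial>N) = Complex (\<integral>x. Z x * Re (f x) \<partial>N) (\<integral>x. Z x * Im (f x) \<partial>N)"
    unfolding eq using i
    by (subst Bochner_Integration.integral_add)
      (auto intro!: integrable_mult_right integrable_of_real simp: complex_eq_iff simp del: of_real_mult)
qed

lemma nn_integral_cmod_square:
  fixes f :: "'a \<Rightarrow> complex"
  assumes f: "square_integrable N (\<lambda>x. Re (f x))" "square_integrable N (\<lambda>x. Im (f x))"
  shows "(\<integral>\<^sup>+x. ennreal ((norm (f x))\<^sup>2) \<partial>N) = ennreal ((\<integral>x. (Re (f x))\<^sup>2 \<partial>N) + (\<integral>x. (Im (f x))\<^sup>2 \<partial>N))"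
proof -
  have "(\<integral>\<^sup>+x. ennreal ((norm (f x))\<^sup>2) \<partial>N) = (\<integral>\<^sup>+x. ennreal ((Re (f x))\<^sup>2) + ennreal ((Im (f x))\<^sup>2) \<partial>N)"
    by (simp add: cmod_power2)
  also have "\<dots> = (\<integral>\<^sup>+x. ennreal ((Re (f x))\<^sup>2) \<partial>N) + (\<integral>\<^sup>+x. ennreal ((Im (f x))\<^sup>2) \<partial>N)"
    using f by (intro nn_integral_add) (auto simp: square_integrable_def)
  finally show ?thesis by (simp add: nn_integral_square[OF f(1)] nn_integral_square[OF f(2)])
qed

lemma square_integrable_Re_Im:
  fixes f :: "'a \<Rightarrow> complex"
  assumes f[measurable]: "f \<in> borel_measurable N" and fin: "(\<integral>\<^sup>+x. ennreal ((norm (f x))\<^sup>2) \<partial>N) < \<infinity>"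
  shows "square_integrable N (\<lambda>x. Re (f x))" "square_integrable N (\<lambda>x. Im (f x))"
proof -
  have n: "square_integrable N (\<lambda>x. norm (f x))"
    using fin by (subst square_integrable_iff_nn_integral) auto
  show "square_integrable N (\<lambda>x. Re (f x))" "square_integrable N (\<lambda>x. Im (f x))"
    by (rule square_integrable_bound[OF n]; simp add: abs_Re_le_cmod abs_Im_le_cmod)+
qed

context filtered_basis
begin

lemma sq_martingale_cD:
  assumes "sq_martingale_c M F T U"
  shows "sq_martingale M F T (\<lambda>t \<omega>. Re (U t \<omega>))" "sq_martingale M F T (\<lambda>t \<omega>. Im (U t \<omega>))"
  using assms by (simp_all add: sq_martingale_c_def)

lemma sq_martingale_c_sqi:
  assumes "sq_martingale_c M F T U" "t \<in> {0..T}"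
  shows "square_integrable M (\<lambda>\<omega>. Re (U t \<omega>))" "square_integrable M (\<lambda>\<omega>. Im (U t \<omega>))"
  using sq_martingale_sqi[OF sq_martingale_cD(1)[OF assms(1)] assms(2)]
    sq_martingale_sqi[OF sq_martingale_cD(2)[OF assms(1)] assms(2)] by simp_all

lemma sq_martingale_norm_le:
  assumes U: "sq_martingale M F T U" and t: "t \<in> {0..T}"
  shows "(\<integral>\<omega>. (U t \<omega>)\<^sup>2 \<partial>M) \<le> (\<integral>\<omega>. (U T \<omega>)\<^sup>2 \<partial>M)"
proof -
  have "(\<integral>\<omega>. indicator (space M) \<omega> * (U t \<omega>)\<^sup>2 \<partial>M) \<le> (\<integral>\<omega>. indicator (space M) \<omega> * (U T \<omega>)\<^sup>2 \<partial>M)"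
    using t by (intro sq_martingale_norm_mono[OF U]) (auto intro: space_in_F)
  then show ?thesis
    by (simp cong: Bochner_Integration.integral_cong)
qed

text \<open>Second moments of martingales increase with time, so a terminal bound holds
  throughout.\<close>

lemma sq_martingale_c_bound:
  assumes U: "sq_martingale_c M F T U" and t: "t \<in> {0..T}"
    and K: "(\<integral>\<^sup>+\<omega>. ennreal ((norm (U T \<omega>))\<^sup>2) \<partial>M) \<le> K"
  shows "(\<integral>\<^sup>+\<omega>. ennreal ((norm (U t \<omega>))\<^sup>2) \<partial>M) \<le> K"
proof -
  have T: "T \<in> {0..T}" using T_pos by simp
  have "(\<integral>\<^sup>+\<omega>. ennreal ((norm (U t \<omega>))\<^sup>2) \<partial>M) \<le> (\<integral>\<^sup>+\<omega>. ennreal ((norm (U T \<omega>))\<^sup>2) \<partial>M)"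
    unfolding nn_integral_cmod_square[OF sq_martingale_c_sqi[OF U t]] nn_integral_cmod_square[OF sq_martingale_c_sqi[OF U T]]
    using sq_martingale_norm_le[OF sq_martingale_cD(1)[OF U] t] sq_martingale_norm_le[OF sq_martingale_cD(2)[OF U] t]
    by (intro ennreal_leI add_mono)
  with K show ?thesis by simp
qed

lemma sq_martingale_c_inner:
  assumes U: "sq_martingale_c M F T U" and st: "0 \<le> s" "s \<le> t" "t \<le> T"
    and f: "f \<in> borel_measurable (F s)" "square_integrable M f"
  shows "(\<integral>\<omega>. complex_of_real (f \<omega>) * U t \<omega> \<partial>M) = (\<integral>\<omega>. complex_of_real (f \<omega>) * U s \<omega> \<partial>M)"
proof -
  have T: "s \<in> {0..T}" "t \<in> {0..T}" using st by auto
  show ?thesis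
    unfolding complex_inner_integral(2)[OF f(2) sq_martingale_c_sqi[OF U T(1)]]
      complex_inner_integral(2)[OF f(2) sq_martingale_c_sqi[OF U T(2)]]
    using sq_martingale_inner[OF sq_martingale_cD(1)[OF U] st f] sq_martingale_inner[OF sq_martingale_cD(2)[OF U] st f]
    by simp
qed

lemma progressive_section:
  assumes "progressive_family Z U" "t \<in> {0..T}"
  shows "(\<lambda>x. U (snd x) t (fst x)) \<in> borel_measurable (F t \<Otimes>\<^sub>M Z)"
proof -
  have "(\<lambda>x. ((t, fst x), snd x)) \<in> measurable (F t \<Otimes>\<^sub>M Z) ((restrict_space borel {0..t} \<Otimes>\<^sub>M F t) \<Otimes>\<^sub>M Z)"
  proof (intro measurable_Pair measurable_snd measurable_fst)
    show "(\<lambda>x. t) \<in> measurable (F t \<Otimes>\<^sub>M Z) (restrict_space borel {0..t})"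
      using assms(2) by (intro measurable_const) (auto simp: space_restrict_space)
  qed
  from measurable_compose[OF this progressive_familyD[OF assms]] show ?thesis by simp
qed

lemma progressive_family_diff:
  fixes U V :: "'z \<Rightarrow> real \<Rightarrow> 'a \<Rightarrow> complex"
  assumes "progressive_family Z U" "progressive_family Z V"
  shows "progressive_family Z (\<lambda>z t \<omega>. U z t \<omega> - V z t \<omega>)"
  by (rule progressive_familyI, rule borel_measurable_diff[OF progressive_familyD[OF assms(1)] progressive_familyD[OF assms(2)]])

text \<open>Time 0 lies in every \<open>{0..t}\<close>, so freezing the time at 0 is a measurable
  map of the progressive space into itself.\<close>

lemma progressive_family_initial:
  assumes U: "progressive_family Z U"
  shows "progressive_family Z (\<lambda>z t \<omega>. U z 0 \<omega>)"
proof (rule progressive_familyI)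
  fix t assume t: "t \<in> {0..T}"
  have "(\<lambda>x. ((0, snd (fst x)), snd x)) \<in> measurable ((restrict_space borel {0..t} \<Otimes>\<^sub>M F t) \<Otimes>\<^sub>M Z)
      ((restrict_space borel {0..t} \<Otimes>\<^sub>M F t) \<Otimes>\<^sub>M Z)"
  proof (intro measurable_Pair measurable_snd measurable_compose[OF measurable_fst measurable_snd])
    show "(\<lambda>x. 0) \<in> measurable ((restrict_space borel {0..t} \<Otimes>\<^sub>M F t) \<Otimes>\<^sub>M Z) (restrict_space borel {0..t})"
      using t by (intro measurable_const) (auto simp: space_restrict_space)
  qed
  from measurable_compose[OF this progressive_familyD[OF U t]]
  show "(\<lambda>x. U (snd x) 0 (snd (fst x))) \<in> borel_measurable ((restrict_space borel {0..t} \<Otimes>\<^sub>M F t) \<Otimes>\<^sub>M Z)" by simp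
qed

end

section \<open>Mixtures against the complex measure on the strip\<close>

lemma strip_point_in: "strip_point R y \<in> strip R"
  by (simp add: strip_point_def strip_def)

lemma strip_point_measurable: "strip_point R \<in> measurable lborel (restrict_space borel (strip R))"
proof (rule measurable_restrict_space2)
  show "strip_point R \<in> space lborel \<rightarrow> strip R" by (simp add: strip_point_in)
  have "continuous_on UNIV (strip_point R)"
    unfolding strip_point_def[abs_def] Complex_eq
    by (intro continuous_intros)
  then show "strip_point R \<in> borel_measurable lborel"
    by (simp add: borel_measurable_continuous_onI)
qed

locale fourier_mixture = integrator M F T S A for M :: "'a measure" and F T S A +
  fixes h :: "real ^ 'n \<Rightarrow> real" and R :: "real ^ 'n"
  assumes h_fourier: "fourier_representation h R"
begin

abbreviation "Z \<equiv> restrict_space borel (strip R) :: (complex ^ 'n) measure"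

text \<open>The density of the complex measure in the coordinate y = Im z, including the factor from
  dz; every mixture becomes an integral over \<open>lborel\<close>.\<close>

definition weight :: "real ^ 'n \<Rightarrow> complex" where
  "weight y = zeta_density h (strip_point R y) * \<i> ^ CARD('n)"

lemma space_Z [simp]: "space Z = strip R"
  by (simp add: space_restrict_space)

lemma weight_integrable: "integrable lborel weight"
  using h_fourier unfolding weight_def[abs_def] zeta_density_def fourier_representation_def by simp

lemma zeta_integrable_iff: "zeta_integrable h R f \<longleftrightarrow> integrable lborel (\<lambda>y. f (strip_point R y) * weight y)"
  by (simp add: zeta_integrable_def weight_def mult.assoc)

lemma zeta_integral_eq: "zeta_integral h R f = (\<integral>y. f (strip_point R y) * weight y \<partial>lborel)"
  by (simp add: zeta_integral_def weight_def mult.assoc)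

abbreviation "mix \<equiv> zeta_process h R"

lemma mix_eq: "mix U t \<omega> = (\<integral>y. U (strip_point R y) t \<omega> * weight y \<partial>lborel)"
  by (simp add: zeta_process_def zeta_integral_eq)

lemma progressive_strip:
  assumes "progressive_family Z U" "t \<in> {0..T}"
  shows "(\<lambda>x. U (strip_point R (snd x)) t (fst x)) \<in> borel_measurable (F t \<Otimes>\<^sub>M lborel)"
    and "(\<lambda>x. U (strip_point R (snd x)) t (fst x)) \<in> borel_measurable (M \<Otimes>\<^sub>M lborel)"
proof -
  have 1: "(\<lambda>x. (fst x, strip_point R (snd x))) \<in> measurable (F t \<Otimes>\<^sub>M lborel) (F t \<Otimes>\<^sub>M Z)"
    by (intro measurable_Pair measurable_fst measurable_compose[OF measurable_snd strip_point_measurable])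
  from measurable_compose[OF 1 progressive_section[OF assms]]
  show 2: "(\<lambda>x. U (strip_point R (snd x)) t (fst x)) \<in> borel_measurable (F t \<Otimes>\<^sub>M lborel)" by simp
  have "(\<lambda>\<omega>. \<omega>) \<in> measurable M (F t)"
    by (rule measurable_F_imp_M[OF measurable_ident_sets[OF refl] assms(2)])
  then have "(\<lambda>x. (fst x, snd x)) \<in> measurable (M \<Otimes>\<^sub>M lborel) (F t \<Otimes>\<^sub>M lborel)"
    by (intro measurable_Pair measurable_snd measurable_compose[OF measurable_fst])
  from measurable_compose[OF this 2]
  show "(\<lambda>x. U (strip_point R (snd x)) t (fst x)) \<in> borel_measurable (M \<Otimes>\<^sub>M lborel)" by simp
qed

lemma mix_measurable:
  assumes "progressive_family Z U" "t \<in> {0..T}"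
  shows "mix U t \<in> borel_measurable (F t)" "mix U t \<in> borel_measurable M"
proof -
  note [measurable] = progressive_strip(1)[OF assms] borel_measurable_integrable[OF weight_integrable]
  show "mix U t \<in> borel_measurable (F t)"
    unfolding mix_eq[abs_def] by measurable
  then show "mix U t \<in> borel_measurable M" by (rule measurable_F_imp_M[OF _ assms(2)])
qed

text \<open>The general mixture lemma, with Lebesgue measure in the imaginary direction as mixing
  measure and \<open>weight\<close> as complex density.\<close>

lemma mix_facts:
  assumes U: "progressive_family Z U" "t \<in> {0..T}"
    and K: "\<And>z. z \<in> strip R \<Longrightarrow> (\<integral>\<^sup>+\<omega>. ennreal ((norm (U z t \<omega>))\<^sup>2) \<partial>M) \<le> ennreal K"
  shows mix_AE: "AE \<omega> in M. zeta_integrable h R (\<lambda>z. U z t \<omega>)"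
    and mix_sqi: "square_integrable M (\<lambda>\<omega>. Re (mix U t \<omega>))" "square_integrable M (\<lambda>\<omega>. Im (mix U t \<omega>))"
    and mix_inner: "square_integrable M X \<Longrightarrow>
      (\<integral>\<omega>. complex_of_real (X \<omega>) * mix U t \<omega> \<partial>M) =
      (\<integral>y. (\<integral>\<omega>. complex_of_real (X \<omega>) * U (strip_point R y) t \<omega> \<partial>M) * weight y \<partial>lborel)"
proof -
  let ?Y = "\<lambda>x. U (strip_point R (snd x)) t (fst x)"
  have b: "(\<integral>\<^sup>+\<omega>. ennreal ((norm (?Y (\<omega>, y)))\<^sup>2) \<partial>M) \<le> ennreal K" for y
    using K[OF strip_point_in] by simp
  note m = finite_measure_axioms lborel.sigma_finite_measure_axioms progressive_strip(2)[OF U] weight_integrable b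
  show "AE \<omega> in M. zeta_integrable h R (\<lambda>z. U z t \<omega>)"
    using mixture_AE_integrable[OF m] by (simp add: zeta_integrable_iff)
  have "(\<integral>\<^sup>+\<omega>. ennreal ((norm (mix U t \<omega>))\<^sup>2) \<partial>M) < \<infinity>"
    using mixture_bound[OF m] by (simp add: mix_eq)
  from square_integrable_Re_Im[OF mix_measurable(2)[OF U] this]
  show "square_integrable M (\<lambda>\<omega>. Re (mix U t \<omega>))" "square_integrable M (\<lambda>\<omega>. Im (mix U t \<omega>))" .
  show "(\<integral>\<omega>. complex_of_real (X \<omega>) * mix U t \<omega> \<partial>M) =
      (\<integral>y. (\<integral>\<omega>. complex_of_real (X \<omega>) * U (strip_point R y) t \<omega> \<partial>M) * weight y \<partial>lborel)" if "square_integrable M X"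
    using mixture_inner[OF m that] by (simp add: mix_eq)
qed

text \<open>The versions differ on null sets depending on z. By Tonelli almost every scenario sees
  agreement for almost every z, which is all that the integral over z feels.\<close>

lemma mix_version:
  assumes U: "(\<lambda>x. U (strip_point R (snd x)) t (fst x)) \<in> borel_measurable (M \<Otimes>\<^sub>M lborel)"
    and V: "(\<lambda>x. V (strip_point R (snd x)) t (fst x)) \<in> borel_measurable (M \<Otimes>\<^sub>M lborel)"
    and eq: "\<And>z. z \<in> strip R \<Longrightarrow> AE \<omega> in M. U z t \<omega> = V z t \<omega>"
  shows "AE \<omega> in M. (zeta_integrable h R (\<lambda>z. U z t \<omega>) \<longleftrightarrow> zeta_integrable h R (\<lambda>z. V z t \<omega>)) \<and> mix U t \<omega> = mix V t \<omega>"
proof -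
  have "AE \<omega> in M. AE y in lborel. U (strip_point R (snd (\<omega>, y))) t (fst (\<omega>, y)) = V (strip_point R (snd (\<omega>, y))) t (fst (\<omega>, y))"
    by (rule AE_AE_eq_swap[OF sigma_finite_measure_axioms lborel.sigma_finite_measure_axioms
        U V])
      (use eq[OF strip_point_in] in simp)
  then show ?thesis
    using AE_space
  proof eventually_elim
    case (elim \<omega>)
    have sec: "(\<lambda>y. W (strip_point R y) t \<omega> * weight y) \<in> borel_measurable lborel"
      if "(\<lambda>x. W (strip_point R (snd x)) t (fst x)) \<in> borel_measurable (M \<Otimes>\<^sub>M lborel)" for W
      using measurable_compose[OF measurable_Pair1'[OF elim(2), of lborel] that]
        borel_measurable_integrable[OF weight_integrable] by simp
    have ae: "AE y in lborel. U (strip_point R y) t \<omega> * weight y = V (strip_point R y) t \<omega> * weight y"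
      using elim(1) by eventually_elim simp
    show ?case
      unfolding zeta_integrable_iff mix_eq
      using integrable_cong_AE[OF sec[of U, OF U] sec[of V, OF V] ae] integral_cong_AE[OF sec[of U, OF U] sec[of V, OF V] ae] by simp
  qed
qed

text \<open>Conditioning on \<open>F t\<close> commutes with the mixture, so a mixture identity for martingales
  only has to be checked at the terminal time.\<close>
lemma mix_martingale:
  assumes Y: "progressive_family Z Y" and UY: "\<And>z. z \<in> strip R \<Longrightarrow> indist M T (U z) (Y z)"
    and U: "\<And>z. z \<in> strip R \<Longrightarrow> sq_martingale_c M F T (U z)"
    and K: "\<And>z. z \<in> strip R \<Longrightarrow> (\<integral>\<^sup>+\<omega>. ennreal ((norm (U z T \<omega>))\<^sup>2) \<partial>M) \<le> ennreal K"
    and V: "sq_martingale_c M F T V" and VT: "AE \<omega> in M. V T \<omega> = mix Y T \<omega>" and t: "t \<in> {0..T}"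
  shows "AE \<omega> in M. V t \<omega> = mix Y t \<omega>"
proof -
  have ae: "AE \<omega> in M. U z r \<omega> = Y z r \<omega>" if "z \<in> strip R" "r \<in> {0..T}" for z r
    using UY[OF that(1)] unfolding indist_def by eventually_elim (use that in blast)
  have KY: "(\<integral>\<^sup>+\<omega>. ennreal ((norm (Y z r \<omega>))\<^sup>2) \<partial>M) \<le> ennreal K" if z: "z \<in> strip R" and r: "r \<in> {0..T}" for z r
  proof -
    have "AE \<omega> in M. ennreal ((norm (Y z r \<omega>))\<^sup>2) = ennreal ((norm (U z r \<omega>))\<^sup>2)"
      using ae[OF z r] by eventually_elim simp
    from nn_integral_cong_AE[OF this]
    have "(\<integral>\<^sup>+\<omega>. ennreal ((norm (Y z r \<omega>))\<^sup>2) \<partial>M) = (\<integral>\<^sup>+\<omega>. ennreal ((norm (U z r \<omega>))\<^sup>2) \<partial>M)" .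
    then show ?thesis using sq_martingale_c_bound[OF U[OF z] r K[OF z]] by simp
  qed
  \<comment> \<open>Tested against an event of \<open>F t\<close>: mixing commutes with the pairing,
    and for each z the martingale property moves the time from \<open>t\<close> to
    \<open>T\<close>.\<close>
  have inner: "(\<integral>\<omega>. complex_of_real (indicator B \<omega>) * mix Y t \<omega> \<partial>M) = (\<integral>\<omega>. complex_of_real (indicator B \<omega>) * V T \<omega> \<partial>M)"
    if B: "B \<in> sets (F t)" for B
  proof -
    have BM: "B \<in> sets M" using B sets_F_subset[OF t] by blast
    have sB: "square_integrable M (indicator B)" by (rule sqi_indicator[OF BM])
    have eqU: "(\<integral>\<omega>. complex_of_real (indicator B \<omega>) * Y z r \<omega> \<partial>M) = (\<integral>\<omega>. complex_of_real (indicator B \<omega>) * U z r \<omega> \<partial>M)"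
      if z: "z \<in> strip R" and r: "r \<in> {0..T}" for z r
    proof (rule integral_cong_AE)
      have "U z r \<in> borel_measurable M"
      proof (rule borel_measurable_complex_iff[THEN iffD2], intro conjI)
        show "(\<lambda>\<omega>. Re (U z r \<omega>)) \<in> borel_measurable M" "(\<lambda>\<omega>. Im (U z r \<omega>)) \<in> borel_measurable M"
          using sq_martingale_c_sqi[OF U[OF z] r] by (simp_all add: square_integrable_def)
      qed
      then show "(\<lambda>\<omega>. complex_of_real (indicator B \<omega>) * U z r \<omega>) \<in> borel_measurable M" using BM by simp
      have "(\<lambda>\<omega>. Y z r \<omega>) \<in> borel_measurable M"
        using measurable_compose[OF measurable_Pair2'[of z Z "F r"] progressive_section[OF Y r]] z
        by (intro measurable_F_imp_M[OF _ r]) simp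
      then show "(\<lambda>\<omega>. complex_of_real (indicator B \<omega>) * Y z r \<omega>) \<in> borel_measurable M" using BM by simp
      show "AE \<omega> in M. complex_of_real (indicator B \<omega>) * Y z r \<omega> = complex_of_real (indicator B \<omega>) * U z r \<omega>"
        using ae[OF z r] by eventually_elim simp
    qed
    have tT: "0 \<le> t" "t \<le> T" using t by auto
    have "(\<integral>\<omega>. complex_of_real (indicator B \<omega>) * Y z t \<omega> \<partial>M) = (\<integral>\<omega>. complex_of_real (indicator B \<omega>) * Y z T \<omega> \<partial>M)" if z: "z \<in> strip R" for z
      unfolding eqU[OF z t] eqU[OF z T_in]
      by (rule sq_martingale_c_inner[OF U[OF z] tT order_refl, symmetric]) (use B sB in simp_all)
    note step = this[OF strip_point_in]
    have mi: "(\<integral>\<omega>. complex_of_real (indicator B \<omega>) * mix Y r \<omega> \<partial>M) =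
      (\<integral>y. (\<integral>\<omega>. complex_of_real (indicator B \<omega>) * Y (strip_point R y) r \<omega> \<partial>M) * weight y \<partial>lborel)"
      if r: "r \<in> {0..T}" for r by (rule mix_inner[OF Y r KY[OF _ r] sB])
    have "(\<integral>\<omega>. complex_of_real (indicator B \<omega>) * mix Y t \<omega> \<partial>M) = (\<integral>\<omega>. complex_of_real (indicator B \<omega>) * mix Y T \<omega> \<partial>M)"
      unfolding mi[OF t] mi[OF T_in] step ..
    also have "\<dots> = (\<integral>\<omega>. complex_of_real (indicator B \<omega>) * V T \<omega> \<partial>M)"
    proof (rule integral_cong_AE)
      show "AE \<omega> in M. complex_of_real (indicator B \<omega>) * mix Y T \<omega> = complex_of_real (indicator B \<omega>) * V T \<omega>"
        using VT by eventually_elim simp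
      show "(\<lambda>\<omega>. complex_of_real (indicator B \<omega>) * mix Y T \<omega>) \<in> borel_measurable M"
        using mix_measurable(2)[OF Y T_in] BM by simp
      show "(\<lambda>\<omega>. complex_of_real (indicator B \<omega>) * V T \<omega>) \<in> borel_measurable M"
        using complex_inner_integral(1)[OF sB sq_martingale_c_sqi[OF V T_in]] by (rule borel_measurable_integrable)
    qed
    finally show ?thesis .
  qed
  interpret sub: sigma_finite_subalgebra M "F t" by (rule sigma_finite_subalg[OF t])
  have sm: "square_integrable M (\<lambda>\<omega>. Re (mix Y t \<omega>))" "square_integrable M (\<lambda>\<omega>. Im (mix Y t \<omega>))"
    by (rule mix_sqi[OF Y t KY[OF _ t]]; assumption)+
  note sV = sq_martingale_c_sqi[OF V T_in]
  have mixF: "(\<lambda>\<omega>. Re (mix Y t \<omega>)) \<in> borel_measurable (F t)" "(\<lambda>\<omega>. Im (mix Y t \<omega>)) \<in> borel_measurable (F t)"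
    using mix_measurable(1)[OF Y t] by simp_all
  have eqs: "(\<integral>\<omega>\<in>B. Re (V T \<omega>) \<partial>M) = (\<integral>\<omega>\<in>B. Re (mix Y t \<omega>) \<partial>M)"
    "(\<integral>\<omega>\<in>B. Im (V T \<omega>) \<partial>M) = (\<integral>\<omega>\<in>B. Im (mix Y t \<omega>) \<partial>M)" if B: "B \<in> sets (F t)" for B
  proof -
    have BM: "B \<in> sets M" using B sets_F_subset[OF t] by blast
    have sB: "square_integrable M (indicator B)" by (rule sqi_indicator[OF BM])
    from inner[OF B] show "(\<integral>\<omega>\<in>B. Re (V T \<omega>) \<partial>M) = (\<integral>\<omega>\<in>B. Re (mix Y t \<omega>) \<partial>M)"
      "(\<integral>\<omega>\<in>B. Im (V T \<omega>) \<partial>M) = (\<integral>\<omega>\<in>B. Im (mix Y t \<omega>) \<partial>M)"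
      unfolding complex_inner_integral(2)[OF sB sm] complex_inner_integral(2)[OF sB sV]
      by (simp_all add: set_lebesgue_integral_def)
  qed
  \<comment> \<open>Equal integrals over all events of \<open>F t\<close> identify the mixture with
    the conditional expectation of \<open>V T\<close>; this uses nothing about its paths.\<close>
  have "AE \<omega> in M. real_cond_exp M (F t) (\<lambda>\<omega>. Re (V T \<omega>)) \<omega> = Re (mix Y t \<omega>)"
    "AE \<omega> in M. real_cond_exp M (F t) (\<lambda>\<omega>. Im (V T \<omega>)) \<omega> = Im (mix Y t \<omega>)"
    by (rule sub.real_cond_exp_charact[OF eqs(1) _ _ mixF(1)] sub.real_cond_exp_charact[OF eqs(2) _ _ mixF(2)];
        auto intro: square_integrable_imp_integrable sm sV)+
  moreover have "AE \<omega> in M. real_cond_exp M (F t) (\<lambda>\<omega>. Re (V T \<omega>)) \<omega> = Re (V t \<omega>)"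
    "AE \<omega> in M. real_cond_exp M (F t) (\<lambda>\<omega>. Im (V T \<omega>)) \<omega> = Im (V t \<omega>)"
    using V t unfolding sq_martingale_c_def sq_martingale_def martingale_def by simp_all
  ultimately show ?thesis
    by eventually_elim (simp add: complex_eq_iff)
qed

end

section \<open>Bounds by orthogonality and uniqueness of complex integrals\<close>

context integrator
begin

text \<open>\<open>N T - N 0\<close> is a sum of two orthogonal terms, and its second moment is that
  of \<open>N T\<close> minus that of \<open>N 0\<close>. A bound on \<open>N\<close> alone thus
  controls both parts.\<close>

lemma orthogonal_decomposition_bound:
  assumes N: "sq_martingale M F T N" and X: "ito \<theta> X" and L: "sq_martingale M F T L"
    and cov: "covariation M F T L S (\<lambda>_ _. 0)"
    and dec: "AE \<omega> in M. N T \<omega> = N 0 \<omega> + X \<omega> + L T \<omega>"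
  shows "(\<integral>\<omega>. (X \<omega>)\<^sup>2 \<partial>M) \<le> (\<integral>\<omega>. (N T \<omega>)\<^sup>2 \<partial>M)" "(\<integral>\<omega>. (L T \<omega>)\<^sup>2 \<partial>M) \<le> (\<integral>\<omega>. (N T \<omega>)\<^sup>2 \<partial>M)"
proof -
  have T: "0 \<in> {0..T}" "0 \<le> T" using T_pos by auto
  note sN = sq_martingale_sqi[OF N T(1)] sq_martingale_sqi[OF N T_in] and sL = sq_martingale_sqi[OF L T_in] and sX = ito_sqi(2)[OF X]
  have "(\<integral>\<omega>. L T \<omega> * X \<omega> \<partial>M) = 0"
    by (rule ito_orth[OF X sL covariation_zero_orth[OF L cov]])
  then have o: "(\<integral>\<omega>. X \<omega> * L T \<omega> \<partial>M) = 0" by (simp add: mult.commute)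
  \<comment> \<open>The martingale property turns the cross term into the second moment of
    \<open>N 0\<close>.\<close>
  have n: "(\<integral>\<omega>. N 0 \<omega> * N T \<omega> \<partial>M) = (\<integral>\<omega>. N 0 \<omega> * N 0 \<omega> \<partial>M)"
    by (rule sq_martingale_inner[OF N order_refl T(2) order_refl sq_martingale_meas[OF N T(1)] sN(1)])
  have "(\<integral>\<omega>. (X \<omega> + L T \<omega>)\<^sup>2 \<partial>M) = (\<integral>\<omega>. (N T \<omega> - N 0 \<omega>)\<^sup>2 \<partial>M)"
  proof (rule integral_cong_AE)
    show "AE \<omega> in M. (X \<omega> + L T \<omega>)\<^sup>2 = (N T \<omega> - N 0 \<omega>)\<^sup>2"
      using dec by eventually_elim simp
  qed (use square_integrable_add[OF sX sL] square_integrable_diff[OF sN(2,1)] in \<open>auto simp: square_integrable_def\<close>)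
  then have "(\<integral>\<omega>. (X \<omega>)\<^sup>2 \<partial>M) + (\<integral>\<omega>. (L T \<omega>)\<^sup>2 \<partial>M) = (\<integral>\<omega>. (N T \<omega>)\<^sup>2 \<partial>M) - (\<integral>\<omega>. (N 0 \<omega>)\<^sup>2 \<partial>M)"
    unfolding integral_square_add[OF sX sL] integral_square_diff[OF sN(2,1)] using o n
    by (simp add: power2_eq_square mult.commute)
  moreover have "0 \<le> (\<integral>\<omega>. (X \<omega>)\<^sup>2 \<partial>M)" "0 \<le> (\<integral>\<omega>. (L T \<omega>)\<^sup>2 \<partial>M)" "0 \<le> (\<integral>\<omega>. (N 0 \<omega>)\<^sup>2 \<partial>M)" by simp_all
  ultimately show "(\<integral>\<omega>. (X \<omega>)\<^sup>2 \<partial>M) \<le> (\<integral>\<omega>. (N T \<omega>)\<^sup>2 \<partial>M)" "(\<integral>\<omega>. (L T \<omega>)\<^sup>2 \<partial>M) \<le> (\<integral>\<omega>. (N T \<omega>)\<^sup>2 \<partial>M)" by linarith+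
qed

lemma indist_complex:
  assumes "indist M T (\<lambda>t \<omega>. Re (U t \<omega>)) (\<lambda>t \<omega>. Re (V t \<omega>))" "indist M T (\<lambda>t \<omega>. Im (U t \<omega>)) (\<lambda>t \<omega>. Im (V t \<omega>))"
  shows "indist M T U V"
  using assms unfolding indist_def by eventually_elim (simp add: complex_eq_iff)

lemma stoch_integral_c_unique:
  assumes "stoch_integral_c M F T S A \<theta> I" "stoch_integral_c M F T S A \<theta>' I'"
    and eq: "AE z in Q. \<theta> (fst z) (snd z) = \<theta>' (fst z) (snd z)"
  shows "indist M T I I'"
proof (rule indist_complex)
  have "AE z in Q. Re (\<theta> (fst z) (snd z)) = Re (\<theta>' (fst z) (snd z))" "AE z in Q. Im (\<theta> (fst z) (snd z)) = Im (\<theta>' (fst z) (snd z))"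
    using eq by (eventually_elim, simp)+
  then show "indist M T (\<lambda>t \<omega>. Re (I t \<omega>)) (\<lambda>t \<omega>. Re (I' t \<omega>))" "indist M T (\<lambda>t \<omega>. Im (I t \<omega>)) (\<lambda>t \<omega>. Im (I' t \<omega>))"
    using assms by (auto simp: stoch_integral_c_def intro: stoch_integral_unique)
qed

lemma stoch_integral_c_sq_martingale: "stoch_integral_c M F T S A \<theta> I \<Longrightarrow> sq_martingale_c M F T I"
  by (simp add: stoch_integral_c_def stoch_integral_def sq_martingale_c_def)

lemma sq_martingale_of_real: "sq_martingale M F T N \<Longrightarrow> sq_martingale_c M F T (\<lambda>t \<omega>. complex_of_real (N t \<omega>))"
  by (simp add: sq_martingale_c_def sq_martingale_zero)

end

section \<open>The components of the decomposition of the claim as mixtures\<close>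

locale fourier_claim = fourier_mixture M F T S A h R
  for M :: "'a measure" and F T S A and h :: "real ^ 'n \<Rightarrow> real" and R +
  fixes X\<^sub>T :: "'a \<Rightarrow> real ^ 'n" and H \<theta> L :: "real \<Rightarrow> 'a \<Rightarrow> real"
    and Hz \<theta>z Lz Iz :: "complex ^ 'n \<Rightarrow> real \<Rightarrow> 'a \<Rightarrow> complex"
  assumes X_meas: "X\<^sub>T \<in> borel_measurable M"
    and X_exp: "integrable M (\<lambda>\<omega>. exp (2 * (R \<bullet> X\<^sub>T \<omega>)))"
    and h_meas: "h \<in> borel_measurable borel"
    and h_sq: "integrable M (\<lambda>\<omega>. (h (X\<^sub>T \<omega>))\<^sup>2)"
    and H_def: "\<And>t. t \<in> {0..T} \<Longrightarrow>
      AE \<omega> in M. H t \<omega> = real_cond_exp M (F t) (\<lambda>\<omega>. h (X\<^sub>T \<omega>)) \<omega>"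
    and Hz_def: "\<And>z t. z \<in> strip R \<Longrightarrow> t \<in> {0..T} \<Longrightarrow>
      AE \<omega> in M. Hz z t \<omega> = cond_exp_c M (F t) (\<lambda>\<omega>. exp (pairing z (X\<^sub>T \<omega>))) \<omega>"
    and H_gkw: "gkw M F T S A H \<theta> L"
    and Hz_gkw: "\<And>z. z \<in> strip R \<Longrightarrow> gkw_c M F T S A (Hz z) (\<theta>z z) (Lz z)"
    and Iz_def: "\<And>z. z \<in> strip R \<Longrightarrow> stoch_integral_c M F T S A (\<theta>z z) (Iz z)"
    and Hz_joint: "jointly_progressive M F T R Hz"
    and \<theta>z_joint: "jointly_predictable M F T R \<theta>z"
begin

lemma jointly_progressive_iff: "jointly_progressive M F T R U \<longleftrightarrow> progressive_family Z U"
  by (simp add: jointly_progressive_def progressive_family_def)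

lemma joint_version_iff: "joint_version M F T R U Y \<longleftrightarrow> progressive_family Z Y \<and> (\<forall>z\<in>strip R. indist M T (U z) (Y z))"
  by (simp add: joint_version_def jointly_progressive_iff)

lemma indistD: "indist M T U V \<Longrightarrow> t \<in> {0..T} \<Longrightarrow> AE \<omega> in M. U t \<omega> = V t \<omega>"
  unfolding indist_def by (erule AE_mp, rule AE_I2) blast

lemma Hz_progressive: "progressive_family Z Hz"
  using Hz_joint by (simp add: jointly_progressive_iff)

lemma \<theta>z_measurable: "(\<lambda>p. \<theta>z (snd p) (fst (fst p)) (snd (fst p))) \<in> borel_measurable (Q \<Otimes>\<^sub>M Z)"
proof -
  have "(\<lambda>p. \<theta>z (snd p) (fst (fst p)) (snd (fst p))) \<in> borel_measurable (P \<Otimes>\<^sub>M Z)"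
    using \<theta>z_joint by (simp add: jointly_predictable_def case_prod_beta')
  then show ?thesis by measurable
qed

lemma Hz_martingale: "z \<in> strip R \<Longrightarrow> sq_martingale_c M F T (Hz z)"
  and Lz_martingale: "z \<in> strip R \<Longrightarrow> sq_martingale_c M F T (Lz z)"
  and Lz_cov: "z \<in> strip R \<Longrightarrow> covariation M F T (\<lambda>t \<omega>. Re (Lz z t \<omega>)) S (\<lambda>_ _. 0)"
    "z \<in> strip R \<Longrightarrow> covariation M F T (\<lambda>t \<omega>. Im (Lz z t \<omega>)) S (\<lambda>_ _. 0)"
  using Hz_gkw by (simp_all add: gkw_c_def)

lemma Iz_martingale: "z \<in> strip R \<Longrightarrow> sq_martingale_c M F T (Iz z)"
  using Iz_def by (rule stoch_integral_c_sq_martingale)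

text \<open>The decomposition only asserts that some integral process exists; by uniqueness the
  given \<open>Iz z\<close> may take its place.\<close>

lemma Hz_decomposition:
  assumes z: "z \<in> strip R"
  shows "AE \<omega> in M. \<forall>t\<in>{0..T}. Hz z t \<omega> = Hz z 0 \<omega> + Iz z t \<omega> + Lz z t \<omega>"
proof -
  obtain I where I: "stoch_integral_c M F T S A (\<theta>z z) I" "indist M T (Hz z) (\<lambda>t \<omega>. Hz z 0 \<omega> + I t \<omega> + Lz z t \<omega>)"
    using Hz_gkw[OF z] unfolding gkw_c_def by blast
  have "indist M T I (Iz z)" by (rule stoch_integral_c_unique[OF I(1) Iz_def[OF z]]) simp
  then show ?thesis
    using I(2) unfolding indist_def
    by eventually_elim (rule ballI, drule (1) bspec, drule (1) bspec, simp only:)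
qed

text \<open>\<open>F T\<close> is the full sigma-algebra, so conditioning at \<open>T\<close> is
  trivial. On the strip the modulus of the exponential depends on \<open>R\<close> only, which makes
  the second moment the same for all z.\<close>

lemma Hz_terminal:
  assumes z: "z \<in> strip R"
  shows "AE \<omega> in M. Hz z T \<omega> = exp (pairing z (X\<^sub>T \<omega>))"
    and "(\<integral>\<^sup>+\<omega>. ennreal ((norm (Hz z T \<omega>))\<^sup>2) \<partial>M) = ennreal (\<integral>\<omega>. exp (2 * (R \<bullet> X\<^sub>T \<omega>)) \<partial>M)"
proof -
  have Re_pair: "Re (pairing z x) = R \<bullet> x" for x
    using z by (simp add: pairing_def strip_def inner_vec_def)
  have "pairing z \<in> borel_measurable borel"
    unfolding pairing_def[abs_def] by measurable
  then have e[measurable]: "(\<lambda>\<omega>. exp (pairing z (X\<^sub>T \<omega>))) \<in> borel_measurable M"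
    using X_meas by measurable
  have n: "(norm (exp (pairing z x)))\<^sup>2 = exp (2 * (R \<bullet> x))" for x
    by (simp add: Re_pair exp_double[symmetric])
  have nn: "(\<integral>\<^sup>+\<omega>. ennreal ((norm (exp (pairing z (X\<^sub>T \<omega>))))\<^sup>2) \<partial>M) = ennreal (\<integral>\<omega>. exp (2 * (R \<bullet> X\<^sub>T \<omega>)) \<partial>M)"
    unfolding n by (rule nn_integral_eq_integral[OF X_exp]) simp
  note sq = square_integrable_Re_Im[OF e, unfolded nn, OF ennreal_less_top[folded infinity_ennreal_def]]
  interpret sub: sigma_finite_subalgebra M "F T" by (rule sigma_finite_subalg[OF T_in])
  have "AE \<omega> in M. real_cond_exp M (F T) (\<lambda>\<omega>. Re (exp (pairing z (X\<^sub>T \<omega>)))) \<omega> = Re (exp (pairing z (X\<^sub>T \<omega>)))"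
    "AE \<omega> in M. real_cond_exp M (F T) (\<lambda>\<omega>. Im (exp (pairing z (X\<^sub>T \<omega>)))) \<omega> = Im (exp (pairing z (X\<^sub>T \<omega>)))"
    using sq by (auto intro!: sub.real_cond_exp_F_meas measurable_M_imp_F
        intro: square_integrable_imp_integrable square_integrableD(1))
  with Hz_def[OF z T_in] show ae: "AE \<omega> in M. Hz z T \<omega> = exp (pairing z (X\<^sub>T \<omega>))"
    by eventually_elim (simp add: cond_exp_c_def complex_eq_iff)
  have "AE \<omega> in M. ennreal ((norm (Hz z T \<omega>))\<^sup>2) = ennreal ((norm (exp (pairing z (X\<^sub>T \<omega>))))\<^sup>2)"
    using ae by eventually_elim simp
  from nn_integral_cong_AE[OF this] nn
  show "(\<integral>\<^sup>+\<omega>. ennreal ((norm (Hz z T \<omega>))\<^sup>2) \<partial>M) = ennreal (\<integral>\<omega>. exp (2 * (R \<bullet> X\<^sub>T \<omega>)) \<partial>M)" by simp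
qed

text \<open>The common second moment of the \<open>Hz z T\<close>; it serves as the bound for every
  component.\<close>

definition "K = (\<integral>\<omega>. exp (2 * (R \<bullet> X\<^sub>T \<omega>)) \<partial>M)"

lemma ito_Iz:
  assumes z: "z \<in> strip R"
  shows "ito (\<lambda>x. Re (\<theta>z z (fst x) (snd x))) (\<lambda>\<omega>. Re (Iz z T \<omega>))"
    and "ito (\<lambda>x. Im (\<theta>z z (fst x) (snd x))) (\<lambda>\<omega>. Im (Iz z T \<omega>))"
  using Iz_def[OF z] stoch_integral_ito[of "\<lambda>t \<omega>. Re (\<theta>z z t \<omega>)" "\<lambda>t \<omega>. Re (Iz z t \<omega>)"]
    stoch_integral_ito[of "\<lambda>t \<omega>. Im (\<theta>z z t \<omega>)" "\<lambda>t \<omega>. Im (Iz z t \<omega>)"]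
  by (simp_all add: stoch_integral_c_def)

text \<open>Pythagoras is applied to real and imaginary parts separately; the isometry then moves
  the bound for \<open>Iz z T\<close> to the integrand.\<close>

lemma terminal_bounds:
  assumes z: "z \<in> strip R"
  shows Hz_bound: "(\<integral>\<^sup>+\<omega>. ennreal ((norm (Hz z T \<omega>))\<^sup>2) \<partial>M) \<le> ennreal K"
    and Iz_bound: "(\<integral>\<^sup>+\<omega>. ennreal ((norm (Iz z T \<omega>))\<^sup>2) \<partial>M) \<le> ennreal K"
    and Lz_bound: "(\<integral>\<^sup>+\<omega>. ennreal ((norm (Lz z T \<omega>))\<^sup>2) \<partial>M) \<le> ennreal K"
    and \<theta>z_bound: "(\<integral>\<^sup>+x. ennreal ((norm (\<theta>z z (fst x) (snd x)))\<^sup>2) \<partial>Q) \<le> ennreal K"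
proof -
  note H = sq_martingale_cD[OF Hz_martingale[OF z]] and L = sq_martingale_cD[OF Lz_martingale[OF z]]
  have "AE \<omega> in M. Hz z T \<omega> = Hz z 0 \<omega> + Iz z T \<omega> + Lz z T \<omega>"
    using Hz_decomposition[OF z] by eventually_elim (drule bspec[OF _ T_in])
  then have dec: "AE \<omega> in M. Re (Hz z T \<omega>) = Re (Hz z 0 \<omega>) + Re (Iz z T \<omega>) + Re (Lz z T \<omega>)"
    "AE \<omega> in M. Im (Hz z T \<omega>) = Im (Hz z 0 \<omega>) + Im (Iz z T \<omega>) + Im (Lz z T \<omega>)"
    by (auto elim!: eventually_mono)
  note bR = orthogonal_decomposition_bound[OF H(1) ito_Iz(1)[OF z] L(1) Lz_cov(1)[OF z] dec(1)]
  note bI = orthogonal_decomposition_bound[OF H(2) ito_Iz(2)[OF z] L(2) Lz_cov(2)[OF z] dec(2)]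
  show HK: "(\<integral>\<^sup>+\<omega>. ennreal ((norm (Hz z T \<omega>))\<^sup>2) \<partial>M) \<le> ennreal K"
    using Hz_terminal(2)[OF z] by (simp add: K_def)
  have H': "ennreal ((\<integral>\<omega>. (Re (Hz z T \<omega>))\<^sup>2 \<partial>M) + (\<integral>\<omega>. (Im (Hz z T \<omega>))\<^sup>2 \<partial>M)) \<le> ennreal K"
    using HK unfolding nn_integral_cmod_square[OF sq_martingale_c_sqi[OF Hz_martingale[OF z] T_in]] .
  show IK: "(\<integral>\<^sup>+\<omega>. ennreal ((norm (Iz z T \<omega>))\<^sup>2) \<partial>M) \<le> ennreal K"
    unfolding nn_integral_cmod_square[OF sq_martingale_c_sqi[OF Iz_martingale[OF z] T_in]]
    by (rule order_trans[OF ennreal_leI[OF add_mono[OF bR(1) bI(1)]] H'])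
  show "(\<integral>\<^sup>+\<omega>. ennreal ((norm (Lz z T \<omega>))\<^sup>2) \<partial>M) \<le> ennreal K"
    unfolding nn_integral_cmod_square[OF sq_martingale_c_sqi[OF Lz_martingale[OF z] T_in]]
    by (rule order_trans[OF ennreal_leI[OF add_mono[OF bR(2) bI(2)]] H'])
  show "(\<integral>\<^sup>+x. ennreal ((norm (\<theta>z z (fst x) (snd x)))\<^sup>2) \<partial>Q) \<le> ennreal K"
    using IK unfolding nn_integral_cmod_square[OF sq_martingale_c_sqi[OF Iz_martingale[OF z] T_in]]
      nn_integral_cmod_square[OF ito_sqi(1)[OF ito_Iz(1)[OF z]] ito_sqi(1)[OF ito_Iz(2)[OF z]]]
      ito_isometry[OF ito_Iz(1)[OF z]] ito_isometry[OF ito_Iz(2)[OF z]] .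
qed

lemma Iz_version: "\<exists>Y. progressive_family Z Y \<and> (\<forall>z\<in>strip R. indist M T (Iz z) (Y z))"
proof -
  have m: "(\<lambda>p. Re (\<theta>z (snd p) (fst (fst p)) (snd (fst p)))) \<in> borel_measurable (Q \<Otimes>\<^sub>M Z)"
    "(\<lambda>p. Im (\<theta>z (snd p) (fst (fst p)) (snd (fst p)))) \<in> borel_measurable (Q \<Otimes>\<^sub>M Z)"
    using borel_measurable_complex_iff[THEN iffD1, OF \<theta>z_measurable] by simp_all
  have "\<exists>Y. progressive_family Z Y \<and> (\<forall>z\<in>space Z. indist M T (\<lambda>t \<omega>. Re (Iz z t \<omega>)) (Y z))"
    using Iz_def by (intro stoch_integral_progressive_version[OF m(1)]) (simp add: stoch_integral_c_def)
  then obtain Y1 where Y1: "progressive_family Z Y1" "\<And>z. z \<in> strip R \<Longrightarrow> indist M T (\<lambda>t \<omega>. Re (Iz z t \<omega>)) (Y1 z)"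
    by (auto simp del: space_restrict_space)
  have "\<exists>Y. progressive_family Z Y \<and> (\<forall>z\<in>space Z. indist M T (\<lambda>t \<omega>. Im (Iz z t \<omega>)) (Y z))"
    using Iz_def by (intro stoch_integral_progressive_version[OF m(2)]) (simp add: stoch_integral_c_def)
  then obtain Y2 where Y2: "progressive_family Z Y2" "\<And>z. z \<in> strip R \<Longrightarrow> indist M T (\<lambda>t \<omega>. Im (Iz z t \<omega>)) (Y2 z)"
    by (auto simp del: space_restrict_space)
  define Y where "Y z t \<omega> = Complex (Y1 z t \<omega>) (Y2 z t \<omega>)" for z t \<omega>
  have "progressive_family Z Y"
    unfolding Y_def using progressive_familyD[OF Y1(1)] progressive_familyD[OF Y2(1)]
    by (intro progressive_familyI borel_measurable_complex_iff[THEN iffD2]) auto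
  moreover have "indist M T (Iz z) (Y z)" if "z \<in> strip R" for z
    unfolding Y_def using Y1(2)[OF that] Y2(2)[OF that] by (intro indist_complex) simp_all
  ultimately show ?thesis by blast
qed

definition "YI = (SOME Y. progressive_family Z Y \<and> (\<forall>z\<in>strip R. indist M T (Iz z) (Y z)))"

lemma YI: "progressive_family Z YI" "z \<in> strip R \<Longrightarrow> indist M T (Iz z) (YI z)"
  using someI_ex[OF Iz_version] unfolding YI_def by blast+

text \<open>A version of \<open>Lz z\<close> obtained by subtraction: \<open>Hz\<close> is jointly
  measurable by assumption and \<open>YI\<close> by construction, so the difference inherits
  this.\<close>

definition "YL z t \<omega> = Hz z t \<omega> - Hz z 0 \<omega> - YI z t \<omega>"

lemma YL: "progressive_family Z YL" "z \<in> strip R \<Longrightarrow> indist M T (Lz z) (YL z)"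
proof -
  show "progressive_family Z YL"
    unfolding YL_def[abs_def]
    by (intro progressive_family_diff progressive_family_initial Hz_progressive YI)
  assume z: "z \<in> strip R"
  show "indist M T (Lz z) (YL z)"
    using Hz_decomposition[OF z] YI(2)[OF z] unfolding indist_def
    by eventually_elim (rule ballI, drule (1) bspec, drule (1) bspec, simp only: YL_def, simp)
qed

lemma bound_version:
  assumes "sq_martingale_c M F T U" "indist M T U Y" "t \<in> {0..T}"
    and "(\<integral>\<^sup>+\<omega>. ennreal ((norm (U T \<omega>))\<^sup>2) \<partial>M) \<le> ennreal K"
  shows "(\<integral>\<^sup>+\<omega>. ennreal ((norm (Y t \<omega>))\<^sup>2) \<partial>M) \<le> ennreal K"
proof -
  have "AE \<omega> in M. ennreal ((norm (Y t \<omega>))\<^sup>2) = ennreal ((norm (U t \<omega>))\<^sup>2)"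
    using indistD[OF assms(2,3)] by eventually_elim simp
  from nn_integral_cong_AE[OF this] sq_martingale_c_bound[OF assms(1,3,4)] show ?thesis by simp
qed

lemma Hz_bound': "z \<in> strip R \<Longrightarrow> t \<in> {0..T} \<Longrightarrow> (\<integral>\<^sup>+\<omega>. ennreal ((norm (Hz z t \<omega>))\<^sup>2) \<partial>M) \<le> ennreal K"
  by (rule sq_martingale_c_bound[OF Hz_martingale _ Hz_bound])

lemma YI_bound: "z \<in> strip R \<Longrightarrow> t \<in> {0..T} \<Longrightarrow> (\<integral>\<^sup>+\<omega>. ennreal ((norm (YI z t \<omega>))\<^sup>2) \<partial>M) \<le> ennreal K"
  by (rule bound_version[OF Iz_martingale YI(2) _ Iz_bound])

lemma YL_bound: "z \<in> strip R \<Longrightarrow> t \<in> {0..T} \<Longrightarrow> (\<integral>\<^sup>+\<omega>. ennreal ((norm (YL z t \<omega>))\<^sup>2) \<partial>M) \<le> ennreal K"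
  by (rule bound_version[OF Lz_martingale YL(2) _ Lz_bound])

lemma H_martingale: "sq_martingale M F T H" and L_martingale: "sq_martingale M F T L"
  and L_cov: "covariation M F T L S (\<lambda>_ _. 0)"
  using H_gkw by (simp_all add: gkw_def)

text \<open>At \<open>T\<close> the mixture of exponentials is the Fourier representation of
  \<open>h\<close>, evaluated at \<open>X\<^sub>T\<close>. For each z the variable
  \<open>Hz z T\<close> is the exponential only up to a null set, so versions have to be
  exchanged.\<close>

lemma H_terminal: "AE \<omega> in M. complex_of_real (H T \<omega>) = mix Hz T \<omega>"
proof -
  have hX: "(\<lambda>\<omega>. h (X\<^sub>T \<omega>)) \<in> borel_measurable M" using X_meas h_meas by measurable
  then have sq: "square_integrable M (\<lambda>\<omega>. h (X\<^sub>T \<omega>))" using h_sq by (simp add: square_integrable_def)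
  interpret sub: sigma_finite_subalgebra M "F T" by (rule sigma_finite_subalg[OF T_in])
  have 1: "AE \<omega> in M. real_cond_exp M (F T) (\<lambda>\<omega>. h (X\<^sub>T \<omega>)) \<omega> = h (X\<^sub>T \<omega>)"
    by (rule sub.real_cond_exp_F_meas[OF square_integrable_imp_integrable[OF sq] measurable_M_imp_F[OF hX]])
  have pm: "(\<lambda>x. exp (pairing (strip_point R (snd x)) (X\<^sub>T (fst x)))) \<in> borel_measurable (M \<Otimes>\<^sub>M lborel)"
  proof -
    have [measurable]: "X\<^sub>T \<in> borel_measurable M" by (rule X_meas)
    have [measurable]: "(\<lambda>v :: real ^ 'n. v $ i) \<in> borel_measurable borel" for i
      by (intro borel_measurable_continuous_onI continuous_intros)
    have "(\<lambda>x. pairing (strip_point R (snd x)) (X\<^sub>T (fst x))) \<in> borel_measurable (M \<Otimes>\<^sub>M lborel)"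
      unfolding pairing_def strip_point_def by (simp add: Complex_eq) measurable
    then show ?thesis by measurable
  qed
  have "AE \<omega> in M. (zeta_integrable h R (\<lambda>z. Hz z T \<omega>) \<longleftrightarrow> zeta_integrable h R (\<lambda>z. (\<lambda>z t \<omega>. exp (pairing z (X\<^sub>T \<omega>))) z T \<omega>)) \<and>
      mix Hz T \<omega> = mix (\<lambda>z t \<omega>. exp (pairing z (X\<^sub>T \<omega>))) T \<omega>"
    by (rule mix_version[where U = Hz and V = "\<lambda>z t \<omega>. exp (pairing z (X\<^sub>T \<omega>))", OF progressive_strip(2)[OF Hz_progressive T_in]]) (use pm Hz_terminal(1) in auto)
  then have 2: "AE \<omega> in M. mix Hz T \<omega> = complex_of_real (h (X\<^sub>T \<omega>))"
    using h_fourier unfolding fourier_representation_def by (simp add: zeta_process_def)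
  show ?thesis using H_def[OF T_in] 1 2 by eventually_elim simp
qed

lemma H_mix: "t \<in> {0..T} \<Longrightarrow> AE \<omega> in M. complex_of_real (H t \<omega>) = mix Hz t \<omega>"
  by (rule mix_martingale[OF Hz_progressive _ Hz_martingale Hz_bound sq_martingale_of_real[OF H_martingale] H_terminal])
    (simp_all add: indist_def)

text \<open>Integrals over z may be subtracted only where all terms are integrable; the uniform
  bounds ensure this almost surely.\<close>

lemma mix_YL:
  assumes t: "t \<in> {0..T}"
  shows "AE \<omega> in M. mix YL t \<omega> = mix Hz t \<omega> - mix Hz 0 \<omega> - mix YI t \<omega>"
proof -
  have z0: "0 \<in> {0..T}" using T_pos by simp
  have "AE \<omega> in M. zeta_integrable h R (\<lambda>z. Hz z t \<omega>)" "AE \<omega> in M. zeta_integrable h R (\<lambda>z. Hz z 0 \<omega>)"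
    "AE \<omega> in M. zeta_integrable h R (\<lambda>z. YI z t \<omega>)"
    by (rule mix_AE[OF Hz_progressive t Hz_bound'] mix_AE[OF Hz_progressive z0 Hz_bound'] mix_AE[OF YI(1) t YI_bound]; (assumption | rule t z0))+
  then show ?thesis
    by eventually_elim (simp add: zeta_integrable_iff mix_eq YL_def left_diff_distrib)
qed

text \<open>A choice of the integral process that the decomposition of \<open>H\<close> asserts to
  exist.\<close>

definition "IH = (SOME I. stoch_integral M F T S A \<theta> I \<and> indist M T H (\<lambda>t \<omega>. H 0 \<omega> + I t \<omega> + L t \<omega>))"

lemma IH: "stoch_integral M F T S A \<theta> IH" "indist M T H (\<lambda>t \<omega>. H 0 \<omega> + IH t \<omega> + L t \<omega>)"
proof -
  have "\<exists>I. stoch_integral M F T S A \<theta> I \<and> indist M T H (\<lambda>t \<omega>. H 0 \<omega> + I t \<omega> + L t \<omega>)"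
    using H_gkw unfolding gkw_def by (elim conjE)
  note c = someI_ex[OF this, folded IH_def]
  show "stoch_integral M F T S A \<theta> IH" by (rule conjunct1[OF c])
  show "indist M T H (\<lambda>t \<omega>. H 0 \<omega> + IH t \<omega> + L t \<omega>)" by (rule conjunct2[OF c])
qed

lemma IH_martingale: "sq_martingale M F T IH"
  using IH(1) by (simp add: stoch_integral_def)

text \<open>Compare the given decomposition of \<open>H\<close> with the mixed one; the initial
  values cancel by \<open>H_mix\<close> at time 0.\<close>

lemma defect_eq:
  assumes t: "t \<in> {0..T}"
  shows "AE \<omega> in M. complex_of_real (IH t \<omega>) - mix YI t \<omega> = mix YL t \<omega> - complex_of_real (L t \<omega>)"
proof -
  have z0: "0 \<in> {0..T}" using T_pos by simp
  show ?thesis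
    using H_mix[OF t] H_mix[OF z0] mix_YL[OF t] indistD[OF IH(2) t]
  proof eventually_elim
    case (elim \<omega>)
    have "mix Hz t \<omega> = mix Hz 0 \<omega> + complex_of_real (IH t \<omega>) + complex_of_real (L t \<omega>)"
      using elim(4) unfolding elim(1)[symmetric] elim(2)[symmetric] by simp
    then show ?case unfolding elim(3) by simp
  qed
qed

text \<open>Pairings are computed for the given processes but mixed for their jointly measurable
  versions; this passes from the former to the latter.\<close>

lemma family_inner_zero:
  assumes "sq_martingale_c M F T U" "indist M T U Y" and Ym: "Y T \<in> borel_measurable M"
    and X: "square_integrable M X"
    and "(\<integral>\<omega>. X \<omega> * Re (U T \<omega>) \<partial>M) = a" "(\<integral>\<omega>. X \<omega> * Im (U T \<omega>) \<partial>M) = b"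
  shows "(\<integral>\<omega>. complex_of_real (X \<omega>) * Y T \<omega> \<partial>M) = Complex a b"
proof -
  have "(\<integral>\<omega>. complex_of_real (X \<omega>) * Y T \<omega> \<partial>M) = (\<integral>\<omega>. complex_of_real (X \<omega>) * U T \<omega> \<partial>M)"
  proof (rule integral_cong_AE)
    show "(\<lambda>\<omega>. complex_of_real (X \<omega>) * Y T \<omega>) \<in> borel_measurable M"
      using Ym square_integrableD(1)[OF X] by simp
    show "(\<lambda>\<omega>. complex_of_real (X \<omega>) * U T \<omega>) \<in> borel_measurable M"
      by (rule borel_measurable_integrable[OF complex_inner_integral(1)[OF X sq_martingale_c_sqi[OF assms(1) T_in]]])
    show "AE \<omega> in M. complex_of_real (X \<omega>) * Y T \<omega> = complex_of_real (X \<omega>) * U T \<omega>"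
      using indistD[OF assms(2) T_in] by eventually_elim simp
  qed
  then show ?thesis
    unfolding complex_inner_integral(2)[OF X sq_martingale_c_sqi[OF assms(1) T_in]] assms(5,6) .
qed

lemma progressive_slice:
  assumes "progressive_family Z Y" "z \<in> strip R" "t \<in> {0..T}"
  shows "Y z t \<in> borel_measurable M"
  using measurable_compose[OF measurable_Pair2'[of z Z "F t"] progressive_section[OF assms(1,3)]] assms(2)
  by (intro measurable_F_imp_M[OF _ assms(3)]) simp

lemma mix_YI_inner:
  assumes X: "square_integrable M X"
  shows "(\<integral>\<omega>. complex_of_real (X \<omega>) * mix YI T \<omega> \<partial>M) =
    (\<integral>y. Complex (\<integral>\<omega>. X \<omega> * Re (Iz (strip_point R y) T \<omega>) \<partial>M) (\<integral>\<omega>. X \<omega> * Im (Iz (strip_point R y) T \<omega>) \<partial>M) * weight y \<partial>lborel)"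
proof -
  have "(\<integral>\<omega>. complex_of_real (X \<omega>) * mix YI T \<omega> \<partial>M) =
      (\<integral>y. (\<integral>\<omega>. complex_of_real (X \<omega>) * YI (strip_point R y) T \<omega> \<partial>M) * weight y \<partial>lborel)"
    by (rule mix_inner[OF YI(1) T_in YI_bound[OF _ T_in] X])
  also have "(\<integral>\<omega>. complex_of_real (X \<omega>) * YI z T \<omega> \<partial>M) =
      Complex (\<integral>\<omega>. X \<omega> * Re (Iz z T \<omega>) \<partial>M) (\<integral>\<omega>. X \<omega> * Im (Iz z T \<omega>) \<partial>M)" if z: "z \<in> strip R" for z
    by (rule family_inner_zero[OF Iz_martingale[OF z] YI(2)[OF z] progressive_slice[OF YI(1) z T_in] X refl refl])
  then have "(\<integral>y. (\<integral>\<omega>. complex_of_real (X \<omega>) * YI (strip_point R y) T \<omega> \<partial>M) * weight y \<partial>lborel) =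
    (\<integral>y. Complex (\<integral>\<omega>. X \<omega> * Re (Iz (strip_point R y) T \<omega>) \<partial>M) (\<integral>\<omega>. X \<omega> * Im (Iz (strip_point R y) T \<omega>) \<partial>M) * weight y \<partial>lborel)"
    by (simp add: strip_point_in)
  finally show ?thesis .
qed

text \<open>Each \<open>Lz z T\<close> is orthogonal to elementary integrals, and the pairing may be
  taken before mixing.\<close>

lemma mix_YL_orth:
  assumes E: "elementary M F T E"
  shows "(\<integral>\<omega>. complex_of_real (elem_integral S E T \<omega>) * mix YL T \<omega> \<partial>M) = 0"
proof -
  let ?e = "elem_integral S E T"
  note X = sqi_elem_integral[OF E]
  have z: "(\<integral>\<omega>. complex_of_real (?e \<omega>) * YL z T \<omega> \<partial>M) = Complex 0 0" if z: "z \<in> strip R" for z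
  proof (rule family_inner_zero[OF Lz_martingale[OF z] YL(2)[OF z] progressive_slice[OF YL(1) z T_in] X])
    show "(\<integral>\<omega>. ?e \<omega> * Re (Lz z T \<omega>) \<partial>M) = 0"
      using covariation_zero_orth[OF sq_martingale_cD(1)[OF Lz_martingale[OF z]] Lz_cov(1)[OF z] E] by (simp add: mult.commute)
    show "(\<integral>\<omega>. ?e \<omega> * Im (Lz z T \<omega>) \<partial>M) = 0"
      using covariation_zero_orth[OF sq_martingale_cD(2)[OF Lz_martingale[OF z]] Lz_cov(2)[OF z] E] by (simp add: mult.commute)
  qed
  have "(\<integral>\<omega>. complex_of_real (?e \<omega>) * mix YL T \<omega> \<partial>M) =
      (\<integral>y. (\<integral>\<omega>. complex_of_real (?e \<omega>) * YL (strip_point R y) T \<omega> \<partial>M) * weight y \<partial>lborel)"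
    by (rule mix_inner[OF YL(1) T_in YL_bound[OF _ T_in] X])
  also have "\<dots> = 0" unfolding z[OF strip_point_in] by (simp add: complex_eq_iff zero_complex.code[symmetric])
  finally show ?thesis .
qed

text \<open>At time \<open>T\<close>, \<open>IH - mix YI\<close> lies in the closed span of the elementary integrals; since it also
  equals \<open>mix YL - L\<close>, it is orthogonal to all of them, hence to itself.\<close>
lemma IH_terminal: "AE \<omega> in M. complex_of_real (IH T \<omega>) = mix YI T \<omega>"
proof -
  define D where "D \<omega> = complex_of_real (IH T \<omega>) - mix YI T \<omega>" for \<omega>
  have sYI: "square_integrable M (\<lambda>\<omega>. Re (mix YI T \<omega>))" "square_integrable M (\<lambda>\<omega>. Im (mix YI T \<omega>))"
    by (rule mix_sqi[OF YI(1) T_in YI_bound[OF _ T_in]]; assumption)+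
  have sYL: "square_integrable M (\<lambda>\<omega>. Re (mix YL T \<omega>))" "square_integrable M (\<lambda>\<omega>. Im (mix YL T \<omega>))"
    by (rule mix_sqi[OF YL(1) T_in YL_bound[OF _ T_in]]; assumption)+
  have sIH: "square_integrable M (\<lambda>\<omega>. Re (complex_of_real (IH T \<omega>)))" "square_integrable M (\<lambda>\<omega>. Im (complex_of_real (IH T \<omega>)))"
    using sq_martingale_sqi[OF IH_martingale T_in] by (simp_all add: square_integrable_zero)
  have sLT: "square_integrable M (\<lambda>\<omega>. Re (complex_of_real (L T \<omega>)))" "square_integrable M (\<lambda>\<omega>. Im (complex_of_real (L T \<omega>)))"
    using sq_martingale_sqi[OF L_martingale T_in] by (simp_all add: square_integrable_zero)
  have sD: "square_integrable M (\<lambda>\<omega>. Re (D \<omega>))" "square_integrable M (\<lambda>\<omega>. Im (D \<omega>))"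
    using square_integrable_diff[OF sIH(1) sYI(1)] square_integrable_diff[OF sIH(2) sYI(2)] by (simp_all add: D_def)
  \<comment> \<open>Here \<open>D\<close> is read as \<open>mix YL T\<close> minus
    \<open>L T\<close>.\<close>
  have De: "(\<integral>\<omega>. complex_of_real (elem_integral S E T \<omega>) * D \<omega> \<partial>M) = 0" if E: "elementary M F T E" for E
  proof -
    let ?e = "elem_integral S E T"
    note X = sqi_elem_integral[OF E]
    have "(\<integral>\<omega>. complex_of_real (?e \<omega>) * D \<omega> \<partial>M) =
        (\<integral>\<omega>. complex_of_real (?e \<omega>) * mix YL T \<omega> - complex_of_real (?e \<omega>) * complex_of_real (L T \<omega>) \<partial>M)"
    proof (rule integral_cong_AE)
      show "AE \<omega> in M. complex_of_real (?e \<omega>) * D \<omega> =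
          complex_of_real (?e \<omega>) * mix YL T \<omega> - complex_of_real (?e \<omega>) * complex_of_real (L T \<omega>)"
        using defect_eq[OF T_in] by eventually_elim (simp only: D_def right_diff_distrib[symmetric])
    qed (use complex_inner_integral(1)[OF X sD] complex_inner_integral(1)[OF X sYL] complex_inner_integral(1)[OF X sLT]
        in \<open>auto intro!: borel_measurable_diff borel_measurable_integrable\<close>)
    also have "\<dots> = 0 - (\<integral>\<omega>. complex_of_real (?e \<omega>) * complex_of_real (L T \<omega>) \<partial>M)"
      using complex_inner_integral(1)[OF X sYL] complex_inner_integral(1)[OF X sLT] mix_YL_orth[OF E]
      by (subst Bochner_Integration.integral_diff) simp_all
    also have "\<dots> = 0"
      unfolding complex_inner_integral(2)[OF X sLT]
      using covariation_zero_orth[OF L_martingale L_cov E] by (simp add: mult.commute complex_eq_iff)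
    finally show ?thesis .
  qed
  \<comment> \<open>Here \<open>D\<close> is read as \<open>IH T\<close> minus
    \<open>mix YI T\<close>: what is orthogonal to elementary integrals is orthogonal to all
    integrals, and hence to their mixture.\<close>
  have XD: "(\<integral>\<omega>. complex_of_real (X \<omega>) * D \<omega> \<partial>M) = 0"
    if X: "square_integrable M X" and orth: "\<And>E. elementary M F T E \<Longrightarrow> (\<integral>\<omega>. X \<omega> * elem_integral S E T \<omega> \<partial>M) = 0" for X
  proof -
    have o: "(\<integral>\<omega>. X \<omega> * V \<omega> \<partial>M) = 0" if "ito \<psi> V" for \<psi> V
      by (rule ito_orth[OF that X orth])
    have "(\<integral>\<omega>. complex_of_real (X \<omega>) * mix YI T \<omega> \<partial>M) = 0"
      unfolding mix_YI_inner[OF X] o[OF ito_Iz(1)[OF strip_point_in]] o[OF ito_Iz(2)[OF strip_point_in]]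
      by (simp add: zero_complex.code[symmetric])
    moreover have "(\<integral>\<omega>. complex_of_real (X \<omega>) * complex_of_real (IH T \<omega>) \<partial>M) = 0"
      unfolding complex_inner_integral(2)[OF X sIH] using o[OF stoch_integral_ito[OF IH(1)]] by (simp add: complex_eq_iff)
    ultimately show ?thesis
      using complex_inner_integral(1)[OF X sYI] complex_inner_integral(1)[OF X sIH]
      by (simp add: D_def right_diff_distrib)
  qed
  have e: "(\<integral>\<omega>. Re (D \<omega>) * elem_integral S E T \<omega> \<partial>M) = 0" "(\<integral>\<omega>. Im (D \<omega>) * elem_integral S E T \<omega> \<partial>M) = 0"
    if E: "elementary M F T E" for E
    using De[OF E] unfolding complex_inner_integral(2)[OF sqi_elem_integral[OF E] sD]
    by (simp_all add: complex_eq_iff mult.commute)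
  \<comment> \<open>By \<open>e\<close>, the real and the imaginary part of \<open>D\<close> are
    themselves admissible test functions in \<open>XD\<close>.\<close>
  have "(\<integral>\<omega>. Re (D \<omega>) * Re (D \<omega>) \<partial>M) = 0" "(\<integral>\<omega>. Im (D \<omega>) * Im (D \<omega>) \<partial>M) = 0"
    using XD[OF sD(1) e(1)] XD[OF sD(2) e(2)]
    unfolding complex_inner_integral(2)[OF sD(1) sD] complex_inner_integral(2)[OF sD(2) sD]
    by (simp_all add: complex_eq_iff)
  then have "AE \<omega> in M. Re (D \<omega>) = 0" "AE \<omega> in M. Im (D \<omega>) = 0"
    using integral_square_eq_0_iff[OF sD(1)] integral_square_eq_0_iff[OF sD(2)] by (simp_all add: power2_eq_square)
  then show ?thesis by eventually_elim (simp add: D_def complex_eq_iff)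
qed

lemma IH_mix: "t \<in> {0..T} \<Longrightarrow> AE \<omega> in M. complex_of_real (IH t \<omega>) = mix YI t \<omega>"
  by (rule mix_martingale[OF YI Iz_martingale Iz_bound sq_martingale_of_real[OF IH_martingale] IH_terminal])

lemma L_mix:
  assumes t: "t \<in> {0..T}"
  shows "AE \<omega> in M. complex_of_real (L t \<omega>) = mix YL t \<omega>"
  using defect_eq[OF t] IH_mix[OF t] by eventually_elim simp

lemma mix_\<theta>z_measurable: "(\<lambda>x. mix \<theta>z (fst x) (snd x)) \<in> borel_measurable P"
proof -
  have 1: "(\<lambda>p. (fst p, strip_point R (snd p))) \<in> measurable (P \<Otimes>\<^sub>M lborel) (P \<Otimes>\<^sub>M Z)"
    by (intro measurable_Pair measurable_fst measurable_compose[OF measurable_snd strip_point_measurable])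
  have 2: "(\<lambda>p. \<theta>z (snd p) (fst (fst p)) (snd (fst p))) \<in> borel_measurable (P \<Otimes>\<^sub>M Z)"
    using \<theta>z_joint by (simp add: jointly_predictable_def case_prod_beta')
  from measurable_compose[OF 1 2]
  have "(\<lambda>p. \<theta>z (strip_point R (snd p)) (fst (fst p)) (snd (fst p))) \<in> borel_measurable (P \<Otimes>\<^sub>M lborel)"
    by simp
  note [measurable] = this borel_measurable_integrable[OF weight_integrable]
  show ?thesis unfolding mix_eq by measurable
qed

text \<open>Against an elementary integrand, \<open>\<theta>z z\<close> pairs over \<open>Q\<close>
  as \<open>Iz z T\<close> does over \<open>M\<close>. Mixing both sides and inserting
  \<open>IH_terminal\<close> gives the pairing of \<open>\<theta>\<close>. Since
  \<open>\<theta>\<close> is real, the imaginary part of the mixture is orthogonal to all elementary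
  integrands.\<close>

lemma integrand_mix:
  "AE x in Q. zeta_integrable h R (\<lambda>z. \<theta>z z (fst x) (snd x)) \<and> complex_of_real (\<theta> (fst x) (snd x)) = mix \<theta>z (fst x) (snd x)"
proof -
  define Y where "Y p = \<theta>z (strip_point R (snd p)) (fst (fst p)) (snd (fst p))" for p
  have Y: "Y \<in> borel_measurable (Q \<Otimes>\<^sub>M lborel)"
  proof -
    have "(\<lambda>p. (fst p, strip_point R (snd p))) \<in> measurable (Q \<Otimes>\<^sub>M lborel) (Q \<Otimes>\<^sub>M Z)"
      by (intro measurable_Pair measurable_fst measurable_compose[OF measurable_snd strip_point_measurable])
    from measurable_compose[OF this \<theta>z_measurable] show ?thesis by (simp add: Y_def[abs_def])
  qed
  have b: "(\<integral>\<^sup>+x. ennreal ((norm (Y (x, y)))\<^sup>2) \<partial>Q) \<le> ennreal K" for y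
    using \<theta>z_bound[OF strip_point_in] by (simp add: Y_def)
  note m = finite_Q lborel.sigma_finite_measure_axioms Y weight_integrable b
  define g where "g x = mix \<theta>z (fst x) (snd x)" for x
  have g: "g x = (\<integral>y. Y (x, y) * weight y \<partial>lborel)" for x
    by (simp add: g_def mix_eq Y_def)
  have sg: "square_integrable Q (\<lambda>x. Re (g x))" "square_integrable Q (\<lambda>x. Im (g x))"
    unfolding g using mixture_measurable[OF m] mixture_bound[OF m] by (rule square_integrable_Re_Im)+
  note s\<theta> = ito_sqi(1)[OF stoch_integral_ito[OF IH(1)]]
  have inner: "(\<integral>x. elem_process E (fst x) (snd x) * Re (g x) \<partial>Q) = (\<integral>x. elem_process E (fst x) (snd x) * \<theta> (fst x) (snd x) \<partial>Q)"
    "(\<integral>x. elem_process E (fst x) (snd x) * Im (g x) \<partial>Q) = 0" if E: "elementary M F T E" for E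
  proof -
    let ?p = "\<lambda>x. elem_process E (fst x) (snd x)"
    let ?e = "elem_integral S E T"
    note sp = sqi_elem_process[OF E] and se = sqi_elem_integral[OF E] and iE = ito_elem[OF E]
    have sIH: "square_integrable M (\<lambda>\<omega>. Re (complex_of_real (IH T \<omega>)))" "square_integrable M (\<lambda>\<omega>. Im (complex_of_real (IH T \<omega>)))"
      using sq_martingale_sqi[OF IH_martingale T_in] by (simp_all add: square_integrable_zero)
    have slice: "(\<integral>x. complex_of_real (?p x) * Y (x, y) \<partial>Q) =
        Complex (\<integral>\<omega>. ?e \<omega> * Re (Iz (strip_point R y) T \<omega>) \<partial>M) (\<integral>\<omega>. ?e \<omega> * Im (Iz (strip_point R y) T \<omega>) \<partial>M)" for y
    proof -
      note i = ito_Iz[OF strip_point_in[of R y]]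
      show ?thesis
        using complex_inner_integral(2)[OF sp ito_sqi(1)[OF i(1)] ito_sqi(1)[OF i(2)]]
        unfolding ito_inner[OF iE i(1)] ito_inner[OF iE i(2)] by (simp add: Y_def)
    qed
    have "(\<integral>x. complex_of_real (?p x) * g x \<partial>Q) = (\<integral>y. (\<integral>x. complex_of_real (?p x) * Y (x, y) \<partial>Q) * weight y \<partial>lborel)"
      using mixture_inner[OF m sp] unfolding g by blast
    also have "\<dots> = (\<integral>\<omega>. complex_of_real (?e \<omega>) * mix YI T \<omega> \<partial>M)"
      unfolding slice mix_YI_inner[OF se] ..
    also have "\<dots> = (\<integral>\<omega>. complex_of_real (?e \<omega>) * complex_of_real (IH T \<omega>) \<partial>M)"
    proof (rule integral_cong_AE)
      show "(\<lambda>\<omega>. complex_of_real (?e \<omega>) * mix YI T \<omega>) \<in> borel_measurable M"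
        using mix_measurable(2)[OF YI(1) T_in] square_integrableD(1)[OF se] by simp
      show "(\<lambda>\<omega>. complex_of_real (?e \<omega>) * complex_of_real (IH T \<omega>)) \<in> borel_measurable M"
        by (rule borel_measurable_integrable[OF complex_inner_integral(1)[OF se sIH]])
      show "AE \<omega> in M. complex_of_real (?e \<omega>) * mix YI T \<omega> = complex_of_real (?e \<omega>) * complex_of_real (IH T \<omega>)"
        using IH_terminal by eventually_elim simp
    qed
    finally have "Complex (\<integral>x. ?p x * Re (g x) \<partial>Q) (\<integral>x. ?p x * Im (g x) \<partial>Q) = Complex (\<integral>\<omega>. ?e \<omega> * IH T \<omega> \<partial>M) 0"
      unfolding complex_inner_integral(2)[OF sp sg] complex_inner_integral(2)[OF se sIH] by simp
    then show "(\<integral>x. ?p x * Re (g x) \<partial>Q) = (\<integral>x. ?p x * \<theta> (fst x) (snd x) \<partial>Q)" "(\<integral>x. ?p x * Im (g x) \<partial>Q) = 0"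
      using ito_inner[OF iE stoch_integral_ito[OF IH(1)]] by simp_all
  qed
  have "AE x in Q. Re (g x) - \<theta> (fst x) (snd x) = 0"
  proof (rule elementary_dense[OF square_integrable_diff[OF sg(1) s\<theta>]])
    fix E assume E: "elementary M F T E"
    show "(\<integral>x. elem_process E (fst x) (snd x) * (Re (g x) - \<theta> (fst x) (snd x)) \<partial>Q) = 0"
      using inner(1)[OF E] square_integrable_mult[OF sqi_elem_process[OF E] sg(1)] square_integrable_mult[OF sqi_elem_process[OF E] s\<theta>]
      by (simp add: right_diff_distrib)
  qed
  moreover have "AE x in Q. Im (g x) = 0"
    by (rule elementary_dense[OF sg(2) inner(2)])
  moreover have "AE x in Q. zeta_integrable h R (\<lambda>z. \<theta>z z (fst x) (snd x))"
    using mixture_AE_integrable[OF m] by (simp add: zeta_integrable_iff Y_def)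
  ultimately show ?thesis
    by eventually_elim (simp add: g_def complex_eq_iff)
qed

end

section \<open>Passage to modifications\<close>

context filtered_basis
begin

text \<open>The modification is adapted because every \<open>F t\<close> contains the null sets, and
  conditional expectations do not distinguish almost surely equal variables. Path regularity is a
  separate demand.\<close>

lemma martingale_cong:
  assumes U: "martingale M F T U" and eq: "\<And>t. t \<in> {0..T} \<Longrightarrow> AE \<omega> in M. U t \<omega> = V t \<omega>"
    and cad: "\<And>\<omega>. \<omega> \<in> space M \<Longrightarrow> cadlag_on T (\<lambda>t. V t \<omega>)"
  shows "martingale M F T V"
proof -
  have mF: "V t \<in> borel_measurable (F t)" if t: "t \<in> {0..T}" for t
  proof (rule measurable_F_cong_AE[OF _ eq[OF t] t])
    show "U t \<in> borel_measurable (F t)" using U t by (simp add: martingale_def)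
  qed simp
  have mM: "U t \<in> borel_measurable M" "V t \<in> borel_measurable M" if t: "t \<in> {0..T}" for t
    using measurable_F_imp_M[OF mF[OF t] t] U t by (auto simp: martingale_def)
  have int: "integrable M (V t)" if t: "t \<in> {0..T}" for t
    using U t integrable_cong_AE[OF mM(1)[OF t] mM(2)[OF t] eq[OF t]] by (simp add: martingale_def)
  have ce: "AE \<omega> in M. real_cond_exp M (F s) (V t) \<omega> = V s \<omega>" if st: "0 \<le> s" "s \<le> t" "t \<le> T" for s t
  proof -
    have T: "s \<in> {0..T}" "t \<in> {0..T}" using st by auto
    interpret sigma_finite_subalgebra M "F s" by (rule sigma_finite_subalg[OF T(1)])
    have "AE \<omega> in M. real_cond_exp M (F s) (U t) \<omega> = U s \<omega>"
      using U st by (simp add: martingale_def)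
    then show ?thesis
      using real_cond_exp_cong[OF eq[OF T(2)] mM[OF T(2)]] eq[OF T(1)] by eventually_elim simp
  qed
  show ?thesis
    unfolding martingale_def using mF int ce cad by blast
qed

lemma sq_martingale_cong:
  assumes U: "sq_martingale M F T U" and eq: "\<And>t. t \<in> {0..T} \<Longrightarrow> AE \<omega> in M. U t \<omega> = V t \<omega>"
    and cad: "\<And>\<omega>. \<omega> \<in> space M \<Longrightarrow> cadlag_on T (\<lambda>t. V t \<omega>)"
  shows "sq_martingale M F T V"
proof -
  have V: "martingale M F T V"
    using U by (intro martingale_cong[OF _ eq cad]) (simp_all add: sq_martingale_def)
  have "integrable M (\<lambda>\<omega>. (V t \<omega>)\<^sup>2)" if t: "t \<in> {0..T}" for t
  proof -
    have "V t \<in> borel_measurable M" using V t by (auto simp: martingale_def)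
    from square_integrableD(2)[OF square_integrable_cong_AE[OF sq_martingale_sqi[OF U t] this eq[OF t]]] show ?thesis .
  qed
  with V show ?thesis by (simp add: sq_martingale_def)
qed

end

context integrator
begin

lemma covariation_zeroI:
  assumes "martingale M F T (\<lambda>t \<omega>. U t \<omega> * S t \<omega>)"
  shows "covariation M F T U S (\<lambda>_ _. 0)"
  unfolding covariation_def
proof (intro conjI ballI)
  show "predictable M F T (\<lambda>_ _. 0)" by (simp add: predictable_def)
  show "cadlag_on T (\<lambda>_. 0)" by (rule cadlag_on_const)
  show "\<exists>f g. mono_on {0..T} f \<and> mono_on {0..T} g \<and> (\<forall>t\<in>{0..T}. (0::real) = f t - g t)"
    by (intro exI[of _ "\<lambda>_. 0"]) (simp add: mono_on_def)
qed (use assms in simp_all)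

lemma covariation_zero_cong:
  assumes L: "martingale M F T (\<lambda>t \<omega>. L t \<omega> * S t \<omega>)"
    and eq: "\<And>t. t \<in> {0..T} \<Longrightarrow> AE \<omega> in M. L t \<omega> = V t \<omega>"
    and cad: "\<And>\<omega>. \<omega> \<in> space M \<Longrightarrow> cadlag_on T (\<lambda>t. V t \<omega>)"
  shows "covariation M F T V S (\<lambda>_ _. 0)"
proof (rule covariation_zeroI, rule martingale_cong[OF L])
  show "AE \<omega> in M. L t \<omega> * S t \<omega> = V t \<omega> * S t \<omega>" if "t \<in> {0..T}" for t
    using eq[OF that] by eventually_elim simp
  show "cadlag_on T (\<lambda>t. V t \<omega> * S t \<omega>)" if "\<omega> \<in> space M" for \<omega>
    by (rule cadlag_on_mult[OF cad[OF that] sq_martingale_cadlag[OF S that]])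
qed

end

section \<open>The four claims\<close>

context fourier_claim
begin

text \<open>The definition quantifies over all jointly measurable versions. One of them with a
  uniform bound suffices, as any two almost surely share integrability and mixture at each
  time.\<close>

lemma eq_zeta_processI:
  assumes Y: "progressive_family Z Y" "\<And>z. z \<in> strip R \<Longrightarrow> indist M T (U z) (Y z)"
    and b: "\<And>z t. z \<in> strip R \<Longrightarrow> t \<in> {0..T} \<Longrightarrow> (\<integral>\<^sup>+\<omega>. ennreal ((norm (Y z t \<omega>))\<^sup>2) \<partial>M) \<le> ennreal K"
    and V: "\<And>t. t \<in> {0..T} \<Longrightarrow> AE \<omega> in M. V t \<omega> = mix Y t \<omega>"
  shows "eq_zeta_process M F T h R V U"
  unfolding eq_zeta_process_def joint_version_iff
proof (intro conjI allI impI ballI)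
  show "\<exists>Y. progressive_family Z Y \<and> (\<forall>z\<in>strip R. indist M T (U z) (Y z))" using Y by blast
next
  fix Y' t assume Y': "progressive_family Z Y' \<and> (\<forall>z\<in>strip R. indist M T (U z) (Y' z))" and t: "t \<in> {0..T}"
  have ae: "AE \<omega> in M. Y z t \<omega> = Y' z t \<omega>" if z: "z \<in> strip R" for z
  proof -
    have "indist M T (U z) (Y' z)" using Y' z by blast
    from indistD[OF this t] indistD[OF Y(2)[OF z] t] show ?thesis by eventually_elim simp
  qed
  have "AE \<omega> in M. (zeta_integrable h R (\<lambda>z. Y z t \<omega>) \<longleftrightarrow> zeta_integrable h R (\<lambda>z. Y' z t \<omega>)) \<and> mix Y t \<omega> = mix Y' t \<omega>"
  proof (rule mix_version[where U = Y and V = Y' and t = t])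
    show "(\<lambda>x. Y (strip_point R (snd x)) t (fst x)) \<in> borel_measurable (M \<Otimes>\<^sub>M lborel)"
      by (rule progressive_strip(2)[OF Y(1) t])
    show "(\<lambda>x. Y' (strip_point R (snd x)) t (fst x)) \<in> borel_measurable (M \<Otimes>\<^sub>M lborel)"
      by (rule progressive_strip(2)[OF conjunct1[OF Y'] t])
  qed (rule ae)
  moreover have "AE \<omega> in M. zeta_integrable h R (\<lambda>z. Y z t \<omega>)"
    by (rule mix_AE[OF Y(1) t b[OF _ t]])
  ultimately show "AE \<omega> in M. zeta_integrable h R (\<lambda>z. Y' z t \<omega>) \<and> V t \<omega> = mix Y' t \<omega>"
    using V[OF t] by eventually_elim simp
qed

text \<open>The mixed integrand agrees \<open>Q\<close>-almost everywhere with the real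
  \<open>\<theta>\<close>, so \<open>IH\<close>, with imaginary part zero, is an integral of
  it.\<close>

lemma stoch_integral_mix: "stoch_integral_c M F T S A (mix \<theta>z) (\<lambda>t \<omega>. complex_of_real (IH t \<omega>))"
  unfolding stoch_integral_c_def
proof
  have m: "(\<lambda>x. Re (mix \<theta>z (fst x) (snd x))) \<in> borel_measurable P" "(\<lambda>x. Im (mix \<theta>z (fst x) (snd x))) \<in> borel_measurable P"
    using mix_\<theta>z_measurable by simp_all
  have "AE x in Q. complex_of_real (\<theta> (fst x) (snd x)) = mix \<theta>z (fst x) (snd x)"
    using integrand_mix by eventually_elim blast
  then have ae: "AE x in Q. \<theta> (fst x) (snd x) = Re (mix \<theta>z (fst x) (snd x))" "AE x in Q. 0 = Im (mix \<theta>z (fst x) (snd x))"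
    by (auto elim!: eventually_mono simp: complex_eq_iff)
  show "stoch_integral M F T S A (\<lambda>t \<omega>. Re (mix \<theta>z t \<omega>)) (\<lambda>t \<omega>. Re (complex_of_real (IH t \<omega>)))"
  proof (rule ito_stoch_integral[OF m(1)])
    show "ito (\<lambda>x. Re (mix \<theta>z (fst x) (snd x))) (\<lambda>\<omega>. Re (complex_of_real (IH T \<omega>)))"
      using ito_cong[OF stoch_integral_ito[OF IH(1)] m(1) ae(1)] by simp
  qed (simp add: IH_martingale)
  \<comment> \<open>The empty elementary integrand is the witness.\<close>
  have "ito (\<lambda>x. 0) (\<lambda>\<omega>. 0)"
  proof -
    have "elem_integral S [] T = (\<lambda>\<omega>. 0)" by (rule ext) simp
    with ito_elem[OF elementary_Nil] show ?thesis by simp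
  qed
  from ito_cong[OF this m(2) ae(2)]
  show "stoch_integral M F T S A (\<lambda>t \<omega>. Im (mix \<theta>z t \<omega>)) (\<lambda>t \<omega>. Im (complex_of_real (IH t \<omega>)))"
    by (intro ito_stoch_integral[OF m(2)]) (simp_all add: sq_martingale_zero)
qed

lemma integrand_claim:
  "AE \<omega> in M. AE t in path_measure T A \<omega>. t \<in> {0..T} \<longrightarrow>
     zeta_integrable h R (\<lambda>z. \<theta>z z t \<omega>) \<and> complex_of_real (\<theta> t \<omega>) = mix \<theta>z t \<omega>"
  by (rule AE_Q_iterated[OF integrand_mix])

text \<open>Every integral of the mixed integrand is indistinguishable from \<open>IH\<close>, and
  \<open>IH\<close> is already known to be the mixture of \<open>YI\<close>.\<close>

lemma integral_claim:
  assumes J: "stoch_integral_c M F T S A (mix \<theta>z) J"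
  shows "eq_zeta_process M F T h R J Iz"
proof (rule eq_zeta_processI[OF YI YI_bound])
  fix t assume t: "t \<in> {0..T}"
  have "indist M T J (\<lambda>t \<omega>. complex_of_real (IH t \<omega>))"
    by (rule stoch_integral_c_unique[OF J stoch_integral_mix]) simp
  from indistD[OF this t] IH_mix[OF t] show "AE \<omega> in M. J t \<omega> = mix YI t \<omega>" by eventually_elim simp
qed

lemma orthogonal_claim: "eq_zeta_process M F T h R (\<lambda>t \<omega>. complex_of_real (L t \<omega>)) Lz"
  by (rule eq_zeta_processI[OF YL YL_bound L_mix])

text \<open>Being a mixture fixes \<open>\<Lambda>\<close> only up to modification. Cadlag paths
  improve this to indistinguishability from \<open>L\<close>, and the martingale property and the
  orthogonality to \<open>S\<close> carry over.\<close>

lemma gkw_claim: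
  assumes cad: "\<And>\<omega>. \<omega> \<in> space M \<Longrightarrow> cadlag_on T (\<lambda>t. \<Lambda> t \<omega>)" and \<Lambda>: "eq_zeta_process M F T h R \<Lambda> Lz"
  shows "gkw_c M F T S A (\<lambda>t \<omega>. complex_of_real (H t \<omega>)) (mix \<theta>z) \<Lambda>"
proof -
  have "joint_version M F T R Lz YL" unfolding joint_version_iff using YL by blast
  then have \<Lambda>_mix: "AE \<omega> in M. \<Lambda> t \<omega> = mix YL t \<omega>" if "t \<in> {0..T}" for t
    using \<Lambda> that unfolding eq_zeta_process_def by (auto elim!: allE[of _ YL] eventually_mono)
  have "AE \<omega> in M. complex_of_real (L t \<omega>) = \<Lambda> t \<omega>" if "t \<in> {0..T}" for t
    using \<Lambda>_mix[OF that] L_mix[OF that] by eventually_elim simp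
  \<comment> \<open>\<open>L\<close> is real, so the imaginary part of \<open>\<Lambda>\<close> is a
    modification of the zero martingale.\<close>
  then have ae: "AE \<omega> in M. L t \<omega> = Re (\<Lambda> t \<omega>)" "AE \<omega> in M. 0 = Im (\<Lambda> t \<omega>)" if "t \<in> {0..T}" for t
    using that by (auto elim!: eventually_mono simp: complex_eq_iff)
  have cadR: "cadlag_on T (\<lambda>t. Re (\<Lambda> t \<omega>))" "cadlag_on T (\<lambda>t. Im (\<Lambda> t \<omega>))" if "\<omega> \<in> space M" for \<omega>
    using cadlag_on_Re[OF cad[OF that]] cadlag_on_Im[OF cad[OF that]] by simp_all
  have mR: "sq_martingale M F T (\<lambda>t \<omega>. Re (\<Lambda> t \<omega>))"
    by (rule sq_martingale_cong[OF L_martingale ae(1) cadR(1)])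
  have mI: "sq_martingale M F T (\<lambda>t \<omega>. Im (\<Lambda> t \<omega>))"
    by (rule sq_martingale_cong[OF sq_martingale_zero ae(2) cadR(2)])
  have iR: "indist M T L (\<lambda>t \<omega>. Re (\<Lambda> t \<omega>))"
    by (rule indist_real_cadlagI[OF sq_martingale_cadlag[OF L_martingale] cadR(1) ae(1)])
  have iI: "indist M T (\<lambda>_ _. 0) (\<lambda>t \<omega>. Im (\<Lambda> t \<omega>))"
    by (rule indist_real_cadlagI[OF cadlag_on_const cadR(2) ae(2)])
  have i\<Lambda>: "indist M T (\<lambda>t \<omega>. complex_of_real (L t \<omega>)) \<Lambda>"
    using iR iI by (intro indist_complex) simp_all
  have z0: "0 \<in> {0..T}" using T_pos by simp
  have LS: "martingale M F T (\<lambda>t \<omega>. L t \<omega> * S t \<omega>)" using L_cov by (simp add: covariation_def)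
  have "AE \<omega> in M. L 0 \<omega> = 0" using H_gkw by (simp add: gkw_def)
  with indistD[OF i\<Lambda> z0] have \<Lambda>0: "AE \<omega> in M. \<Lambda> 0 \<omega> = 0"
    by eventually_elim simp
  have cR: "covariation M F T (\<lambda>t \<omega>. Re (\<Lambda> t \<omega>)) S (\<lambda>_ _. 0)"
    by (rule covariation_zero_cong[OF LS ae(1) cadR(1)])
  have "martingale M F T (\<lambda>t \<omega>. 0 * S t \<omega>)"
    using sq_martingale_zero by (simp add: sq_martingale_def)
  then have cI: "covariation M F T (\<lambda>t \<omega>. Im (\<Lambda> t \<omega>)) S (\<lambda>_ _. 0)"
    by (rule covariation_zero_cong[OF _ ae(2) cadR(2)])
  have ind: "indist M T (\<lambda>t \<omega>. complex_of_real (H t \<omega>))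
      (\<lambda>t \<omega>. complex_of_real (H 0 \<omega>) + complex_of_real (IH t \<omega>) + \<Lambda> t \<omega>)"
    using IH(2) i\<Lambda> unfolding indist_def
    by eventually_elim (rule ballI, drule (1) bspec, drule (1) bspec, simp only: of_real_add)
  have pred: "predictable M F T (mix \<theta>z)"
    using mix_\<theta>z_measurable by (simp add: predictable_def case_prod_beta')
  have "L2_energy M T A (mix \<theta>z) < \<infinity>"
  proof -
    have "stoch_integral M F T S A (\<lambda>t \<omega>. Re (mix \<theta>z t \<omega>)) (\<lambda>t \<omega>. Re (complex_of_real (IH t \<omega>)))"
      "stoch_integral M F T S A (\<lambda>t \<omega>. Im (mix \<theta>z t \<omega>)) (\<lambda>t \<omega>. Im (complex_of_real (IH t \<omega>)))"
      using stoch_integral_mix unfolding stoch_integral_c_def by blast+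
    note i = this[THEN stoch_integral_ito]
    show ?thesis
      unfolding L2_energy_eq[OF mix_\<theta>z_measurable] nn_integral_cmod_square[OF ito_sqi(1)[OF i(1)] ito_sqi(1)[OF i(2)]] by simp
  qed
  with pred have "L2_integrand M F T A (mix \<theta>z)" by (simp add: L2_integrand_def)
  moreover have "sq_martingale_c M F T \<Lambda>" using mR mI by (simp add: sq_martingale_c_def)
  ultimately show ?thesis
    unfolding gkw_c_def
    by (intro conjI exI[of _ "\<lambda>t \<omega>. complex_of_real (IH t \<omega>)"] sq_martingale_of_real H_martingale \<Lambda>0 cR cI stoch_integral_mix ind)
qed

end

theorem theorem4p6:
  fixes M :: "'a measure" and F :: "real \<Rightarrow> 'a measure" and T :: real
    and X\<^sub>T :: "'a \<Rightarrow> real ^ 'n" and R :: "real ^ 'n" and h :: "real ^ 'n \<Rightarrow> real"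
    and S A :: "real \<Rightarrow> 'a \<Rightarrow> real"
    and H \<theta> L :: "real \<Rightarrow> 'a \<Rightarrow> real"
    and Hz \<theta>z Lz Iz :: "complex ^ 'n \<Rightarrow> real \<Rightarrow> 'a \<Rightarrow> complex"
  assumes basis: "usual_basis M F T"
    and X_meas: "X\<^sub>T \<in> borel_measurable M"
    and X_exp: "integrable M (\<lambda>\<omega>. exp (2 * (R \<bullet> X\<^sub>T \<omega>)))"
    and h_meas: "h \<in> borel_measurable borel"
    and h_fourier: "fourier_representation h R"
    and h_sq: "integrable M (\<lambda>\<omega>. (h (X\<^sub>T \<omega>))\<^sup>2)"
    and H_def: "\<And>t. t \<in> {0..T} \<Longrightarrow>
      AE \<omega> in M. H t \<omega> = real_cond_exp M (F t) (\<lambda>\<omega>. h (X\<^sub>T \<omega>)) \<omega>"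
    and Hz_def: "\<And>z t. z \<in> strip R \<Longrightarrow> t \<in> {0..T} \<Longrightarrow>
      AE \<omega> in M. Hz z t \<omega> = cond_exp_c M (F t) (\<lambda>\<omega>. exp (pairing z (X\<^sub>T \<omega>))) \<omega>"
    and S_mart: "sq_martingale M F T S"
    and S_pos: "AE \<omega> in M. \<forall>t\<in>{0..T}. 0 < S t \<omega>"
    and A_def: "quad_variation M F T S A"
    and H_gkw: "gkw M F T S A H \<theta> L"
    and Hz_gkw: "\<And>z. z \<in> strip R \<Longrightarrow> gkw_c M F T S A (Hz z) (\<theta>z z) (Lz z)"
    and Iz_def: "\<And>z. z \<in> strip R \<Longrightarrow> stoch_integral_c M F T S A (\<theta>z z) (Iz z)"
    and Hz_joint: "jointly_progressive M F T R Hz"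
    and \<theta>z_joint: "jointly_predictable M F T R \<theta>z"
  shows "(AE \<omega> in M. AE t in path_measure T A \<omega>. t \<in> {0..T} \<longrightarrow>
            zeta_integrable h R (\<lambda>z. \<theta>z z t \<omega>) \<and>
            complex_of_real (\<theta> t \<omega>) = zeta_process h R \<theta>z t \<omega>)
       \<and> ((\<exists>J. stoch_integral_c M F T S A (zeta_process h R \<theta>z) J) \<and>
          (\<forall>J. stoch_integral_c M F T S A (zeta_process h R \<theta>z) J \<longrightarrow>
               eq_zeta_process M F T h R J Iz))
       \<and> eq_zeta_process M F T h R (\<lambda>t \<omega>. complex_of_real (L t \<omega>)) Lz
       \<and> (\<forall>\<Lambda>. (\<forall>\<omega>\<in>space M. cadlag_on T (\<lambda>t. \<Lambda> t \<omega>)) \<and> eq_zeta_process M F T h R \<Lambda> Lz \<longrightarrow>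
               gkw_c M F T S A (\<lambda>t \<omega>. complex_of_real (H t \<omega>)) (zeta_process h R \<theta>z) \<Lambda>)"
proof -
  interpret fourier_claim M F T S A h R X\<^sub>T H \<theta> L Hz \<theta>z Lz Iz
    by unfold_locales fact+
  show ?thesis
    using integrand_claim stoch_integral_mix integral_claim orthogonal_claim gkw_claim by blast
qed

end
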